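(* Let $V$ be an irreducible finite-dimensional representation of $Y(\mathfrak{sp}_2)$ which as an $\mathfrak{sp}_2$-representation is isomorphic to $V(\mu_1,p)\oplus\cdots\oplus V(\mu_k,p)$, where each $\mu_i$ is a non-positive integer and, if $p>0$, $p>2\max_i(-\mu_i)+2$. Then $V$ is a highest weight representation $V=V(\mu(u),p)$ for some $\mu(u)\in1+u^{-1}\mathbb K[[u^{-1}]]$, and there exists a monic polynomial $P(u)$ such that $P(u)=P(-u+1)$ and $$\frac{\mu(-u)}{\mu(u)}=\frac{P(u+1)}{P(u)}.$$
   Context: $\mathbb K$ is an algebraically closed field of characteristic $p\ne2$ ($p=0$ allowed). Rows and columns of $2\times2$ matrices are indexed by $\{-1,1\}$. $\theta_{ij}=\mathrm{sgn}(i)\,\mathrm{sgn}(j)$ and $(A')_{ij}=\theta_{ij}a_{-j,-i}$. $\mathfrak{sp}_2$ is spanned by $F_{ij}=E_{ij}-\theta_{ij}E_{-j,-i}$. $V(m,p)$, for an integer $m\le0$, is the simple $Sp_2$-module with highest weight $m$, i.e. with highest weight vector killed by $F_{-1,1}$ and on which $F_{11}$ acts by $m$ (regarded as an $\mathfrak{sp}_2$-module). $P=\sum E_{ij}\otimes E_{ji}$, $R(u)=1-P/u$, $R'(u)=1-P'/u$ where $P'$ is $P$ with $A\mapsto A'$ applied in the first tensor factor. $Y(\mathfrak{sp}_{2})$ is the unital associative algebra generated by $s_{ij}^{(r)}$ ($r\ge1$, $i,j\in\{-1,1\}$) with $\mathcal S(u)=[s_{ij}(u)]$, $s_{ij}(u)=\delta_{ij}+\sum_{r\ge1}s_{ij}^{(r)}u^{-r}$,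 and relations $R(u-v)\mathcal S_1(u)R'(-u-v)\mathcal S_2(v)=\mathcal S_2(v)R'(-u-v)\mathcal S_1(u)R(u-v)$ and $\mathcal S'(-u)=\mathcal S(u)-\frac{\mathcal S(u)-\mathcal S(-u)}{2u}$. The $\mathfrak{sp}_2$-action on a $Y(\mathfrak{sp}_2)$-module is via $F_{ij}\mapsto s_{ij}^{(1)}$. $V$ is a highest weight representation with highest weight $\mu(u)$ if it is generated by a nonzero $\xi$ with $s_{-1,1}(u)\xi=0$ and $s_{11}(u)\xi=\mu(u)\xi$; $V(\mu(u),p)$ denotes the irreducible one. *)

theory Defs
  imports
    "HOL-Library.Poly_Mapping"
    "HOL-Computational_Algebra.Formal_Laurent_Series"
    "HOL-Analysis.Finite_Cartesian_Product"
    "HOL-Algebra.QuotRing"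
begin

section \<open>Matrices indexed by {-1, 1}\<close>

datatype idx = MinusOne | PlusOne

lemma UNIV_idx: "UNIV = {MinusOne, PlusOne}"
  using idx.exhaust by auto

instantiation idx :: "{finite, uminus}"
begin

definition uminus_idx :: "idx \<Rightarrow> idx" where
  "- i = (case i of MinusOne \<Rightarrow> PlusOne | PlusOne \<Rightarrow> MinusOne)"

instance by standard (simp add: UNIV_idx)

end

definition sgn_idx :: "idx \<Rightarrow> 'a::ring_1" where
  "sgn_idx i = (case i of MinusOne \<Rightarrow> - 1 | PlusOne \<Rightarrow> 1)"

definition theta :: "idx \<Rightarrow> idx \<Rightarrow> 'a::ring_1" where
  "theta i j = sgn_idx i * sgn_idx j"

definition prime_mat :: "'a::ring_1 ^ idx ^ idx \<Rightarrow> 'a ^ idx ^ idx" where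
  "prime_mat A = (\<chi> i j. theta i j * A $ (- j) $ (- i))"

definition E_mat :: "idx \<Rightarrow> idx \<Rightarrow> 'a::ring_1 ^ idx ^ idx" where
  "E_mat i j = (\<chi> a b. if a = i \<and> b = j then 1 else 0)"

definition F_mat :: "idx \<Rightarrow> idx \<Rightarrow> 'a::ring_1 ^ idx ^ idx" where
  "F_mat i j = E_mat i j - (\<chi> a b. theta i j * E_mat (- j) (- i) $ a $ b)"

definition tensor_mat ::
  "'a::ring_1 ^ idx ^ idx \<Rightarrow> 'a ^ idx ^ idx \<Rightarrow> 'a ^ (idx \<times> idx) ^ (idx \<times> idx)" where
  "tensor_mat A B = (\<chi> a b. A $ fst a $ fst b * B $ snd a $ snd b)"

definition P_mat :: "'a::ring_1 ^ (idx \<times> idx) ^ (idx \<times> idx)" where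
  "P_mat = (\<Sum>i\<in>UNIV. \<Sum>j\<in>UNIV. tensor_mat (E_mat i j) (E_mat j i))"

definition P'_mat :: "'a::ring_1 ^ (idx \<times> idx) ^ (idx \<times> idx)" where
  "P'_mat = (\<Sum>i\<in>UNIV. \<Sum>j\<in>UNIV. tensor_mat (prime_mat (E_mat i j)) (E_mat j i))"


section \<open>The free algebra on the generators\<close>

datatype 'g word = Word "'g list"

instantiation word :: (type) monoid_add
begin

definition zero_word :: "'a word" where
  "0 = Word []"

definition plus_word :: "'a word \<Rightarrow> 'a word \<Rightarrow> 'a word" where
  "v + w = (case v of Word xs \<Rightarrow> case w of Word ys \<Rightarrow> Word (xs @ ys))"

instance by standard (auto simp: zero_word_def plus_word_def split: word.splits)

end

text \<open>Words form a monoid under concatenation (written additively, as \<open>poly_mapping\<close> requires),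
  so the convolution product makes this type the free unital associative \<open>'k\<close>-algebra. The
  letter \<open>(i, j, r)\<close> stands for the generator with upper index \<open>r + 1\<close>.\<close>

type_synonym 'k free_alg = "(idx \<times> idx \<times> nat) word \<Rightarrow>\<^sub>0 'k"

definition free_scalar :: "'k::field \<Rightarrow> 'k free_alg" where
  "free_scalar c = Poly_Mapping.single 0 c"

text \<open>The coefficient of \<open>u\<^sup>-\<^sup>r\<close> in \<open>s\<^sub>i\<^sub>j(u)\<close>.\<close>

definition s_free :: "idx \<Rightarrow> idx \<Rightarrow> nat \<Rightarrow> 'k::field free_alg" where
  "s_free i j r =
     (case r of 0 \<Rightarrow> (if i = j then 1 else 0)
      | Suc q \<Rightarrow> Poly_Mapping.single (Word [(i, j, q)]) 1)"


section \<open>The defining relations\<close>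

text \<open>The reflection equation is read in \<open>A((v\<inverse>))((u\<inverse>))\<close>, realised as \<open>'a fls fls\<close>
  with outer variable \<open>u\<inverse>\<close> and inner variable \<open>v\<inverse>\<close>. Thus \<open>1/(u - c)\<close> denotes its expansion
  in powers of \<open>u\<inverse>\<close>.\<close>

definition inv_u_minus :: "'a::ring_1 fls \<Rightarrow> 'a fls fls" where
  "inv_u_minus c = fps_to_fls (Abs_fps (\<lambda>r. if r = 0 then 0 else c ^ (r - 1)))"

lemma inv_u_minus_right: "(fls_X_inv - fls_const c) * inv_u_minus c = 1"
proof -
  have "fls_X * ((fls_X_inv - fls_const c) * inv_u_minus c) = (fls_X :: 'a::ring_1 fls fls)"
  proof -
    have 1: "fls_X * (fls_X_inv - fls_const c) = fps_to_fls (1 - fps_X * fps_const c)"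
      by (simp add: algebra_simps fls_times_fps_to_fls fls_X_times_conv_shift
          fls_X_inv_conv_shift_1)
    have 2: "(1 - fps_X * fps_const c) * Abs_fps (\<lambda>r. if r = 0 then 0 else c ^ (r - 1)) = fps_X"
      (is "_ * ?G = _")
    proof (rule fps_ext)
      fix n
      have "fps_nth ((1 - fps_X * fps_const c) * ?G) n
            = fps_nth ?G n - (if n = 0 then 0 else c * fps_nth ?G (n - 1))"
        by (simp add: left_diff_distrib mult.assoc)
      also have "\<dots> = fps_nth fps_X n"
        by (cases n; cases "n - 1") (auto simp: fps_X_def)
      finally show "fps_nth ((1 - fps_X * fps_const c) * ?G) n = fps_nth fps_X n" .
    qed
    show ?thesis
      unfolding mult.assoc [symmetric] 1 inv_u_minus_def fls_times_fps_to_fls [symmetric] 2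
      by simp
  qed
  then have "fls_X_inv * (fls_X * ((fls_X_inv - fls_const c) * inv_u_minus c))
             = fls_X_inv * (fls_X :: 'a fls fls)"
    by simp
  then show ?thesis
    by (simp add: mult.assoc [symmetric] fls_X_inv_times_conv_shift fls_X_conv_shift_1)
qed

lemma inv_u_minus_minus_v:
  "(- fls_X_inv - fls_const fls_X_inv) * (- inv_u_minus (- fls_X_inv))
     = (1 :: 'a::ring_1 fls fls)"
  using inv_u_minus_right [of "- fls_X_inv :: 'a fls"]
  by (simp add: minus_mult_left [symmetric] algebra_simps)

definition R_mat ::
  "'a \<Rightarrow> 'a::ring_1 ^ (idx \<times> idx) ^ (idx \<times> idx) \<Rightarrow> 'a ^ (idx \<times> idx) ^ (idx \<times> idx)" where
  "R_mat w Q = mat 1 - (\<chi> a b. w * Q $ a $ b)"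

definition R_uv :: "'a::ring_1 fls fls ^ (idx \<times> idx) ^ (idx \<times> idx)" where
  "R_uv = R_mat (inv_u_minus fls_X_inv) P_mat"

text \<open>Here \<open>1/(-u - v) = - 1/(u - (-v))\<close>, see \<open>inv_u_minus_minus_v\<close>.\<close>

definition R'_uv :: "'a::ring_1 fls fls ^ (idx \<times> idx) ^ (idx \<times> idx)" where
  "R'_uv = R_mat (- inv_u_minus (- fls_X_inv)) P'_mat"

definition S1_u :: "'k::field free_alg fls fls ^ (idx \<times> idx) ^ (idx \<times> idx)" where
  "S1_u = tensor_mat
     (\<chi> i j. fps_to_fls (Abs_fps (\<lambda>r. fls_const (s_free i j r)))) (mat 1)"

definition S2_v :: "'k::field free_alg fls fls ^ (idx \<times> idx) ^ (idx \<times> idx)" where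
  "S2_v = tensor_mat (mat 1)
     (\<chi> i j. fls_const (fps_to_fls (Abs_fps (s_free i j))))"

definition reflection_defect :: "'k::field free_alg fls fls ^ (idx \<times> idx) ^ (idx \<times> idx)" where
  "reflection_defect =
     R_uv ** S1_u ** R'_uv ** S2_v - S2_v ** R'_uv ** S1_u ** R_uv"

text \<open>For series in \<open>u\<inverse>\<close>: replace \<open>u\<close> by \<open>-u\<close>.\<close>

definition neg_u :: "'a::ring_1 fps \<Rightarrow> 'a fps" where
  "neg_u f = Abs_fps (\<lambda>r. (- 1) ^ r * fps_nth f r)"

definition S_u :: "'k::field free_alg fps ^ idx ^ idx" where
  "S_u = (\<chi> i j. Abs_fps (s_free i j))"

definition S_neg_u :: "'k::field free_alg fps ^ idx ^ idx" where
  "S_neg_u = (\<chi> i j. neg_u (S_u $ i $ j))"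

definition symmetry_defect :: "'k::field free_alg fps ^ idx ^ idx" where
  "symmetry_defect = prime_mat S_neg_u
     - (S_u - (\<chi> i j. fps_const (free_scalar (1 / 2)) * fps_X * (S_u - S_neg_u) $ i $ j))"

definition yangian_relators :: "'k::field free_alg set" where
  "yangian_relators =
     {fls_nth (fls_nth (reflection_defect $ a $ b) m) n | a b m n. True} \<union>
     {fps_nth (symmetry_defect $ i $ j) r | i j r. True}"


section \<open>The twisted Yangian and its representations\<close>

definition free_ring :: "'k::field free_alg ring" where
  "free_ring = \<lparr>carrier = UNIV, mult = (*), one = 1, zero = 0, add = (+)\<rparr>"

lemma ring_free_ring: "ring (free_ring :: 'k::field free_alg ring)"
proof (rule ringI)
  show "abelian_group (free_ring :: 'k free_alg ring)"
  proof (rule abelian_groupI)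
    fix x :: "'k free_alg"
    show "\<exists>y\<in>carrier free_ring. y \<oplus>\<^bsub>free_ring\<^esub> x = \<zero>\<^bsub>free_ring\<^esub>"
      by (rule bexI [of _ "- x"]) (simp_all add: free_ring_def)
  qed (auto simp: free_ring_def algebra_simps)
  show "Group.monoid (free_ring :: 'k free_alg ring)"
    by (rule Group.monoidI) (auto simp: free_ring_def algebra_simps)
qed (auto simp: free_ring_def algebra_simps)

definition yangian_ideal :: "'k::field free_alg set" where
  "yangian_ideal = genideal free_ring yangian_relators"

definition yangian :: "'k::field free_alg set ring" where
  "yangian = free_ring Quot yangian_ideal"

definition yangian_class :: "'k::field free_alg \<Rightarrow> 'k free_alg set" where
  "yangian_class x = yangian_ideal +>\<^bsub>free_ring\<^esub> x"

lemma yangian_ideal_ideal: "ideal (yangian_ideal :: 'k::field free_alg set) free_ring"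
  unfolding yangian_ideal_def
  by (rule ring.genideal_ideal [OF ring_free_ring]) (simp add: free_ring_def)

lemma ring_yangian: "ring (yangian :: 'k::field free_alg set ring)"
  unfolding yangian_def by (rule ideal.quotient_is_ring [OF yangian_ideal_ideal])

definition End_ring :: "('k::field \<Rightarrow> 'v \<Rightarrow> 'v::ab_group_add) \<Rightarrow> ('v \<Rightarrow> 'v) ring" where
  "End_ring scl =
     \<lparr>carrier = {f. Vector_Spaces.linear scl scl f}, mult = (\<circ>), one = id,
      zero = (\<lambda>_. 0), add = (\<lambda>f g v. f v + g v)\<rparr>"

text \<open>A representation of the \<open>'k\<close>-algebra \<open>yangian\<close> on the vector space \<open>'v\<close>; the last clause says
  that the ring homomorphism is \<open>'k\<close>-linear.\<close>

definition yangian_rep ::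
  "('k::field \<Rightarrow> 'v \<Rightarrow> 'v::ab_group_add) \<Rightarrow> ('k free_alg set \<Rightarrow> 'v \<Rightarrow> 'v) \<Rightarrow> bool" where
  "yangian_rep scl \<rho> \<longleftrightarrow>
     vector_space scl \<and>
     \<rho> \<in> ring_hom yangian (End_ring scl) \<and>
     (\<forall>c. \<rho> (yangian_class (free_scalar c)) = scl c)"

definition s_act ::
  "('k::field free_alg set \<Rightarrow> 'v \<Rightarrow> 'v) \<Rightarrow> idx \<Rightarrow> idx \<Rightarrow> nat \<Rightarrow> 'v \<Rightarrow> 'v" where
  "s_act \<rho> i j r = \<rho> (yangian_class (s_free i j r))"

definition fin_dim :: "('k::field \<Rightarrow> 'v \<Rightarrow> 'v::ab_group_add) \<Rightarrow> bool" where
  "fin_dim scl \<longleftrightarrow> (\<exists>B. finite B \<and> module.span scl B = UNIV)"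

definition yangian_submodule ::
  "('k::field \<Rightarrow> 'v \<Rightarrow> 'v::ab_group_add) \<Rightarrow> ('k free_alg set \<Rightarrow> 'v \<Rightarrow> 'v) \<Rightarrow> 'v set \<Rightarrow> bool"
  where
  "yangian_submodule scl \<rho> U \<longleftrightarrow>
     module.subspace scl U \<and> (\<forall>y\<in>carrier yangian. \<rho> y ` U \<subseteq> U)"

definition irreducible_rep ::
  "('k::field \<Rightarrow> 'v \<Rightarrow> 'v::ab_group_add) \<Rightarrow> ('k free_alg set \<Rightarrow> 'v \<Rightarrow> 'v) \<Rightarrow> bool" where
  "irreducible_rep scl \<rho> \<longleftrightarrow>
     yangian_rep scl \<rho> \<and> (UNIV :: 'v set) \<noteq> {0} \<and>
     (\<forall>U. yangian_submodule scl \<rho> U \<longrightarrow> U = {0} \<or> U = UNIV)"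

definition highest_weight_rep ::
  "('k::field \<Rightarrow> 'v \<Rightarrow> 'v::ab_group_add) \<Rightarrow> ('k free_alg set \<Rightarrow> 'v \<Rightarrow> 'v) \<Rightarrow> 'k fps \<Rightarrow> bool"
  where
  "highest_weight_rep scl \<rho> \<mu> \<longleftrightarrow>
     yangian_rep scl \<rho> \<and>
     (\<exists>\<xi>. \<xi> \<noteq> 0 \<and>
        (\<forall>U. yangian_submodule scl \<rho> U \<and> \<xi> \<in> U \<longrightarrow> U = UNIV) \<and>
        (\<forall>r. s_act \<rho> MinusOne PlusOne r \<xi> = 0) \<and>
        (\<forall>r. s_act \<rho> PlusOne PlusOne r \<xi> = scl (fps_nth \<mu> r) \<xi>))"


section \<open>The modules $V(m,p)$\<close>

text \<open>In positive characteristic a simple \<open>sp\<^sub>2\<close>-module is not determined by the eigenvalue of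
  \<open>F\<^sub>1\<^sub>1\<close> on a vector killed by \<open>F\<^sub>-\<^sub>1\<^sub>,\<^sub>1\<close>, so the simple modules are taken over the algebraic
  group, and the Lie algebra acts by the differential.\<close>

definition Sp2 :: "('k::field ^ idx ^ idx) set" where
  "Sp2 = {g. prime_mat g ** g = mat 1}"

definition torus_elt :: "'k::field \<Rightarrow> 'k ^ idx ^ idx" where
  "torus_elt t =
     (\<chi> i j. if i \<noteq> j then 0 else case i of PlusOne \<Rightarrow> t | MinusOne \<Rightarrow> inverse t)"

definition unip_elt :: "'k::field \<Rightarrow> 'k ^ idx ^ idx" where
  "unip_elt t = mat 1 + (\<chi> i j. t * E_mat MinusOne PlusOne $ i $ j)"

text \<open>\<open>W\<close> is a subspace of an ambient vector space and \<open>\<pi>\<close> need only be meaningful on \<open>Sp2\<close>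
  and \<open>W\<close>.\<close>

definition Sp2_rep ::
  "('k::field \<Rightarrow> 'w \<Rightarrow> 'w::ab_group_add) \<Rightarrow> ('k ^ idx ^ idx \<Rightarrow> 'w \<Rightarrow> 'w) \<Rightarrow> 'w set \<Rightarrow> bool"
  where
  "Sp2_rep scl \<pi> W \<longleftrightarrow>
     module.subspace scl W \<and>
     (\<forall>g\<in>Sp2. \<forall>w\<in>W. \<pi> g w \<in> W) \<and>
     (\<forall>g\<in>Sp2. \<forall>v\<in>W. \<forall>w\<in>W. \<pi> g (v + w) = \<pi> g v + \<pi> g w) \<and>
     (\<forall>g\<in>Sp2. \<forall>c. \<forall>w\<in>W. \<pi> g (scl c w) = scl c (\<pi> g w)) \<and>
     (\<forall>w\<in>W. \<pi> (mat 1) w = w) \<and>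
     (\<forall>g\<in>Sp2. \<forall>h\<in>Sp2. \<forall>w\<in>W. \<pi> (g ** h) w = \<pi> g (\<pi> h w))"

definition Sp2_simple ::
  "('k::field \<Rightarrow> 'w \<Rightarrow> 'w::ab_group_add) \<Rightarrow> ('k ^ idx ^ idx \<Rightarrow> 'w \<Rightarrow> 'w) \<Rightarrow> 'w set \<Rightarrow> bool"
  where
  "Sp2_simple scl \<pi> W \<longleftrightarrow>
     W \<noteq> {0} \<and>
     (\<forall>U\<subseteq>W. module.subspace scl U \<and> (\<forall>g\<in>Sp2. \<pi> g ` U \<subseteq> U) \<longrightarrow> U = {0} \<or> U = W)"

definition matrix_monomial :: "(idx \<Rightarrow> idx \<Rightarrow> nat) \<Rightarrow> 'a::comm_ring_1 ^ idx ^ idx \<Rightarrow> 'a" where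
  "matrix_monomial \<alpha> g = (\<Prod>i\<in>UNIV. \<Prod>j\<in>UNIV. (g $ i $ j) ^ \<alpha> i j)"

text \<open>The orbit map \<open>g \<mapsto> \<pi> g w\<close> is given by a polynomial in the entries of \<open>g\<close> with
  coefficients in \<open>W\<close>.\<close>

definition orbit_polynomial ::
  "('k::field \<Rightarrow> 'w \<Rightarrow> 'w::ab_group_add) \<Rightarrow> ('k ^ idx ^ idx \<Rightarrow> 'w \<Rightarrow> 'w) \<Rightarrow> 'w set \<Rightarrow> 'w \<Rightarrow>
     (idx \<Rightarrow> idx \<Rightarrow> nat) set \<Rightarrow> ((idx \<Rightarrow> idx \<Rightarrow> nat) \<Rightarrow> 'w) \<Rightarrow> bool" where
  "orbit_polynomial scl \<pi> W w A c \<longleftrightarrow>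
     finite A \<and> c ` A \<subseteq> W \<and>
     (\<forall>g\<in>Sp2. \<pi> g w = (\<Sum>\<alpha>\<in>A. scl (matrix_monomial \<alpha> g) (c \<alpha>)))"

definition Sp2_rational ::
  "('k::field \<Rightarrow> 'w \<Rightarrow> 'w::ab_group_add) \<Rightarrow> ('k ^ idx ^ idx \<Rightarrow> 'w \<Rightarrow> 'w) \<Rightarrow> 'w set \<Rightarrow> bool"
  where
  "Sp2_rational scl \<pi> W \<longleftrightarrow> (\<forall>w\<in>W. \<exists>A c. orbit_polynomial scl \<pi> W w A c)"

text \<open>The derivative of a monomial at the identity in the direction \<open>X\<close> is the coefficient of
  \<open>\<epsilon>\<close> in its value at \<open>1 + \<epsilon> X\<close>.\<close>

definition diff_monomial :: "(idx \<Rightarrow> idx \<Rightarrow> nat) \<Rightarrow> 'k::field ^ idx ^ idx \<Rightarrow> 'k" where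
  "diff_monomial \<alpha> X =
     coeff (matrix_monomial \<alpha> (\<chi> i j. [: (mat 1 :: 'k ^ idx ^ idx) $ i $ j, X $ i $ j :])) 1"

text \<open>An action of \<open>sp\<^sub>2\<close> is given by the operators \<open>\<tau> i j\<close> of its spanning elements
  \<open>F\<^sub>i\<^sub>j\<close>.\<close>

definition Sp2_differential ::
  "('k::field \<Rightarrow> 'w \<Rightarrow> 'w::ab_group_add) \<Rightarrow> ('k ^ idx ^ idx \<Rightarrow> 'w \<Rightarrow> 'w) \<Rightarrow> 'w set \<Rightarrow>
     (idx \<Rightarrow> idx \<Rightarrow> 'w \<Rightarrow> 'w) \<Rightarrow> bool" where
  "Sp2_differential scl \<pi> W \<tau> \<longleftrightarrow>
     (\<forall>w\<in>W. \<forall>A c. orbit_polynomial scl \<pi> W w A c \<longrightarrow>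
        (\<forall>i j. \<tau> i j w = (\<Sum>\<alpha>\<in>A. scl (diff_monomial \<alpha> (F_mat i j)) (c \<alpha>))))"

text \<open>\<open>(W, \<tau>)\<close> is \<open>V(m,p)\<close> for \<open>p\<close> the characteristic of \<open>'k\<close>. The highest weight vector is
  fixed by the group elements \<open>1 + t E\<^sub>-\<^sub>1\<^sub>,\<^sub>1\<close> and has torus weight \<open>m\<close>; in positive characteristic
  the last two conditions alone, although implied, would not determine the integer \<open>m\<close>.\<close>

definition is_V ::
  "('k::field \<Rightarrow> 'w \<Rightarrow> 'w::ab_group_add) \<Rightarrow> 'w set \<Rightarrow> (idx \<Rightarrow> idx \<Rightarrow> 'w \<Rightarrow> 'w) \<Rightarrow> int \<Rightarrow> bool"
  where
  "is_V scl W \<tau> m \<longleftrightarrow>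
     (\<exists>\<pi>. Sp2_rep scl \<pi> W \<and> Sp2_rational scl \<pi> W \<and> Sp2_simple scl \<pi> W \<and>
        Sp2_differential scl \<pi> W \<tau> \<and>
        (\<exists>\<xi>\<in>W. \<xi> \<noteq> 0 \<and>
           (\<forall>t. \<pi> (unip_elt t) \<xi> = \<xi>) \<and>
           (\<forall>t. t \<noteq> 0 \<longrightarrow> \<pi> (torus_elt t) \<xi> = scl (t powi m) \<xi>) \<and>
           \<tau> MinusOne PlusOne \<xi> = 0 \<and>
           \<tau> PlusOne PlusOne \<xi> = scl (of_int m) \<xi>))"

text \<open>The \<open>sp\<^sub>2\<close>-module \<open>('v, \<tau>)\<close> is isomorphic to the external direct sum of the modules
  \<open>(W i, \<sigma> i)\<close>, \<open>i \<in> I\<close> (with \<open>I\<close> finite).\<close>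

definition iso_direct_sum ::
  "('k::field \<Rightarrow> 'v \<Rightarrow> 'v::ab_group_add) \<Rightarrow> (idx \<Rightarrow> idx \<Rightarrow> 'v \<Rightarrow> 'v) \<Rightarrow>
   ('k \<Rightarrow> 'w \<Rightarrow> 'w::ab_group_add) \<Rightarrow> (nat \<Rightarrow> 'w set) \<Rightarrow> (nat \<Rightarrow> idx \<Rightarrow> idx \<Rightarrow> 'w \<Rightarrow> 'w) \<Rightarrow>
   nat set \<Rightarrow> bool" where
  "iso_direct_sum scl \<tau> scl' W \<sigma> I \<longleftrightarrow>
     (\<exists>\<Phi>. bij_betw \<Phi> UNIV (\<Pi>\<^sub>E i\<in>I. W i) \<and>
        (\<forall>i\<in>I. \<forall>v w. \<Phi> (v + w) i = \<Phi> v i + \<Phi> w i) \<and>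
        (\<forall>i\<in>I. \<forall>c v. \<Phi> (scl c v) i = scl' c (\<Phi> v i)) \<and>
        (\<forall>i\<in>I. \<forall>a b v. \<Phi> (\<tau> a b v) i = \<sigma> i a b (\<Phi> v i)))"


section \<open>Polynomials in $u$ as Laurent series in $u^{-1}$\<close>

definition poly_in_u :: "'k::field poly \<Rightarrow> 'k fls" where
  "poly_in_u P = poly (map_poly fls_const P) fls_X_inv"

end

(*
  Write S(u) = ((a(u), b(u)), (c(u), d(u))). The hypothesis on p makes the F_11-weights of V residues
  of integers in [-n, n], distinct from n + 2 and - n - 2. Hence b(u) kills the (- n)-weight space, the
  d(u) commute on it, and a common eigenvector xi has d(u) xi = mu(u) xi.

  The operators gamma(u) = (2u - 1) c(u) commute and are even in u. As in the algebraic Bethe ansatz,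
  applying the N-th power of e = b^(1) to gamma(u_1) ... gamma(u_N) xi gives N! times the scalar
    sum over y_i = u_i, - u_i  of  prod_i G(y_i) mu(y_i) * prod_{j<i} (y_i + y_j + 1) / (y_i + y_j)
  times xi. It vanishes for N = n + 1, because n + 2 is not a weight. Let N be minimal such that it
  vanishes identically. Multiplied by the product of the u_N^2 - u_j^2, the scalar reads
    G(u) (mu(u) Q(u^2 + u) - mu(- u) Q(u^2 - u)),  u = u_N,
  where Q is a polynomial whose leading coefficient is the scalar for u_1, ..., u_{N-1}, so that Q can
  be chosen nonzero. Then P(u) = Q(u^2 - u), made monic, is the required polynomial.

  The u_i are specialised to 1 / (alpha_i X) with alpha_i in the ground field, so a single formal
  variable suffices; comparing coefficients of powers of X at the end makes Q a polynomial over the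
  ground field.
*)

theory Submission
  imports Defs
begin

text \<open>The exchange relations have poles at u^2 = v^2, so the algebra is done over the field
  K((X)). Its vectors are series with coefficients in End(V), on which operator series act by left
  multiplication; the highest weight vector becomes a constant endomorphism whose image is the line
  that it spans.

  The factor N! and the product form of the scalar rest on one interpolation identity: each
  application of e removes one parameter, and for a fixed choice of signs the N possible removals
  contribute factors whose sum is N. The arguments u^2 + u and u^2 - u are forced by (p + y + 1)(p -
  y) = (p^2 + p) - (y^2 + y).

  The bound on p acts twice: it makes (n + 1)! invertible, and it keeps n + 2 - j and n + 2 + j
  nonzero in K for all integers j in [- n, n]. To see that the weights of V(m,p) are residues of m,
  m + 2, ..., - m, the group is used: the orbit of the highest weight vector under a one-parameter
  unipotent subgroup is a polynomial curve of degree at most - m, and its coefficients are weight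
  vectors that span the module.\<close>

no_notation fps_nth (infixl "$" 75)

section \<open>The Bethe vectors\<close>

text \<open>In use p is 2v - 1, and q, r are 2a - 1 and 2a + 1 in either order. The letters stay
  opaque, so that only q cancels and the factor common to all terms of the exchange identities is
  pulled out.\<close>

lemma bethe_identity_cancel:
  fixes p q r a w y z X :: "'f::field"
  assumes "p \<noteq> 0" "q \<noteq> 0" "a \<noteq> 0" "y \<noteq> 0" "w \<noteq> 0" "z \<noteq> 0" "(2::'f) \<noteq> 0"
  shows "(q * r) / (p * (2 * a * w)) * (X / (q * (2 * y * z))) = X / (p * (2 * y)) * (r / (2 * a * w * z))"
    and "(r * q) / (p * (2 * a * w)) * (X / (- q * (2 * y * z))) = X / (p * (2 * y)) * (- r / (2 * a * w * z))"
    and "- (q * r) / a * (X / (q * (2 * y * z))) = - X / y * (r / (2 * a * z))"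
    and "- (r * q) / (- a) * (X / (- q * (2 * y * z))) = - X / y * (r / (2 * a * z))"
  using assms by (simp_all add: divide_simps)

text \<open>This is the partial fraction expansion in y of the right-hand side, which has simple
  poles at v, a and - a.\<close>

lemma bethe_identity_aux:
  fixes v a y :: "'f::field"
  assumes "a \<noteq> 0" "v - a \<noteq> 0" "v + a \<noteq> 0" "y - a \<noteq> 0" "y + a \<noteq> 0" "y - v \<noteq> 0" "(2::'f) \<noteq> 0"
  shows "((v + 1)\<^sup>2 - a\<^sup>2) / ((v - a) * (v + a)) / (y - v) + (2 * a + 1) / (2 * a * (a - v) * (y - a))
      + - (2 * a - 1) / (2 * a * (v + a) * (y + a)) = ((y + 1)\<^sup>2 - a\<^sup>2) / ((y - a) * (y + a)) / (y - v)" (is "?A + ?B + ?C = ?D")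
proof -
  define D where "D = 2 * a * (v - a) * (v + a) * (y - a) * (y + a) * (y - v)"
  have D: "D \<noteq> 0" using assms by (simp add: D_def)
  have B: "?B = - (2 * a + 1) / (2 * a * (v - a) * (y - a))"
  proof -
    have "2 * a * (a - v) * (y - a) = - (2 * a * (v - a) * (y - a))"
      by (simp add: algebra_simps)
    then show ?thesis
      by (metis minus_divide_divide add.inverse_inverse)
  qed
  have "?A * D = ((v + 1)\<^sup>2 - a\<^sup>2) * (2 * a * (y - a) * (y + a))"
    using assms unfolding D_def by simp
  moreover have "?B * D = - (2 * a + 1) * ((v + a) * (y + a) * (y - v))"
    using assms unfolding D_def B by simp
  moreover have "?C * D = - (2 * a - 1) * ((v - a) * (y - a) * (y - v))"
    using assms unfolding D_def by simp
  moreover have "?D * D = ((y + 1)\<^sup>2 - a\<^sup>2) * (2 * a * (v - a) * (v + a))"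
    using assms unfolding D_def by simp
  moreover have "((v + 1)\<^sup>2 - a\<^sup>2) * (2 * a * (y - a) * (y + a)) + - (2 * a + 1) * ((v + a) * (y + a) * (y - v))
    + - (2 * a - 1) * ((v - a) * (y - a) * (y - v)) = ((y + 1)\<^sup>2 - a\<^sup>2) * (2 * a * (v - a) * (v + a))"
    by (simp add: algebra_simps power2_eq_square)
  ultimately have "(?A + ?B + ?C) * D = ?D * D"
    by (simp only: distrib_right)
  with D show ?thesis by (simp only: mult_cancel_right simp_thms)
qed

text \<open>When d(v) moves past gamma(u), \<open>bethe_g\<close> is the coefficient of the wanted
  term and \<open>bethe_k\<close> that of the two unwanted ones; \<open>bethe_G\<close> does the
  same for e. The function \<open>bethe_h\<close> is half of \<open>bethe_g\<close>: g(v,u) = h(v,u)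
  h(v,- u).\<close>

definition bethe_g :: "'f::field \<Rightarrow> 'f \<Rightarrow> 'f" where
  "bethe_g v u = ((v + 1)\<^sup>2 - u\<^sup>2) / (v\<^sup>2 - u\<^sup>2)"

definition bethe_k :: "'f::field \<Rightarrow> 'f \<Rightarrow> 'f" where
  "bethe_k v y = (4 * y\<^sup>2 - 1) / ((2 * v - 1) * (2 * y * (y - v)))"

definition bethe_G :: "'f::field \<Rightarrow> 'f" where
  "bethe_G y = - (4 * y\<^sup>2 - 1) / y"

definition bethe_h :: "'f::field \<Rightarrow> 'f \<Rightarrow> 'f" where
  "bethe_h x y = (x + y + 1) / (x + y)"

text \<open>While d(v) moves past gamma(a) and further factors, an exchange with y happens in three
  ways: after the wanted term at a, or after an exchange with a or - a. Up to a common factor the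
  sum is the partial fraction expansion above.\<close>

lemma bethe_identity:
  fixes v a y :: "'f::field"
  assumes "v \<noteq> 0" "a \<noteq> 0" "y \<noteq> 0" "2 * v - 1 \<noteq> 0" "2 * a - 1 \<noteq> 0" "2 * a + 1 \<noteq> 0"
    and "v\<^sup>2 \<noteq> a\<^sup>2" "v\<^sup>2 \<noteq> y\<^sup>2" "y\<^sup>2 \<noteq> a\<^sup>2" "(2::'f) \<noteq> 0"
  shows "bethe_g v a * bethe_k v y + bethe_k v a * bethe_k a y + bethe_k v (- a) * bethe_k (- a) y = bethe_k v y * bethe_g y a"
proof -
  have sq: "v\<^sup>2 - a\<^sup>2 = (v - a) * (v + a)" "y\<^sup>2 - a\<^sup>2 = (y - a) * (y + a)"
    "4 * a\<^sup>2 - 1 = (2 * a - 1) * (2 * a + 1)"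
    "2 * (- a) - 1 = - (2 * a + 1)" "2 * (- a) * (- a - v) = 2 * a * (v + a)" "y - (- a) = y + a"
    by (simp_all add: algebra_simps power2_eq_square)
  have ne: "v - a \<noteq> 0" "a - v \<noteq> 0" "v + a \<noteq> 0" "y - a \<noteq> 0" "y + a \<noteq> 0" "y - v \<noteq> 0"
    using assms by (auto simp: eq_neg_iff_add_eq_0 [symmetric])
  define Y where "Y = (4 * y\<^sup>2 - 1) / ((2 * v - 1) * (2 * y))"
  have key: "((v + 1)\<^sup>2 - a\<^sup>2) / ((v - a) * (v + a)) / (y - v) + (2 * a + 1) / (2 * a * (a - v) * (y - a))
      + - (2 * a - 1) / (2 * a * (v + a) * (y + a)) = ((y + 1)\<^sup>2 - a\<^sup>2) / ((y - a) * (y + a)) / (y - v)"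
    by (rule bethe_identity_aux) (use assms ne in auto)
  have e: "((v + 1)\<^sup>2 - a\<^sup>2) / ((v - a) * (v + a)) * ((4 * y\<^sup>2 - 1) / ((2 * v - 1) * (2 * y * (y - v))))
      = Y * (((v + 1)\<^sup>2 - a\<^sup>2) / ((v - a) * (v + a)) / (y - v))"
    "(4 * y\<^sup>2 - 1) / ((2 * v - 1) * (2 * y * (y - v))) * (((y + 1)\<^sup>2 - a\<^sup>2) / ((y - a) * (y + a)))
      = Y * (((y + 1)\<^sup>2 - a\<^sup>2) / ((y - a) * (y + a)) / (y - v))"
    unfolding Y_def by (simp_all add: mult_ac) (auto simp: algebra_simps)
  have f2: "((2 * a - 1) * (2 * a + 1)) / ((2 * v - 1) * (2 * a * (a - v))) * ((4 * y\<^sup>2 - 1) / ((2 * a - 1) * (2 * y * (y - a))))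
      = Y * ((2 * a + 1) / (2 * a * (a - v) * (y - a)))"
    unfolding Y_def by (rule bethe_identity_cancel(1)) (use assms ne in auto)
  have f3: "((2 * a - 1) * (2 * a + 1)) / ((2 * v - 1) * (2 * a * (v + a))) * ((4 * y\<^sup>2 - 1) / (- (2 * a + 1) * (2 * y * (y + a))))
      = Y * (- (2 * a - 1) / (2 * a * (v + a) * (y + a)))"
    unfolding Y_def by (rule bethe_identity_cancel(2)) (use assms ne in auto)
  show ?thesis
    unfolding bethe_g_def bethe_k_def power2_minus sq e f2 f3 by (simp only: key [symmetric] distrib_left [of Y])
qed

text \<open>The analogue for e. Divided by G(y), it is the partial fraction expansion of g(y,a) in
  y, where 1 is the value at infinity.\<close>

lemma bethe_identity':
  fixes a y :: "'f::field"
  assumes "a \<noteq> 0" "y \<noteq> 0" "2 * a - 1 \<noteq> 0" "2 * a + 1 \<noteq> 0" "y\<^sup>2 \<noteq> a\<^sup>2" "(2::'f) \<noteq> 0"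
  shows "bethe_G a * bethe_k a y + bethe_G (- a) * bethe_k (- a) y + bethe_G y = bethe_G y * bethe_g y a"
proof -
  have sq: "y\<^sup>2 - a\<^sup>2 = (y - a) * (y + a)" "4 * a\<^sup>2 - 1 = (2 * a - 1) * (2 * a + 1)"
    "2 * (- a) - 1 = - (2 * a + 1)" "y - (- a) = y + a"
    by (simp_all add: algebra_simps power2_eq_square)
  have ne: "y - a \<noteq> 0" "y + a \<noteq> 0"
    using assms by (auto simp: eq_neg_iff_add_eq_0 [symmetric])
  have "((2 * a + 1) / (2 * a * (y - a)) + (2 * a - 1) / (2 * a * (y + a)) + 1) * (2 * a * (y - a) * (y + a))
      = ((y + 1)\<^sup>2 - a\<^sup>2) / ((y - a) * (y + a)) * (2 * a * (y - a) * (y + a))" (is "?l = ?r")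
  proof -
    have "(2 * a + 1) / (2 * a * (y - a)) * (2 * a * (y - a) * (y + a)) = (2 * a + 1) * (y + a)"
      "(2 * a - 1) / (2 * a * (y + a)) * (2 * a * (y - a) * (y + a)) = (2 * a - 1) * (y - a)"
      using assms ne by simp_all
    then have "?l = (2 * a + 1) * (y + a) + (2 * a - 1) * (y - a) + 2 * a * (y - a) * (y + a)"
      by (simp only: distrib_right mult_1_left)
    also have "\<dots> = ((y + 1)\<^sup>2 - a\<^sup>2) * (2 * a)"
      by (simp add: algebra_simps power2_eq_square)
    also have "\<dots> = ?r"
      using assms ne by simp
    finally show ?thesis .
  qed
  moreover have "2 * a * (y - a) * (y + a) \<noteq> 0"
    using assms ne by simp
  ultimately have key: "(2 * a + 1) / (2 * a * (y - a)) + (2 * a - 1) / (2 * a * (y + a)) + 1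
      = ((y + 1)\<^sup>2 - a\<^sup>2) / ((y - a) * (y + a))"
    by (simp only: mult_cancel_right simp_thms)
  have f2: "- ((2 * a - 1) * (2 * a + 1)) / a * ((4 * y\<^sup>2 - 1) / ((2 * a - 1) * (2 * y * (y - a))))
      = - (4 * y\<^sup>2 - 1) / y * ((2 * a + 1) / (2 * a * (y - a)))"
    by (rule bethe_identity_cancel(3) [where p = 1 and w = 1]) (use assms ne in auto)
  have f3: "- ((2 * a - 1) * (2 * a + 1)) / (- a) * ((4 * y\<^sup>2 - 1) / (- (2 * a + 1) * (2 * y * (y + a))))
      = - (4 * y\<^sup>2 - 1) / y * ((2 * a - 1) / (2 * a * (y + a)))"
    by (rule bethe_identity_cancel(4) [where p = 1 and w = 1]) (use assms ne in auto)
  show ?thesis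
    unfolding bethe_g_def bethe_k_def bethe_G_def power2_minus sq f2 f3 by (simp only: key [symmetric] distrib_left [of "- (4 * y\<^sup>2 - 1) / y"] mult_1_right)
qed

text \<open>The algebra of the Bethe ansatz, separated from the twisted Yangian:
  \<open>\<gamma>\<close> stands for (2u - 1) c(u), \<open>e\<close> for the first coefficient of
  b(u), and \<open>U\<close> is a symmetric set of values of the spectral parameter at which all
  relations make sense.\<close>

locale bethe = vector_space s
  for s :: "'f::field \<Rightarrow> 'm::ab_group_add \<Rightarrow> 'm" +
  fixes e :: "'m \<Rightarrow> 'm" and \<gamma> d :: "'f \<Rightarrow> 'm \<Rightarrow> 'm" and U :: "'f set" and \<mu> :: "'f \<Rightarrow> 'f" and \<xi> :: 'm
  assumes linear_e: "Vector_Spaces.linear s s e"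
    and linear_\<gamma>: "\<And>u. u \<in> U \<Longrightarrow> Vector_Spaces.linear s s (\<gamma> u)"
    and U_uminus: "\<And>u. u \<in> U \<Longrightarrow> - u \<in> U"
    and U_nonzero: "\<And>u. u \<in> U \<Longrightarrow> u \<noteq> 0"
    and U_half: "\<And>u. u \<in> U \<Longrightarrow> 2 * u - 1 \<noteq> 0"
    and two_nonzero: "(2::'f) \<noteq> 0"
    and \<gamma>_commute: "\<And>u v w. u \<in> U \<Longrightarrow> v \<in> U \<Longrightarrow> \<gamma> u (\<gamma> v w) = \<gamma> v (\<gamma> u w)"
    and \<gamma>_even: "\<And>u. u \<in> U \<Longrightarrow> \<gamma> (- u) = \<gamma> u"
    and e_\<gamma>: "\<And>u w. u \<in> U \<Longrightarrow> e (\<gamma> u w) = \<gamma> u (e w) + s (bethe_G u) (d u w) + s (bethe_G (- u)) (d (- u) w)"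
    and d_\<gamma>: "\<And>u v w. u \<in> U \<Longrightarrow> v \<in> U \<Longrightarrow> v\<^sup>2 \<noteq> u\<^sup>2 \<Longrightarrow>
      d v (\<gamma> u w) = s (bethe_g v u) (\<gamma> u (d v w)) + s (bethe_k v u) (\<gamma> v (d u w)) + s (bethe_k v (- u)) (\<gamma> v (d (- u) w))"
    and e_\<xi>: "e \<xi> = 0"
    and d_\<xi>: "\<And>u. u \<in> U \<Longrightarrow> d u \<xi> = s (\<mu> u) \<xi>"
begin

text \<open>Distinct squares keep the denominators v^2 - u^2 and y - v of g and k nonzero.\<close>

definition admissible :: "nat set \<Rightarrow> (nat \<Rightarrow> 'f) \<Rightarrow> bool" where
  "admissible I u \<longleftrightarrow> finite I \<and> (\<forall>i\<in>I. u i \<in> U) \<and> (\<forall>i\<in>I. \<forall>j\<in>I. i \<noteq> j \<longrightarrow> (u i)\<^sup>2 \<noteq> (u j)\<^sup>2)"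

text \<open>A fold over a set is legitimate because the gammas commute; a parameter can then be
  dropped at any place by passing to \<open>I - {i}\<close>.\<close>

definition \<Gamma> :: "nat set \<Rightarrow> (nat \<Rightarrow> 'f) \<Rightarrow> 'm" where
  "\<Gamma> I u = Finite_Set.fold (\<lambda>i. \<gamma> (u i)) \<xi> I"

lemma \<Gamma>_empty [simp]: "\<Gamma> {} u = \<xi>"
  by (simp add: \<Gamma>_def)

lemma \<Gamma>_insert:
  assumes "finite I" "\<And>i. i \<in> insert a I \<Longrightarrow> u i \<in> U" "a \<notin> I"
  shows "\<Gamma> (insert a I) u = \<gamma> (u a) (\<Gamma> I u)"
proof -
  have "comp_fun_commute_on {i. u i \<in> U} (\<lambda>i. \<gamma> (u i))"
    by unfold_locales (auto simp: fun_eq_iff \<gamma>_commute)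
  from comp_fun_commute_on.fold_insert [OF this, of a I] show ?thesis
    using assms by (auto simp: \<Gamma>_def)
qed

lemma \<Gamma>_insert_Diff:
  assumes "admissible (insert a I) u" "a \<notin> I" "i \<in> I"
  shows "\<Gamma> (insert a I - {i}) u = \<gamma> (u a) (\<Gamma> (I - {i}) u)"
proof -
  have "insert a I - {i} = insert a (I - {i})" using assms by auto
  moreover have "\<Gamma> (insert a (I - {i})) u = \<gamma> (u a) (\<Gamma> (I - {i}) u)"
    by (rule \<Gamma>_insert) (use assms in \<open>auto simp: admissible_def\<close>)
  ultimately show ?thesis by simp
qed

lemma admissible_mono: "admissible I u \<Longrightarrow> J \<subseteq> I \<Longrightarrow> admissible J u"
  unfolding admissible_def by (blast intro: finite_subset)

lemma uminus_neq: "u \<in> U \<Longrightarrow> u \<noteq> - u"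
  using U_nonzero [of u] two_nonzero
  by (metis add_eq_0_iff mult_2 no_zero_divisors)

lemma sum_pm: "u \<in> U \<Longrightarrow> (\<Sum>y\<in>{u, - u}. f y) = f u + (f (- u) :: 'b::ab_group_add)"
  using uminus_neq [of u] by simp

lemma U_half': "u \<in> U \<Longrightarrow> 2 * u + 1 \<noteq> 0"
proof
  assume "u \<in> U" "2 * u + 1 = 0"
  moreover have "2 * (- u) - 1 = - (2 * u + 1)"
    by simp
  ultimately have "2 * (- u) - 1 = 0"
    by simp
  then show False
    using U_half [OF U_uminus] \<open>u \<in> U\<close> by blast
qed

lemma bethe_k_exchange:
  assumes "v \<in> U" "a \<in> U" "y \<in> U" "v\<^sup>2 \<noteq> a\<^sup>2" "v\<^sup>2 \<noteq> y\<^sup>2" "y\<^sup>2 \<noteq> a\<^sup>2"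
  shows "bethe_g v a * bethe_k v y + bethe_k v a * bethe_k a y + bethe_k v (- a) * bethe_k (- a) y = bethe_k v y * bethe_g y a"
  using bethe_identity [of v a y] assms U_nonzero U_half U_half' two_nonzero
  by simp

lemma bethe_G_exchange:
  assumes "a \<in> U" "y \<in> U" "y\<^sup>2 \<noteq> a\<^sup>2"
  shows "bethe_G a * bethe_k a y + bethe_G (- a) * bethe_k (- a) y + bethe_G y = bethe_G y * bethe_g y a"
  using bethe_identity' [of a y] assms U_nonzero U_half U_half' two_nonzero
  by simp

text \<open>Induction on \<open>I\<close>. The term that lacks an old parameter i arises from the
  wanted term at the new parameter a and from the exchanges with a and - a;
  \<open>bethe_k_exchange\<close> merges the three. The term that lacks a arises only from the last
  two, through the eigenvalues \<open>M\<close>.\<close>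

lemma d_\<Gamma>:
  assumes "admissible I u" "v \<in> U" "\<And>i. i \<in> I \<Longrightarrow> v\<^sup>2 \<noteq> (u i)\<^sup>2"
  shows "d v (\<Gamma> I u) = s (\<mu> v * (\<Prod>i\<in>I. bethe_g v (u i))) (\<Gamma> I u)
    + (\<Sum>i\<in>I. s (\<Sum>y\<in>{u i, - u i}. bethe_k v y * (\<mu> y * (\<Prod>j\<in>I-{i}. bethe_g y (u j)))) (\<gamma> v (\<Gamma> (I - {i}) u)))"
proof -
  have "finite I"
    using assms(1) by (simp add: admissible_def)
  then show ?thesis using assms
  proof (induction I arbitrary: v)
    case empty
    then show ?case by (simp add: d_\<xi>)
  next
    case (insert a I)
    have admissible: "admissible I u"
      using insert.prems(1) admissible_mono by blast
    have a: "u a \<in> U" "- u a \<in> U" and uI: "\<And>i. i \<in> I \<Longrightarrow> u i \<in> U"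
      using insert.prems(1) U_uminus by (auto simp: admissible_def)
    have neq: "\<And>i. i \<in> I \<Longrightarrow> (u a)\<^sup>2 \<noteq> (u i)\<^sup>2"
      using insert.prems(1) insert.hyps by (auto simp: admissible_def)
    note v = insert.prems(2)
    have va: "v\<^sup>2 \<noteq> (u a)\<^sup>2" and vI: "\<And>i. i \<in> I \<Longrightarrow> v\<^sup>2 \<noteq> (u i)\<^sup>2"
      using insert.prems(3) by auto
    interpret ga: Vector_Spaces.linear s s "\<gamma> (u a)" by (rule linear_\<gamma>) (fact a)
    interpret gv: Vector_Spaces.linear s s "\<gamma> v" by (rule linear_\<gamma>) (fact v)
    define c where "c v i = (\<Sum>y\<in>{u i, - u i}. bethe_k v y * (\<mu> y * (\<Prod>j\<in>I-{i}. bethe_g y (u j))))" for v i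
    define c' where "c' i = (\<Sum>y\<in>{u i, - u i}. bethe_k v y * (\<mu> y * (\<Prod>j\<in>insert a I-{i}. bethe_g y (u j))))" for i
    define M where "M v = \<mu> v * (\<Prod>i\<in>I. bethe_g v (u i))" for v
    have IH: "d w (\<Gamma> I u) = s (M w) (\<Gamma> I u) + (\<Sum>i\<in>I. s (c w i) (\<gamma> w (\<Gamma> (I - {i}) u)))"
      if "w \<in> U" "\<And>i. i \<in> I \<Longrightarrow> w\<^sup>2 \<noteq> (u i)\<^sup>2" for w
      unfolding M_def c_def by (rule insert.IH) (use admissible that in auto)
    define T where "T i = \<gamma> v (\<gamma> (u a) (\<Gamma> (I - {i}) u))" for i
    have Ga: "\<Gamma> (insert a I) u = \<gamma> (u a) (\<Gamma> I u)"
      by (rule \<Gamma>_insert) (use insert.hyps insert.prems(1) in \<open>auto simp: admissible_def\<close>)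
    have Gi: "\<gamma> v (\<Gamma> (insert a I - {i}) u) = T i" if "i \<in> I" for i
      using \<Gamma>_insert_Diff [OF insert.prems(1) insert.hyps(2) that] by (simp add: T_def)
    have coef: "bethe_g v (u a) * c v i + bethe_k v (u a) * c (u a) i + bethe_k v (- u a) * c (- u a) i = c' i"
      if "i \<in> I" for i
    proof -
      have i: "insert a I - {i} = insert a (I - {i})" using that insert.hyps by auto
      have y: "bethe_g v (u a) * (bethe_k v y * X) + bethe_k v (u a) * (bethe_k (u a) y * X) + bethe_k v (- u a) * (bethe_k (- u a) y * X)
          = bethe_k v y * (bethe_g y (u a) * X)" if "y \<in> {u i, - u i}" for y X
      proof -
        have yU: "y \<in> U"
          using that uI [OF \<open>i \<in> I\<close>] U_uminus by blast
        have y2: "y\<^sup>2 = (u i)\<^sup>2"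
          using that by auto
        have "bethe_g v (u a) * bethe_k v y + bethe_k v (u a) * bethe_k (u a) y + bethe_k v (- u a) * bethe_k (- u a) y = bethe_k v y * bethe_g y (u a)"
          using bethe_k_exchange [OF v a(1) yU va] vI [OF \<open>i \<in> I\<close>] neq [OF \<open>i \<in> I\<close>, symmetric] by (simp add: y2)
        then have "(bethe_g v (u a) * bethe_k v y + bethe_k v (u a) * bethe_k (u a) y + bethe_k v (- u a) * bethe_k (- u a) y) * X = bethe_k v y * bethe_g y (u a) * X"
          by simp
        then show ?thesis by (simp only: distrib_right mult.assoc)
      qed
      show ?thesis
        unfolding c_def c'_def sum_distrib_left i
      proof (simp only: sum.distrib [symmetric], rule sum.cong [OF refl])
        fix x assume x: "x \<in> {u i, - u i}"
        have "(\<Prod>j\<in>insert a (I - {i}). bethe_g x (u j)) = bethe_g x (u a) * (\<Prod>j\<in>I - {i}. bethe_g x (u j))"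
          using insert.hyps by simp
        with y [OF x, of "\<mu> x * (\<Prod>j\<in>I - {i}. bethe_g x (u j))"]
        show "bethe_g v (u a) * (bethe_k v x * (\<mu> x * (\<Prod>j\<in>I - {i}. bethe_g x (u j)))) + bethe_k v (u a) * (bethe_k (u a) x * (\<mu> x * (\<Prod>j\<in>I - {i}. bethe_g x (u j)))) + bethe_k v (- u a) * (bethe_k (- u a) x * (\<mu> x * (\<Prod>j\<in>I - {i}. bethe_g x (u j)))) = bethe_k v x * (\<mu> x * (\<Prod>j\<in>insert a (I - {i}). bethe_g x (u j)))"
          by (simp only: mult.left_commute)
      qed
    qed
    have ca: "c' a = bethe_k v (u a) * M (u a) + bethe_k v (- u a) * M (- u a)"
    proof -
      have "insert a I - {a} = I" using insert.hyps by auto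
      then show ?thesis unfolding c'_def M_def by (simp only: sum_pm [OF a(1)])
    qed
    have "d v (\<Gamma> (insert a I) u) = s (bethe_g v (u a)) (\<gamma> (u a) (d v (\<Gamma> I u)))
        + s (bethe_k v (u a)) (\<gamma> v (d (u a) (\<Gamma> I u))) + s (bethe_k v (- u a)) (\<gamma> v (d (- u a) (\<Gamma> I u)))"
      unfolding Ga by (rule d_\<gamma>) (use a v va in auto)
    also have "d v (\<Gamma> I u) = s (M v) (\<Gamma> I u) + (\<Sum>i\<in>I. s (c v i) (\<gamma> v (\<Gamma> (I - {i}) u)))"
      by (rule IH) (use v vI in auto)
    also have "d (u a) (\<Gamma> I u) = s (M (u a)) (\<Gamma> I u) + (\<Sum>i\<in>I. s (c (u a) i) (\<gamma> (u a) (\<Gamma> (I - {i}) u)))"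
      by (rule IH) (use a neq in auto)
    \<comment> \<open>The unwanted terms contain gamma(- u_a), which evenness turns back into
      gamma(u_a), so that they join those of d(u_a).\<close>
    also have "d (- u a) (\<Gamma> I u) = s (M (- u a)) (\<Gamma> I u) + (\<Sum>i\<in>I. s (c (- u a) i) (\<gamma> (u a) (\<Gamma> (I - {i}) u)))"
      by (subst IH) (use a neq in \<open>auto simp: \<gamma>_even\<close>)
    finally have "d v (\<Gamma> (insert a I) u) = s (M v * bethe_g v (u a)) (\<Gamma> (insert a I) u) + s (c' a) (\<gamma> v (\<Gamma> I u))
       + (\<Sum>i\<in>I. s (bethe_g v (u a) * c v i + bethe_k v (u a) * c (u a) i + bethe_k v (- u a) * c (- u a) i) (T i))"
      unfolding ca Ga T_def
      by (simp add: ga.add ga.sum ga.scale gv.add gv.sum gv.scale scale_right_distrib scale_left_distrib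
          scale_sum_right sum.distrib \<gamma>_commute [OF a(1) v] mult.commute)
    also have "(\<Sum>i\<in>I. s (bethe_g v (u a) * c v i + bethe_k v (u a) * c (u a) i + bethe_k v (- u a) * c (- u a) i) (T i))
      = (\<Sum>i\<in>I. s (c' i) (\<gamma> v (\<Gamma> (insert a I - {i}) u)))"
      by (rule sum.cong) (auto simp: coef Gi)
    finally show ?case
      unfolding c'_def [symmetric] M_def using insert.hyps
      by (simp add: mult.commute mult.left_commute)
  qed
qed

text \<open>The induction for d again, with \<open>bethe_G_exchange\<close> merging the
  contributions. No term keeps all parameters, since e kills \<open>\<xi>\<close>.\<close>

lemma e_\<Gamma>:
  assumes "admissible I u"
  shows "e (\<Gamma> I u) = (\<Sum>i\<in>I. s (\<Sum>y\<in>{u i, - u i}. bethe_G y * (\<mu> y * (\<Prod>j\<in>I-{i}. bethe_g y (u j)))) (\<Gamma> (I - {i}) u))"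
proof -
  have "finite I"
    using assms(1) by (simp add: admissible_def)
  then show ?thesis using assms
  proof (induction I)
    case empty
    then show ?case by (simp add: e_\<xi>)
  next
    case (insert a I)
    have admissible: "admissible I u"
      using insert.prems(1) admissible_mono by blast
    have a: "u a \<in> U" "- u a \<in> U" and uI: "\<And>i. i \<in> I \<Longrightarrow> u i \<in> U"
      using insert.prems(1) U_uminus by (auto simp: admissible_def)
    have neq: "\<And>i. i \<in> I \<Longrightarrow> (u a)\<^sup>2 \<noteq> (u i)\<^sup>2"
      using insert.prems(1) insert.hyps by (auto simp: admissible_def)
    interpret ga: Vector_Spaces.linear s s "\<gamma> (u a)" by (rule linear_\<gamma>) (fact a)
    define c where "c v i = (\<Sum>y\<in>{u i, - u i}. bethe_k v y * (\<mu> y * (\<Prod>j\<in>I-{i}. bethe_g y (u j))))" for v i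
    define E where "E i = (\<Sum>y\<in>{u i, - u i}. bethe_G y * (\<mu> y * (\<Prod>j\<in>I-{i}. bethe_g y (u j))))" for i
    define E' where "E' i = (\<Sum>y\<in>{u i, - u i}. bethe_G y * (\<mu> y * (\<Prod>j\<in>insert a I-{i}. bethe_g y (u j))))" for i
    define M where "M v = \<mu> v * (\<Prod>i\<in>I. bethe_g v (u i))" for v
    define T where "T i = \<gamma> (u a) (\<Gamma> (I - {i}) u)" for i
    have Ga: "\<Gamma> (insert a I) u = \<gamma> (u a) (\<Gamma> I u)"
      by (rule \<Gamma>_insert) (use insert.hyps insert.prems(1) in \<open>auto simp: admissible_def\<close>)
    have Gi: "\<Gamma> (insert a I - {i}) u = T i" if "i \<in> I" for i
      using \<Gamma>_insert_Diff [OF insert.prems(1) insert.hyps(2) that] by (simp add: T_def)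
    have coef: "E i + bethe_G (u a) * c (u a) i + bethe_G (- u a) * c (- u a) i = E' i"
      if "i \<in> I" for i
    proof -
      have i: "insert a I - {i} = insert a (I - {i})" using that insert.hyps by auto
      have y: "bethe_G y * X + bethe_G (u a) * (bethe_k (u a) y * X) + bethe_G (- u a) * (bethe_k (- u a) y * X)
          = bethe_G y * (bethe_g y (u a) * X)" if "y \<in> {u i, - u i}" for y X
      proof -
        have yU: "y \<in> U"
          using that uI [OF \<open>i \<in> I\<close>] U_uminus by blast
        have y2: "y\<^sup>2 = (u i)\<^sup>2"
          using that by auto
        have "bethe_G (u a) * bethe_k (u a) y + bethe_G (- u a) * bethe_k (- u a) y + bethe_G y = bethe_G y * bethe_g y (u a)"
          using bethe_G_exchange [OF a(1) yU] neq [OF \<open>i \<in> I\<close>, symmetric] by (simp add: y2)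
        then have "(bethe_G (u a) * bethe_k (u a) y + bethe_G (- u a) * bethe_k (- u a) y + bethe_G y) * X = bethe_G y * bethe_g y (u a) * X"
          by simp
        then show ?thesis by (simp only: distrib_right mult.assoc) (simp only: ac_simps)
      qed
      show ?thesis
        unfolding c_def E_def E'_def sum_distrib_left i
      proof (simp only: sum.distrib [symmetric], rule sum.cong [OF refl])
        fix x assume x: "x \<in> {u i, - u i}"
        have "(\<Prod>j\<in>insert a (I - {i}). bethe_g x (u j)) = bethe_g x (u a) * (\<Prod>j\<in>I - {i}. bethe_g x (u j))"
          using insert.hyps by simp
        with y [OF x, of "\<mu> x * (\<Prod>j\<in>I - {i}. bethe_g x (u j))"]
        show "bethe_G x * (\<mu> x * (\<Prod>j\<in>I - {i}. bethe_g x (u j))) + bethe_G (u a) * (bethe_k (u a) x * (\<mu> x * (\<Prod>j\<in>I - {i}. bethe_g x (u j)))) + bethe_G (- u a) * (bethe_k (- u a) x * (\<mu> x * (\<Prod>j\<in>I - {i}. bethe_g x (u j)))) = bethe_G x * (\<mu> x * (\<Prod>j\<in>insert a (I - {i}). bethe_g x (u j)))"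
          by (simp only: mult.left_commute)
      qed
    qed
    have Ea: "E' a = bethe_G (u a) * M (u a) + bethe_G (- u a) * M (- u a)"
    proof -
      have "insert a I - {a} = I" using insert.hyps by auto
      then show ?thesis unfolding E'_def M_def by (simp only: sum_pm [OF a(1)])
    qed
    have "e (\<Gamma> (insert a I) u) = \<gamma> (u a) (e (\<Gamma> I u))
        + s (bethe_G (u a)) (d (u a) (\<Gamma> I u)) + s (bethe_G (- u a)) (d (- u a) (\<Gamma> I u))"
      unfolding Ga by (rule e_\<gamma>) (use a in auto)
    also have "e (\<Gamma> I u) = (\<Sum>i\<in>I. s (E i) (\<Gamma> (I - {i}) u))"
      unfolding E_def by (rule insert.IH) (fact admissible)
    also have "d (u a) (\<Gamma> I u) = s (M (u a)) (\<Gamma> I u) + (\<Sum>i\<in>I. s (c (u a) i) (T i))"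
      unfolding M_def c_def T_def by (rule d_\<Gamma>) (use admissible a neq in auto)
    also have "d (- u a) (\<Gamma> I u) = s (M (- u a)) (\<Gamma> I u) + (\<Sum>i\<in>I. s (c (- u a) i) (T i))"
      unfolding M_def c_def T_def by (subst d_\<Gamma>) (use admissible a neq in \<open>auto simp: \<gamma>_even\<close>)
    finally have "e (\<Gamma> (insert a I) u) = s (E' a) (\<Gamma> I u)
       + (\<Sum>i\<in>I. s (E i + bethe_G (u a) * c (u a) i + bethe_G (- u a) * c (- u a) i) (T i))"
      unfolding Ea T_def
      by (simp add: ga.sum ga.scale scale_right_distrib scale_left_distrib scale_sum_right sum.distrib)
    also have "(\<Sum>i\<in>I. s (E i + bethe_G (u a) * c (u a) i + bethe_G (- u a) * c (- u a) i) (T i))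
      = (\<Sum>i\<in>I. s (E' i) (\<Gamma> (insert a I - {i}) u))"
      by (rule sum.cong) (auto simp: coef Gi)
    finally show ?case
      unfolding E'_def [symmetric] using insert.hyps by simp
  qed
qed

end

section \<open>The sum over choices of signs\<close>

lemma coeff_prod_linear:
  fixes c :: "nat \<Rightarrow> 'f::field"
  assumes "finite I"
  shows "degree (\<Prod>j\<in>I. [:c j, 1:]) = card I" and "coeff (\<Prod>j\<in>I. [:c j, 1:]) (card I) = 1"
    and "I \<noteq> {} \<Longrightarrow> coeff (\<Prod>j\<in>I. [:c j, 1:]) (card I - 1) = (\<Sum>j\<in>I. c j)"
proof -
  have *: "degree (\<Prod>j\<in>I. [:c j, 1:]) = card I \<and> coeff (\<Prod>j\<in>I. [:c j, 1:]) (card I) = 1"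
    if "finite I" for I
    using that
  proof (induction I)
    case (insert a I)
    let ?P = "\<Prod>j\<in>I. [:c j, 1:]"
    have "?P \<noteq> 0"
      using insert by (metis coeff_0 zero_neq_one)
    then have "degree ([:c a, 1:] * ?P) = Suc (card I)"
      using insert by (subst degree_mult_eq) auto
    moreover have "lead_coeff ([:c a, 1:] * ?P) = 1"
      unfolding lead_coeff_mult using insert by simp
    ultimately show ?case
      using insert by (simp only: prod.insert [OF insert(1,2)] card_insert_disjoint [OF insert(1,2)] simp_thms)
  qed simp
  then show "degree (\<Prod>j\<in>I. [:c j, 1:]) = card I" "coeff (\<Prod>j\<in>I. [:c j, 1:]) (card I) = 1"
    using assms by auto
  show "coeff (\<Prod>j\<in>I. [:c j, 1:]) (card I - 1) = (\<Sum>j\<in>I. c j)" if "I \<noteq> {}"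
    using assms that
  proof (induction I rule: finite_ne_induct)
    case (insert a I)
    then obtain n where n: "card I = Suc n"
      by (metis card_gt_0_iff Suc_pred)
    show ?case
      using insert * [OF insert(1)] n by (simp add: add.commute)
  qed simp
qed

text \<open>Lagrange interpolation of A - B at the y_i, where A = prod (x - y_j + 1) and B = prod (x
  - y_j). Its value at y_i is A(y_i), which is the i-th summand times the product of the other y_i -
  y_j. The coefficient of degree card I - 1 is the sum on one side and card I on the other.\<close>

lemma sum_prod_shifted_quotients:
  fixes y :: "nat \<Rightarrow> 'f::field"
  assumes "finite I" "inj_on y I"
  shows "(\<Sum>i\<in>I. \<Prod>j\<in>I-{i}. (y i - y j + 1) / (y i - y j)) = of_nat (card I)"
proof (cases "I = {}")
  case False
  define N where "N = card I"
  have N: "N \<noteq> 0" using False assms by (simp add: N_def)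
  define A where "A = (\<Prod>j\<in>I. [:1 - y j, 1:])"
  define B where "B = (\<Prod>j\<in>I. [:- y j, 1:])"
  define w where "w i = (\<Prod>j\<in>I-{i}. (y i - y j + 1) / (y i - y j))" for i
  define L where "L = (\<Sum>i\<in>I. smult (w i) (\<Prod>j\<in>I-{i}. [:- y j, 1:]))"
  have card: "card (I - {i}) = N - 1" if "i \<in> I" for i
    using that assms by (simp add: N_def)
  have degL: "degree L \<le> N - 1"
    unfolding L_def
  proof (rule degree_sum_le)
    fix i assume "i \<in> I"
    then show "degree (smult (w i) (\<Prod>j\<in>I-{i}. [:- y j, 1:])) \<le> N - 1"
      using coeff_prod_linear(1) [of "I - {i}" "\<lambda>j. - y j"] card [of i] assms
      by (metis degree_smult_le finite_Diff)
  qed (use assms in auto)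
  have degAB: "degree A = N" "degree B = N" "coeff A N = 1" "coeff B N = 1"
    unfolding A_def B_def N_def by (rule coeff_prod_linear [OF assms(1)])+
  have degD: "degree (A - B) \<le> N - 1"
  proof (rule degree_le, safe)
    fix k assume "N - 1 < k"
    then have "k = N \<or> k > N" by auto
    then show "coeff (A - B) k = 0"
      using degAB coeff_eq_0 [of A k] coeff_eq_0 [of B k] by auto
  qed
  have eval: "poly L (y k) = poly (A - B) (y k)" if "k \<in> I" for k
  proof -
    have "poly L (y k) = (\<Sum>i\<in>I. w i * (\<Prod>j\<in>I-{i}. y k - y j))"
      by (simp add: L_def poly_sum poly_prod)
    also have "\<dots> = (\<Sum>i\<in>{k}. w i * (\<Prod>j\<in>I-{i}. y k - y j))"
    proof (rule sum.mono_neutral_right)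
      show "\<forall>i\<in>I - {k}. w i * (\<Prod>j\<in>I - {i}. y k - y j) = 0"
        using that assms by (auto simp: prod_zero_iff)
    qed (use that assms in auto)
    also have "\<dots> = (\<Prod>j\<in>I-{k}. (y k - y j + 1) / (y k - y j) * (y k - y j))"
      by (simp only: w_def prod.distrib sum.insert finite.emptyI empty_iff not_False_eq_True sum.empty add_0_right)
    also have "\<dots> = (\<Prod>j\<in>I-{k}. y k - y j + 1)"
      using assms that by (intro prod.cong) (auto simp: inj_on_def)
    also have "\<dots> = (\<Prod>j\<in>I. y k - y j + 1)"
      using assms that by (simp add: prod.remove [of I k])
    also have "\<dots> = poly A (y k)"
      by (simp add: A_def poly_prod algebra_simps)
    also have "\<dots> = poly (A - B) (y k)"
    proof -
      have "poly B (y k) = 0"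
        using assms that by (auto simp: B_def poly_prod prod_zero_iff)
      then show ?thesis by simp
    qed
    finally show ?thesis .
  qed
  \<comment> \<open>Both have degree at most N - 1 and agree at N distinct points.\<close>
  have "L = A - B"
  proof (rule ccontr)
    assume "L \<noteq> A - B"
    then have ne: "L - (A - B) \<noteq> 0" by simp
    have "y ` I \<subseteq> {x. poly (L - (A - B)) x = 0}"
      using eval by (auto simp: algebra_simps)
    then have "card (y ` I) \<le> degree (L - (A - B))"
      using ne card_poly_roots_bound [OF ne] poly_roots_finite [OF ne] card_mono le_trans by blast
    also have "\<dots> \<le> N - 1"
      using degL degD by (rule degree_diff_le)
    finally have "N \<le> N - 1"
      by (simp only: card_image [OF assms(2)] N_def)
    with N show False by linarith
  qed
  moreover have "coeff L (N - 1) = (\<Sum>i\<in>I. w i)"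
  proof -
    have "coeff (\<Prod>j\<in>I-{i}. [:- y j, 1:]) (N - 1) = 1" if "i \<in> I" for i
      using coeff_prod_linear(2) [of "I - {i}" "\<lambda>j. - y j"] card [OF that] assms by simp
    then show ?thesis by (simp add: L_def coeff_sum)
  qed
  moreover have "coeff (A - B) (N - 1) = of_nat N"
  proof -
    have "coeff A (N - 1) = (\<Sum>j\<in>I. 1 - y j)" "coeff B (N - 1) = (\<Sum>j\<in>I. - y j)"
      unfolding A_def B_def N_def
      using coeff_prod_linear(3) [OF assms(1), of "\<lambda>j. 1 - y j"]
        coeff_prod_linear(3) [OF assms(1), of "\<lambda>j. - y j"] False by simp_all
    then show ?thesis
      by (simp add: sum_subtractf sum_negf N_def)
  qed
  ultimately show ?thesis by (simp add: w_def N_def)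
qed simp

lemma sum_PiE_insert:
  fixes f :: "('a \<Rightarrow> 'b) \<Rightarrow> 'c::comm_monoid_add"
  assumes "a \<notin> I"
  shows "(\<Sum>y\<in>PiE (insert a I) T. f y) = (\<Sum>p\<in>T a. \<Sum>y\<in>PiE I T. f (y(a := p)))"
proof -
  have "inj_on (\<lambda>(p, y). y(a := p)) (T a \<times> PiE I T)"
  proof (rule inj_onI, clarify)
    fix p y q z
    assume *: "y \<in> PiE I T" "z \<in> PiE I T" "y(a := p) = z(a := q)"
    have "y b = z b" for b
      using fun_cong [OF *(3), of b] PiE_arb [OF *(1) assms] PiE_arb [OF *(2) assms]
      by (cases "b = a") auto
    moreover have "p = q" using fun_cong [OF *(3), of a] by simp
    ultimately show "p = q \<and> y = z" by auto
  qed
  then show ?thesis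
    unfolding PiE_insert_eq by (simp add: sum.reindex sum.cartesian_product case_prod_unfold)
qed

definition bethe_H :: "nat set \<Rightarrow> (nat \<Rightarrow> 'f::field) \<Rightarrow> 'f" where
  "bethe_H I y = (\<Prod>i\<in>I. \<Prod>j\<in>{j\<in>I. j < i}. bethe_h (y i) (y j))"

lemma bethe_H_empty [simp]: "bethe_H {} y = 1"
  by (simp add: bethe_H_def)

lemma bethe_H_cong: "(\<And>i. i \<in> I \<Longrightarrow> y i = z i) \<Longrightarrow> bethe_H I y = bethe_H I z"
  by (simp add: bethe_H_def)

text \<open>Since h is symmetric, the order of the indices only selects one of the two ways to write
  a pair; the new index may stand anywhere among the old ones.\<close>

lemma bethe_H_insert:
  assumes "finite I" "a \<notin> I"
  shows "bethe_H (insert a I) y = bethe_H I y * (\<Prod>j\<in>I. bethe_h (y a) (y j))"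
proof -
  have 1: "(\<Prod>j\<in>{j\<in>insert a I. j < i}. bethe_h (y i) (y j))
      = (if a < i then bethe_h (y a) (y i) else 1) * (\<Prod>j\<in>{j\<in>I. j < i}. bethe_h (y i) (y j))" if "i \<in> I" for i
  proof (cases "a < i")
    case True
    then have "{j\<in>insert a I. j < i} = insert a {j\<in>I. j < i}" by auto
    with True assms show ?thesis by (simp add: bethe_h_def add.commute)
  next
    case False
    then have "{j\<in>insert a I. j < i} = {j\<in>I. j < i}" by auto
    with False show ?thesis by simp
  qed
  have 2: "{j\<in>insert a I. j < a} = {j\<in>I. j < a}" by auto
  have "bethe_H (insert a I) y = (\<Prod>j\<in>{j\<in>I. j < a}. bethe_h (y a) (y j)) * (\<Prod>i\<in>{i\<in>I. a < i}. bethe_h (y a) (y i)) * bethe_H I y"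
    unfolding bethe_H_def using assms 1 2
    by (simp add: prod.distrib prod.inter_filter mult.assoc)
  also have "(\<Prod>j\<in>{j\<in>I. j < a}. bethe_h (y a) (y j)) * (\<Prod>i\<in>{i\<in>I. a < i}. bethe_h (y a) (y i)) = (\<Prod>j\<in>I. bethe_h (y a) (y j))"
  proof -
    have "I = {j\<in>I. j < a} \<union> {i\<in>I. a < i}"
      using assms(2) by (auto simp: not_less_iff_gr_or_eq)
    then show ?thesis
      using assms(1) by (metis (no_types, lifting) prod.union_disjoint Collect_conj_eq disjoint_iff finite_Collect_conjI finite_Un mem_Collect_eq not_less_iff_gr_or_eq)
  qed
  finally show ?thesis by (simp add: mult.commute)
qed

context bethe
begin

definition sign_choices :: "nat set \<Rightarrow> (nat \<Rightarrow> 'f) \<Rightarrow> (nat \<Rightarrow> 'f) set" where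
  "sign_choices I u = PiE I (\<lambda>i. {u i, - u i})"

definition sign_weight :: "nat set \<Rightarrow> (nat \<Rightarrow> 'f) \<Rightarrow> 'f" where
  "sign_weight I y = (\<Prod>i\<in>I. bethe_G (y i) * \<mu> (y i)) * bethe_H I y"

text \<open>The vacuum expectation value: up to a factorial, the coefficient of \<open>\<xi>\<close>
  after e has removed all parameters of the Bethe vector.\<close>

definition vacuum :: "nat set \<Rightarrow> (nat \<Rightarrow> 'f) \<Rightarrow> 'f" where
  "vacuum I u = (\<Sum>y\<in>sign_choices I u. sign_weight I y)"

lemma sign_weight_insert:
  assumes "finite I" "a \<notin> I"
  shows "sign_weight (insert a I) (y(a := p)) = bethe_G p * \<mu> p * sign_weight I y * (\<Prod>j\<in>I. bethe_h p (y j))"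
proof -
  have "bethe_H I (y(a := p)) = bethe_H I y"
    by (rule bethe_H_cong) (use assms in auto)
  moreover have "(\<Prod>i\<in>I. bethe_G ((y(a := p)) i) * \<mu> ((y(a := p)) i)) = (\<Prod>i\<in>I. bethe_G (y i) * \<mu> (y i))"
    "(\<Prod>j\<in>I. bethe_h p ((y(a := p)) j)) = (\<Prod>j\<in>I. bethe_h p (y j))"
    using assms by (auto intro!: prod.cong)
  ultimately show ?thesis
    unfolding sign_weight_def using assms by (simp add: bethe_H_insert)
qed

text \<open>Splits g, which sees only w^2, according to a sign: h(p,q) completes the weight of an
  enlarged choice of signs, and h(p,- q) is left over.\<close>

lemma bethe_g_factor:
  assumes "q \<in> {w, - w}"
  shows "bethe_g p w = bethe_h p q * bethe_h p (- q)"
proof -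
  have *: "(p + 1)\<^sup>2 - q\<^sup>2 = (p + q + 1) * (p - q + 1)" "p\<^sup>2 - q\<^sup>2 = (p + q) * (p - q)"
    by (simp_all add: algebra_simps power2_eq_square)
  have "w\<^sup>2 = q\<^sup>2" using assms by auto
  then show ?thesis
    unfolding bethe_g_def bethe_h_def by (simp add: *)
qed

text \<open>The sign p of the removed parameter joins the signs of the others. Of the factors
  g(p,u_j), one half supplies the pair factors missing in \<open>sign_weight\<close>, the other half
  remains as the product of the h(y_a,- y_j).\<close>

lemma vacuum_remove:
  assumes "finite I" "a \<in> I"
  shows "(\<Sum>p\<in>{u a, - u a}. bethe_G p * (\<mu> p * (\<Prod>j\<in>I-{a}. bethe_g p (u j)))) * vacuum (I - {a}) u
    = (\<Sum>y\<in>sign_choices I u. sign_weight I y * (\<Prod>j\<in>I-{a}. bethe_h (y a) (- y j)))"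
proof -
  define J where "J = I - {a}"
  have I: "I = insert a J" "finite J" "a \<notin> J" using assms by (auto simp: J_def)
  have tm: "bethe_G p * (\<mu> p * (\<Prod>j\<in>J. bethe_g p (u j))) * sign_weight J y
      = sign_weight (insert a J) (y(a := p)) * (\<Prod>j\<in>J. bethe_h p (- (y(a := p)) j))" if "y \<in> sign_choices J u" for p y
  proof -
    have "(\<Prod>j\<in>J. bethe_g p (u j)) = (\<Prod>j\<in>J. bethe_h p (y j)) * (\<Prod>j\<in>J. bethe_h p (- y j))"
      unfolding prod.distrib [symmetric]
      by (rule prod.cong [OF refl], rule bethe_g_factor) (use that in \<open>auto simp: sign_choices_def PiE_def Pi_def\<close>)
    moreover have "(\<Prod>j\<in>J. bethe_h p (- (y(a := p)) j)) = (\<Prod>j\<in>J. bethe_h p (- y j))"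
      using I by (auto intro!: prod.cong)
    ultimately show ?thesis
      using I by (simp add: sign_weight_insert)
  qed
  have "(\<Sum>y\<in>sign_choices I u. sign_weight I y * (\<Prod>j\<in>J. bethe_h (y a) (- y j)))
     = (\<Sum>p\<in>{u a, - u a}. \<Sum>y\<in>sign_choices J u. sign_weight (insert a J) (y(a := p)) * (\<Prod>j\<in>J. bethe_h p (- (y(a := p)) j)))"
    unfolding sign_choices_def I(1) by (subst sum_PiE_insert [OF I(3)]) simp
  also have "\<dots> = (\<Sum>p\<in>{u a, - u a}. \<Sum>y\<in>sign_choices J u. bethe_G p * (\<mu> p * (\<Prod>j\<in>J. bethe_g p (u j))) * sign_weight J y)"
    by (intro sum.cong refl) (simp only: tm)
  also have "\<dots> = (\<Sum>p\<in>{u a, - u a}. bethe_G p * (\<mu> p * (\<Prod>j\<in>J. bethe_g p (u j)))) * vacuum J u"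
    unfolding vacuum_def sum_product ..
  finally show ?thesis
    unfolding J_def [symmetric] by simp
qed

lemma sign_choices_inj_on:
  assumes "admissible I u" "y \<in> sign_choices I u"
  shows "inj_on y I"
proof (rule inj_onI, rule ccontr)
  fix i j assume ij: "i \<in> I" "j \<in> I" "y i = y j" "i \<noteq> j"
  have "(y k)\<^sup>2 = (u k)\<^sup>2" if "k \<in> I" for k
    using assms(2) that by (auto simp: sign_choices_def PiE_def Pi_def)
  with ij have "(u i)\<^sup>2 = (u j)\<^sup>2" by metis
  with ij assms(1) show False by (auto simp: admissible_def)
qed

text \<open>For a fixed choice of signs the remaining factors are h(y_i,- y_j) = (y_i - y_j + 1) /
  (y_i - y_j), and their sum over i is card I by \<open>sum_prod_shifted_quotients\<close>. This is
  the origin of the factorial below.\<close>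

lemma vacuum_recurrence:
  assumes "admissible I u"
  shows "(\<Sum>i\<in>I. (\<Sum>p\<in>{u i, - u i}. bethe_G p * (\<mu> p * (\<Prod>j\<in>I-{i}. bethe_g p (u j)))) * vacuum (I - {i}) u)
    = of_nat (card I) * vacuum I u"
proof -
  have fin: "finite I" using assms by (simp add: admissible_def)
  have "(\<Sum>i\<in>I. (\<Sum>p\<in>{u i, - u i}. bethe_G p * (\<mu> p * (\<Prod>j\<in>I-{i}. bethe_g p (u j)))) * vacuum (I - {i}) u)
    = (\<Sum>i\<in>I. \<Sum>y\<in>sign_choices I u. sign_weight I y * (\<Prod>j\<in>I-{i}. bethe_h (y i) (- y j)))"
    by (rule sum.cong [OF refl], rule vacuum_remove [OF fin])
  also have "\<dots> = (\<Sum>y\<in>sign_choices I u. sign_weight I y * (\<Sum>i\<in>I. \<Prod>j\<in>I-{i}. bethe_h (y i) (- y j)))"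
    by (subst sum.swap) (simp add: sum_distrib_left)
  also have "\<dots> = (\<Sum>y\<in>sign_choices I u. sign_weight I y * of_nat (card I))"
    using sum_prod_shifted_quotients [OF fin sign_choices_inj_on [OF assms]]
    by (intro sum.cong refl) (simp add: bethe_h_def)
  also have "\<dots> = of_nat (card I) * vacuum I u"
    by (simp add: vacuum_def sum_distrib_left mult.commute)
  finally show ?thesis .
qed

lemma e_power_\<Gamma>:
  assumes "admissible I u"
  shows "(e ^^ card I) (\<Gamma> I u) = s (of_nat (fact (card I)) * vacuum I u) \<xi>"
  using assms
proof (induction "card I" arbitrary: I)
  case 0
  then have "I = {}" by (simp add: admissible_def)
  then show ?case by (simp add: vacuum_def sign_choices_def sign_weight_def)
next
  case (Suc n)
  interpret ee: Vector_Spaces.linear s s e by (rule linear_e)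
  have fin: "finite I" using Suc by (simp add: admissible_def)
  have lin: "(e ^^ n) (\<Sum>i\<in>A. s (c i) (w i)) = (\<Sum>i\<in>A. s (c i) ((e ^^ n) (w i)))" for n A c and w :: "nat \<Rightarrow> 'm"
    by (induction n) (simp_all add: ee.sum ee.scale)
  have IH: "(e ^^ n) (\<Gamma> (I - {i}) u) = s (of_nat (fact n) * vacuum (I - {i}) u) \<xi>" if "i \<in> I" for i
  proof -
    have c: "card (I - {i}) = n"
      using that fin Suc(2) by simp
    have "admissible (I - {i}) u"
      by (rule admissible_mono [OF Suc(3)]) auto
    from Suc(1) [OF c [symmetric] this] show ?thesis
      unfolding c .
  qed
  have "(e ^^ card I) (\<Gamma> I u) = (e ^^ n) (e (\<Gamma> I u))"
    by (simp only: Suc(2) [symmetric] funpow_Suc_right o_apply)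
  also have "\<dots> = (\<Sum>i\<in>I. s (\<Sum>y\<in>{u i, - u i}. bethe_G y * (\<mu> y * (\<Prod>j\<in>I-{i}. bethe_g y (u j)))) ((e ^^ n) (\<Gamma> (I - {i}) u)))"
    by (simp only: e_\<Gamma> [OF Suc(3)] lin)
  also have "\<dots> = (\<Sum>i\<in>I. s (of_nat (fact n) * ((\<Sum>y\<in>{u i, - u i}. bethe_G y * (\<mu> y * (\<Prod>j\<in>I-{i}. bethe_g y (u j)))) * vacuum (I - {i}) u)) \<xi>)"
    by (rule sum.cong [OF refl], simp only: IH scale_scale) (simp only: mult_ac)
  also have "\<dots> = s (of_nat (fact n) * (\<Sum>i\<in>I. (\<Sum>y\<in>{u i, - u i}. bethe_G y * (\<mu> y * (\<Prod>j\<in>I-{i}. bethe_g y (u j)))) * vacuum (I - {i}) u)) \<xi>"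
    by (simp only: scale_sum_left sum_distrib_left)
  also have "\<dots> = s (of_nat (fact n) * (of_nat (card I) * vacuum I u)) \<xi>"
    by (simp only: vacuum_recurrence [OF Suc(3)])
  also have "\<dots> = s (of_nat (fact (card I)) * vacuum I u) \<xi>"
    unfolding Suc(2) [symmetric] by (simp add: algebra_simps)
  finally show ?case .
qed

text \<open>The roots y^2 + y come from h(p,y) (p^2 - y^2) = (p^2 + p) - (y^2 + y): apart from its
  own factor G(p) mu(p), one more parameter p enters the weights, cleared of denominators, only
  through p^2 + p.\<close>

definition bethe_Q :: "nat set \<Rightarrow> (nat \<Rightarrow> 'f) \<Rightarrow> 'f poly" where
  "bethe_Q I u = (\<Sum>y\<in>sign_choices I u. smult (sign_weight I y) (\<Prod>j\<in>I. [:- ((y j)\<^sup>2 + y j), 1:]))"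

lemma coeff_bethe_Q:
  assumes "finite I"
  shows "coeff (bethe_Q I u) (card I) = vacuum I u"
  using coeff_prod_linear(2) [OF assms, of "\<lambda>j. - ((y j)\<^sup>2 + y j)" for y :: "nat \<Rightarrow> 'f"]
  by (simp add: bethe_Q_def vacuum_def coeff_sum)

text \<open>The two signs of the new parameter evaluate \<open>bethe_Q\<close> at v^2 + v and v^2 -
  v, and the minus sign between them appears because G is odd. The product on the left clears the
  denominators for all choices of signs at once, since it depends on squares only.\<close>

lemma vacuum_insert:
  assumes "admissible I u" "a \<notin> I" "v \<in> U" "\<And>i. i \<in> I \<Longrightarrow> v\<^sup>2 \<noteq> (u i)\<^sup>2"
  shows "vacuum (insert a I) (u(a := v)) * (\<Prod>j\<in>I. v\<^sup>2 - (u j)\<^sup>2)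
    = bethe_G v * (\<mu> v * poly (bethe_Q I u) (v\<^sup>2 + v) - \<mu> (- v) * poly (bethe_Q I u) (v\<^sup>2 - v))"
proof -
  have fin: "finite I" using assms by (simp add: admissible_def)
  have YI: "PiE I (\<lambda>i. {(u(a := v)) i, - (u(a := v)) i}) = sign_choices I u"
    unfolding sign_choices_def by (rule PiE_cong) (use assms in auto)
  have "vacuum (insert a I) (u(a := v)) * (\<Prod>j\<in>I. v\<^sup>2 - (u j)\<^sup>2)
    = (\<Sum>p\<in>{v, - v}. \<Sum>y\<in>sign_choices I u. sign_weight (insert a I) (y(a := p)) * (\<Prod>j\<in>I. v\<^sup>2 - (u j)\<^sup>2))"
    unfolding vacuum_def sign_choices_def by (subst sum_PiE_insert [OF assms(2)]) (simp only: YI [unfolded sign_choices_def] fun_upd_same sum_distrib_right)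
  also have "\<dots> = (\<Sum>p\<in>{v, - v}. bethe_G p * \<mu> p * poly (bethe_Q I u) (p\<^sup>2 + p))"
  proof (rule sum.cong [OF refl])
    fix p assume p: "p \<in> {v, - v}"
    have "sign_weight (insert a I) (y(a := p)) * (\<Prod>j\<in>I. v\<^sup>2 - (u j)\<^sup>2)
        = bethe_G p * \<mu> p * (sign_weight I y * (\<Prod>j\<in>I. - (y j)\<^sup>2 - y j + (p\<^sup>2 + p)))" if y: "y \<in> sign_choices I u" for y
    proof -
      have "(\<Prod>j\<in>I. bethe_h p (y j)) * (\<Prod>j\<in>I. v\<^sup>2 - (u j)\<^sup>2) = (\<Prod>j\<in>I. - (y j)\<^sup>2 - y j + (p\<^sup>2 + p))"
        unfolding prod.distrib [symmetric]
      proof (rule prod.cong [OF refl])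
        fix j assume j: "j \<in> I"
        have sq: "(u j)\<^sup>2 = (y j)\<^sup>2" "v\<^sup>2 = p\<^sup>2"
          using y j p by (auto simp: sign_choices_def PiE_def Pi_def)
        have "p + y j \<noteq> 0"
          using assms(4) [OF j] unfolding sq by (auto simp: add_eq_0_iff)
        then have "bethe_h p (y j) * ((p + y j) * (p - y j)) = (p + y j + 1) * (p - y j)"
          by (simp add: bethe_h_def)
        then show "bethe_h p (y j) * (v\<^sup>2 - (u j)\<^sup>2) = - (y j)\<^sup>2 - y j + (p\<^sup>2 + p)"
          unfolding sq by (simp add: algebra_simps power2_eq_square)
      qed
      then show ?thesis
        by (simp add: sign_weight_insert [OF fin assms(2)] mult.assoc)
    qed
    then show "(\<Sum>y\<in>sign_choices I u. sign_weight (insert a I) (y(a := p)) * (\<Prod>j\<in>I. v\<^sup>2 - (u j)\<^sup>2))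
        = bethe_G p * \<mu> p * poly (bethe_Q I u) (p\<^sup>2 + p)"
      by (simp add: bethe_Q_def poly_sum poly_prod sum_distrib_left)
  qed
  also have "\<dots> = bethe_G v * (\<mu> v * poly (bethe_Q I u) (v\<^sup>2 + v) - \<mu> (- v) * poly (bethe_Q I u) (v\<^sup>2 - v))"
    unfolding sum_pm [OF assms(3)] by (simp add: bethe_G_def algebra_simps)
  finally show ?thesis .
qed

text \<open>The excluded set consists of the squares of the fixed parameters, because the family
  enlarged by v has to stay admissible.\<close>

theorem exists_Q:
  assumes "\<xi> \<noteq> 0" and "of_nat (fact N) \<noteq> (0 :: 'f)"
    and zero: "\<And>I u. admissible I u \<Longrightarrow> card I = N \<Longrightarrow> \<Gamma> I u = 0"
  shows "\<exists>Q E. Q \<noteq> 0 \<and> finite E \<and>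
    (\<forall>v\<in>U. v\<^sup>2 \<notin> E \<longrightarrow> \<mu> v * poly Q (v\<^sup>2 + v) = \<mu> (- v) * poly Q (v\<^sup>2 - v))"
proof -
  define A where "A M \<longleftrightarrow> (\<forall>I u. admissible I u \<longrightarrow> card I = M \<longrightarrow> vacuum I u = 0)" for M
  have "A N"
    unfolding A_def
  proof safe
    fix I u assume I: "admissible I u" "N = card I"
    interpret ee: Vector_Spaces.linear s s e by (rule linear_e)
    have "(e ^^ n) 0 = 0" for n by (induction n) (simp_all add: ee.zero)
    then have "s (of_nat (fact (card I)) * vacuum I u) \<xi> = 0"
      using e_power_\<Gamma> [OF I(1)] zero [OF I(1)] I(2) by simp
    then show "vacuum I u = 0"
      using assms I by simp
  qed
  \<comment> \<open>Without parameters the scalar is the empty product 1, so somewhere between 0 and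
    N identical vanishing sets in.\<close>
  moreover have "\<not> A 0"
    unfolding A_def by (auto intro!: exI [of _ "{}"] simp: admissible_def vacuum_def sign_choices_def sign_weight_def)
  ultimately obtain M where M: "A (Suc M)" "\<not> A M"
    using nat_induct [of "\<lambda>M. \<not> A M" N] by blast
  from M(2) obtain I u where I: "admissible I u" "card I = M" "vacuum I u \<noteq> 0"
    by (auto simp: A_def)
  have fin: "finite I" using I by (simp add: admissible_def)
  have "bethe_Q I u \<noteq> 0"
    using coeff_bethe_Q [OF fin, of u] I(3) by auto
  moreover have "\<mu> v * poly (bethe_Q I u) (v\<^sup>2 + v) = \<mu> (- v) * poly (bethe_Q I u) (v\<^sup>2 - v)"
    if v: "v \<in> U" "v\<^sup>2 \<notin> (\<lambda>i. (u i)\<^sup>2) ` I" for v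
  proof -
    obtain a where a: "a \<notin> I" using fin ex_new_if_finite infinite_UNIV_nat by blast
    have vi: "v\<^sup>2 \<noteq> (u i)\<^sup>2" if "i \<in> I" for i using v that by auto
    have "admissible (insert a I) (u(a := v))"
      unfolding admissible_def
    proof (intro conjI ballI impI)
      fix i j assume "i \<in> insert a I" "j \<in> insert a I" "i \<noteq> j"
      then show "((u(a := v)) i)\<^sup>2 \<noteq> ((u(a := v)) j)\<^sup>2"
        using I(1) vi [of i] vi [of j] by (auto simp: admissible_def)
    qed (use I(1) v in \<open>auto simp: admissible_def\<close>)
    moreover have "card (insert a I) = Suc M" using a fin I by simp
    ultimately have "vacuum (insert a I) (u(a := v)) = 0"
      using M(1) by (simp add: A_def)
    then have "bethe_G v * (\<mu> v * poly (bethe_Q I u) (v\<^sup>2 + v) - \<mu> (- v) * poly (bethe_Q I u) (v\<^sup>2 - v)) = 0"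
      using vacuum_insert [OF I(1) a v(1) vi] by simp
    \<comment> \<open>The zeros and the pole of G are at 1/2, - 1/2 and 0, all outside
      \<open>U\<close>.\<close>
    moreover have "bethe_G v \<noteq> 0"
    proof -
      have "4 * v\<^sup>2 - 1 = (2 * v - 1) * (2 * v + 1)"
        by (simp add: algebra_simps power2_eq_square)
      then show ?thesis
        using U_half [OF v(1)] U_half' [OF v(1)] U_nonzero [OF v(1)] by (simp add: bethe_G_def)
    qed
    ultimately show ?thesis by simp
  qed
  moreover have "finite ((\<lambda>i. (u i)\<^sup>2) ` I)"
    using fin by simp
  ultimately show ?thesis by blast
qed

end

section \<open>Component form of the defining relations\<close>

lemma uminus_idx_simps [simp]:
  "- MinusOne = PlusOne" "- PlusOne = MinusOne" "- (- i) = (i::idx)" "(- i = - j) = (i = (j::idx))"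
  by (simp_all add: uminus_idx_def split: idx.splits)

lemma sum_idx: "(\<Sum>i\<in>UNIV. f i) = f MinusOne + f PlusOne"
  by (simp add: UNIV_idx)

lemma sum_idx_pair: "(\<Sum>p\<in>UNIV. f p) = (\<Sum>a\<in>UNIV. \<Sum>b\<in>UNIV. f (a, b :: idx))"
  for f :: "idx \<times> idx \<Rightarrow> 'a::comm_monoid_add"
  unfolding UNIV_Times_UNIV [symmetric] sum.cartesian_product by simp

lemma P_mat_nth: "P_mat $ (a, b) $ (c, d) = (if a = d \<and> b = c then 1 else 0)"
  by (cases a; cases b; cases c; cases d)
    (simp_all add: P_mat_def tensor_mat_def E_mat_def sum_idx)

lemma P'_mat_nth: "P'_mat $ (a, b) $ (c, d) = (if b = - a \<and> d = - c then theta a c else 0)"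
  by (cases a; cases b; cases c; cases d)
    (simp_all add: P'_mat_def prime_mat_def tensor_mat_def E_mat_def sum_idx theta_def sgn_idx_def)

abbreviation fu :: "'a::ring_1 fls fls" where "fu \<equiv> fls_X_inv"
abbreviation fv :: "'a::ring_1 fls fls" where "fv \<equiv> fls_const fls_X_inv"

definition s_u :: "idx \<Rightarrow> idx \<Rightarrow> 'k::field free_alg fls fls" where
  "s_u i j = fps_to_fls (Abs_fps (\<lambda>r. fls_const (s_free i j r)))"

definition s_v :: "idx \<Rightarrow> idx \<Rightarrow> 'k::field free_alg fls fls" where
  "s_v i j = fls_const (fps_to_fls (Abs_fps (s_free i j)))"

text \<open>These are 1/(u - v) and 1/(u + v). The second occurs with a plus sign, because R'(- u -
  v) = 1 + P'/(u + v).\<close>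

definition inv_diff :: "'a::ring_1 fls fls" where "inv_diff = inv_u_minus fls_X_inv"
definition inv_sum :: "'a::ring_1 fls fls" where "inv_sum = inv_u_minus (- fls_X_inv)"

lemma fu_commute: "fu * x = x * fu"
  by (simp add: fls_X_inv_times_conv_shift)

lemma fv_commute: "fv * x = x * fv"
  by (rule fls_eqI) (simp add: fls_X_inv_times_conv_shift)

lemma inv_diff_left: "(fu - fv) * inv_diff = 1"
  unfolding inv_diff_def by (rule inv_u_minus_right)

lemma inv_sum_left: "(fu + fv) * inv_sum = 1"
  using inv_u_minus_right [of "- fls_X_inv"] unfolding inv_sum_def by simp

text \<open>The coefficient ring is not commutative, but u - v and u + v are central, and hence so
  are their inverses.\<close>

lemma central_inverse_commute:
  fixes c w x :: "'a::ring_1"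
  assumes "\<And>x. c * x = x * c" "c * w = 1"
  shows "w * x = x * w"
proof -
  have "w * x = w * (x * (c * w))" using assms(2) by simp
  also have "\<dots> = (c * w) * x * w" by (metis assms(1) mult.assoc)
  finally show ?thesis using assms(2) by simp
qed

lemma inv_diff_commute: "inv_diff * x = x * inv_diff"
  by (rule central_inverse_commute [OF _ inv_diff_left])
    (simp add: left_diff_distrib right_diff_distrib fu_commute fv_commute)

lemma inv_sum_commute: "inv_sum * x = x * inv_sum"
  by (rule central_inverse_commute [OF _ inv_sum_left])
    (simp add: distrib_left distrib_right fu_commute fv_commute)

lemma R_mat_nth: "R_mat w Q $ a $ b = (if a = b then 1 else 0) - w * Q $ a $ b"
  by (simp add: R_mat_def mat_def)

text \<open>Entries of S_1(u) R'(- u - v) S_2(v); \<open>M2\<close> belongs to the product in the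
  opposite order.\<close>

definition M1 :: "idx \<Rightarrow> idx \<Rightarrow> idx \<Rightarrow> idx \<Rightarrow> 'k::field free_alg fls fls" where
  "M1 i k j l = s_u i j * s_v k l + inv_sum * (theta (- k) j * (s_u i (- k) * s_v (- j) l))"

definition M2 :: "idx \<Rightarrow> idx \<Rightarrow> idx \<Rightarrow> idx \<Rightarrow> 'k::field free_alg fls fls" where
  "M2 i k j l = s_v k l * s_u i j + inv_sum * (theta i (- l) * (s_v k (- i) * s_u (- l) j))"

lemma S1_nth: "S1_u $ (a, b) $ (c, d) = (if b = d then s_u a c else 0)"
  by (simp add: S1_u_def tensor_mat_def s_u_def mat_def)

lemma S2_nth: "S2_v $ (a, b) $ (c, d) = (if a = c then s_v b d else 0)"
  by (simp add: S2_v_def tensor_mat_def s_v_def mat_def)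

lemma R'_nth: "R'_uv $ (a, b) $ (c, d) = (if a = c \<and> b = d then 1 else 0)
    + inv_sum * (if b = - a \<and> d = - c then theta a c else 0)"
  by (simp add: R'_uv_def R_mat_nth P'_mat_nth inv_sum_def)

lemma R_nth: "R_uv $ (a, b) $ (c, d) = (if a = c \<and> b = d then 1 else 0)
    - inv_diff * (if a = d \<and> b = c then 1 else 0)"
  by (simp add: R_uv_def R_mat_nth P_mat_nth inv_diff_def)

lemma inv_sum_left_commute: "x * (inv_sum * y) = inv_sum * (x * y)"
  by (metis mult.assoc inv_sum_commute)

lemma inv_diff_left_commute: "x * (inv_diff * y) = inv_diff * (x * y)"
  by (metis mult.assoc inv_diff_commute)

lemma M1_eq: "(S1_u ** R'_uv ** S2_v) $ (i, k) $ (j, l) = M1 i k j l"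
  by (cases i; cases k; cases j; cases l)
    (simp_all add: M1_def matrix_matrix_mult_def sum_idx_pair sum_idx S1_nth S2_nth R'_nth
      distrib_left distrib_right mult.assoc inv_sum_left_commute theta_def sgn_idx_def)

lemma M2_eq: "(S2_v ** R'_uv ** S1_u) $ (i, k) $ (j, l) = M2 i k j l"
  by (cases i; cases k; cases j; cases l)
    (simp_all add: M2_def matrix_matrix_mult_def sum_idx_pair sum_idx S1_nth S2_nth R'_nth
      distrib_left distrib_right mult.assoc inv_sum_left_commute theta_def sgn_idx_def)

lemma R_mult_nth: "(R_uv ** X) $ (i, k) $ q = X $ (i, k) $ q - inv_diff * X $ (k, i) $ q"
  by (cases i; cases k) (simp_all add: matrix_matrix_mult_def sum_idx_pair sum_idx R_nth algebra_simps)

lemma mult_R_nth: "(X ** R_uv) $ q $ (j, l) = X $ q $ (j, l) - inv_diff * X $ q $ (l, j)"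
  by (cases j; cases l)
    (simp_all add: matrix_matrix_mult_def sum_idx_pair sum_idx R_nth algebra_simps inv_diff_commute)

lemma defect_nth: "(reflection_defect :: 'k::field free_alg fls fls ^ _ ^ _) $ (i, k) $ (j, l)
  = M1 i k j l - inv_diff * M1 k i j l - (M2 i k j l - inv_diff * M2 i k l j)"
proof -
  have "(R_uv ** S1_u ** R'_uv ** S2_v) $ (i, k) $ (j, l) = (M1 i k j l - inv_diff * M1 k i j l :: 'k free_alg fls fls)"
    unfolding matrix_mul_assoc [symmetric] R_mult_nth
    unfolding matrix_mul_assoc M1_eq ..
  moreover have "(S2_v ** R'_uv ** S1_u ** R_uv) $ (i, k) $ (j, l) = (M2 i k j l - inv_diff * M2 i k l j :: 'k free_alg fls fls)"
    unfolding mult_R_nth M2_eq ..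
  ultimately show ?thesis
    by (simp add: reflection_defect_def)
qed

lemma fuv_M1: "(fu + fv) * M1 i k j l
  = (fu + fv) * (s_u i j * s_v k l) + theta (- k) j * (s_u i (- k) * s_v (- j) l)"
  by (simp add: M1_def distrib_left mult.assoc [symmetric] inv_sum_left)

lemma fuv_M2: "(fu + fv) * M2 i k j l
  = (fu + fv) * (s_v k l * s_u i j) + theta i (- l) * (s_v k (- i) * s_u (- l) j)"
  by (simp add: M2_def distrib_left mult.assoc [symmetric] inv_sum_left)

text \<open>Multiplication by (u - v)(u + v) removes both inverses, so that each coefficient becomes
  a finite expression in the generators.\<close>

lemma reflection_entry:
  "(fu - fv) * ((fu + fv) * reflection_defect $ (i, k) $ (j, l))
   = (fu - fv) * ((fu + fv) * (s_u i j * s_v k l) + theta (- k) j * (s_u i (- k) * s_v (- j) l))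
   - ((fu + fv) * (s_u k j * s_v i l) + theta (- i) j * (s_u k (- i) * s_v (- j) l))
   - (fu - fv) * ((fu + fv) * (s_v k l * s_u i j) + theta i (- l) * (s_v k (- i) * s_u (- l) j))
   + ((fu + fv) * (s_v k j * s_u i l) + theta i (- j) * (s_v k (- i) * s_u (- j) l))"
proof -
  have *: "(fu + fv) * (inv_diff * x) = inv_diff * ((fu + fv) * x)" for x
    by (rule inv_diff_left_commute)
  have **: "(fu - fv) * (inv_diff * x) = x" for x
    by (simp add: mult.assoc [symmetric] inv_diff_left)
  show ?thesis
    unfolding defect_nth
    by (simp only: right_diff_distrib [of "fu + fv"] * fuv_M1 fuv_M2 right_diff_distrib [of "fu - fv"] **)
      (simp only: diff_diff_eq2 diff_diff_eq algebra_simps)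
qed

text \<open>The coefficient of \<open>u\<^sup>-\<^sup>m v\<^sup>-\<^sup>n\<close>.\<close>

definition coeff_uv :: "'a::ring_1 fls fls \<Rightarrow> int \<Rightarrow> int \<Rightarrow> 'a" where
  "coeff_uv x m n = fls_nth (fls_nth x m) n"

text \<open>Extended by 0 to negative indices: multiplication by u or v is then a shift without
  boundary cases, and the relations at index - 1 become instances of the general one.\<close>

definition s_int :: "idx \<Rightarrow> idx \<Rightarrow> int \<Rightarrow> 'k::field free_alg" where
  "s_int i j m = (if m < 0 then 0 else s_free i j (nat m))"

lemma coeff_uv_add: "coeff_uv (x + y) m n = coeff_uv x m n + coeff_uv y m n"
  and coeff_uv_diff: "coeff_uv (x - y) m n = coeff_uv x m n - coeff_uv y m n"
  and coeff_uv_uminus: "coeff_uv (- x) m n = - coeff_uv x m n"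
  by (simp_all add: coeff_uv_def)

lemma coeff_uv_fu: "coeff_uv (fu * x) m n = coeff_uv x (m + 1) n"
  by (simp add: coeff_uv_def fls_X_inv_times_conv_shift)

lemma coeff_uv_fv: "coeff_uv (fv * x) m n = coeff_uv x m (n + 1)"
  by (simp add: coeff_uv_def fls_X_inv_times_conv_shift)

lemma coeff_uv_s_u_s_v: "coeff_uv (s_u i j * s_v k l) m n = s_int i j m * s_int k l n"
  by (auto simp: coeff_uv_def s_u_def s_v_def s_int_def)

lemma coeff_uv_s_v_s_u: "coeff_uv (s_v k l * s_u i j) m n = s_int k l n * s_int i j m"
  by (auto simp: coeff_uv_def s_u_def s_v_def s_int_def)

lemma coeff_uv_theta: "coeff_uv (theta i j * x) m n = theta i j * coeff_uv x m n"
  by (cases i; cases j) (simp_all add: theta_def sgn_idx_def coeff_uv_uminus)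

section \<open>Operators of a representation and their quadratic relations\<close>

text \<open>Not an instance of \<open>ring_1\<close>, since \<open>0 = 1\<close> when \<open>'v\<close> is trivial.\<close>

typedef (overloaded) 'v endo = "{f :: 'v::ab_group_add \<Rightarrow> 'v. \<forall>x y. f (x + y) = f x + f y}"
  morphisms app Endo
  by (rule exI [of _ "\<lambda>x. 0"]) simp

setup_lifting type_definition_endo

lemma app_add: "app f (x + y) = app f x + app f y"
  using app [of f] by simp

lemma app_zero [simp]: "app f 0 = 0"
  using app_add [of f 0 0] by simp

instantiation endo :: (ab_group_add) ring
begin

lift_definition zero_endo :: "'a endo" is "\<lambda>x. 0" by simp
lift_definition plus_endo :: "'a endo \<Rightarrow> 'a endo \<Rightarrow> 'a endo" is "\<lambda>f g x. f x + g x"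
  by (simp add: algebra_simps)
lift_definition uminus_endo :: "'a endo \<Rightarrow> 'a endo" is "\<lambda>f x. - f x"
  by (simp add: algebra_simps)
lift_definition minus_endo :: "'a endo \<Rightarrow> 'a endo \<Rightarrow> 'a endo" is "\<lambda>f g x. f x - g x"
  by (simp add: algebra_simps)
lift_definition times_endo :: "'a endo \<Rightarrow> 'a endo \<Rightarrow> 'a endo" is "\<lambda>f g x. f (g x)"
  by simp

instance
  by standard (transfer; simp add: fun_eq_iff algebra_simps)+

end

lemma app_simps [simp]:
  "app (f + g) x = app f x + app g x" "app (f - g) x = app f x - app g x"
  "app (- f) x = - app f x" "app (f * g) x = app f (app g x)" "app 0 x = 0"
  by (transfer, simp)+

lemma endo_eqI: "(\<And>x. app f x = app g x) \<Longrightarrow> f = g"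
  by (metis app_inverse ext)

locale twisted_rep =
  fixes scl :: "'k::field \<Rightarrow> 'v \<Rightarrow> 'v::ab_group_add"
    and \<rho> :: "'k free_alg set \<Rightarrow> 'v \<Rightarrow> 'v"
  assumes rep: "yangian_rep scl \<rho>" and two: "(2::'k) \<noteq> 0"
begin

sublocale V: vector_space scl
  using rep by (simp add: yangian_rep_def)

text \<open>The free algebra acting on the representation. The type of endomorphisms records only
  additivity; linearity over the ground field is \<open>app_E_scale\<close>.\<close>

definition E :: "'k free_alg \<Rightarrow> 'v endo" where
  "E x = Endo (\<rho> (yangian_class x))"

lemma class_hom: "yangian_class \<in> ring_hom free_ring (yangian :: 'k free_alg set ring)"
  using ideal.rcos_ring_hom [OF yangian_ideal_ideal]
  unfolding yangian_def by (simp add: yangian_class_def [abs_def])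

lemma rho_hom: "\<rho> \<in> ring_hom yangian (End_ring scl)"
  using rep by (simp add: yangian_rep_def)

lemma class_carrier: "yangian_class (x :: 'k free_alg) \<in> carrier yangian"
  using ring_hom_closed [OF class_hom, of x] by (simp add: free_ring_def)

lemma linear_rho: "Vector_Spaces.linear scl scl (\<rho> (yangian_class x))"
  using ring_hom_closed [OF rho_hom class_carrier] by (simp add: End_ring_def)

lemma app_E: "app (E x) = \<rho> (yangian_class x)"
proof -
  interpret L: Vector_Spaces.linear scl scl "\<rho> (yangian_class x)" by (rule linear_rho)
  show ?thesis
    unfolding E_def by (rule Endo_inverse) (simp add: L.add)
qed

lemma app_E_scale: "app (E x) (scl c v) = scl c (app (E x) v)"
proof -
  interpret L: Vector_Spaces.linear scl scl "\<rho> (yangian_class x)" by (rule linear_rho)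
  show ?thesis by (simp add: app_E L.scale)
qed

lemma E_add: "E (x + y) = E x + E y"
proof (rule endo_eqI)
  fix v
  have "\<rho> (yangian_class (x + y)) = \<rho> (yangian_class x) \<oplus>\<^bsub>End_ring scl\<^esub> \<rho> (yangian_class y)"
    using ring_hom_add [OF class_hom, of x y] ring_hom_add [OF rho_hom class_carrier class_carrier, of x y]
    by (simp add: free_ring_def)
  then show "app (E (x + y)) v = app (E x + E y) v"
    by (simp add: app_E End_ring_def)
qed

lemma E_mult: "E (x * y) = E x * E y"
proof (rule endo_eqI)
  fix v
  have "\<rho> (yangian_class (x * y)) = \<rho> (yangian_class x) \<otimes>\<^bsub>End_ring scl\<^esub> \<rho> (yangian_class y)"
    using ring_hom_mult [OF class_hom, of x y] ring_hom_mult [OF rho_hom class_carrier class_carrier, of x y]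
    by (simp add: free_ring_def)
  then show "app (E (x * y)) v = app (E x * E y) v"
    by (simp add: app_E End_ring_def)
qed

lemma E_zero [simp]: "E 0 = 0"
  using E_add [of 0 0] by simp

lemma E_uminus: "E (- x) = - E x"
  using E_add [of x "- x"] by (simp add: eq_neg_iff_add_eq_0 add.commute)

lemma E_diff: "E (x - y) = E x - E y"
  using E_add [of x "- y"] by (simp add: E_uminus)

lemma app_E_scalar: "app (E (free_scalar c)) v = scl c v"
  using rep by (simp add: app_E yangian_rep_def)

lemma app_E_one: "app (E 1) v = v"
proof -
  have "(1 :: 'k free_alg) = free_scalar 1"
    by (simp add: free_scalar_def)
  then show ?thesis using app_E_scalar [of 1 v] by simp
qed

lemma E_relator: "x \<in> yangian_relators \<Longrightarrow> E x = 0"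
proof -
  assume x: "x \<in> (yangian_relators :: 'k free_alg set)"
  interpret I: ideal "yangian_ideal :: 'k free_alg set" free_ring by (rule yangian_ideal_ideal)
  have c: "carrier free_ring = (UNIV :: 'k free_alg set)" by (simp add: free_ring_def)
  have "x \<in> yangian_ideal"
    unfolding yangian_ideal_def
    using I.genideal_self [of yangian_relators] x unfolding c by blast
  moreover have "0 \<in> (yangian_ideal :: 'k free_alg set)"
    using additive_subgroup.zero_closed [OF I.is_additive_subgroup] by (simp add: free_ring_def)
  ultimately have "yangian_class x = yangian_class 0"
    unfolding yangian_class_def
    using I.a_coset_join2 [OF _ additive_subgroup.a_subgroup [OF I.is_additive_subgroup]] c by simp
  then have "E x = E 0" by (simp add: E_def)
  then show ?thesis by simp
qed

definition op :: "idx \<Rightarrow> idx \<Rightarrow> int \<Rightarrow> 'v endo" where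
  "op i j m = E (s_int i j m)"

lemma op_neg: "m < 0 \<Longrightarrow> op i j m = 0"
  by (simp add: op_def s_int_def)

lemma app_op_nat: "app (op i j (int r)) = s_act \<rho> i j r"
  by (simp add: op_def s_int_def app_E s_act_def)

lemma app_op_scale: "app (op i j m) (scl c v) = scl c (app (op i j m) v)"
  by (simp add: op_def app_E_scale)

lemma E_coeff_defect: "E (coeff_uv (reflection_defect $ a $ b) m n) = 0"
  by (rule E_relator) (unfold coeff_uv_def yangian_relators_def, blast)

text \<open>\<open>theta\<close> lives in a ring with unit, of which \<open>'v endo\<close> is not
  an instance; its sign is therefore applied as a map.\<close>

definition theta_times :: "idx \<Rightarrow> idx \<Rightarrow> 'v endo \<Rightarrow> 'v endo" where
  "theta_times i j x = (if i = j then x else - x)"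

lemma E_theta: "E (theta i j * x) = theta_times i j (E x)"
  by (cases i; cases j) (simp_all add: theta_def sgn_idx_def theta_times_def E_uminus)

text \<open>The reflection equation multiplied by \<open>u\<^sup>2 - v\<^sup>2\<close>.\<close>

lemma reflection_op:
  "op i j (m + 2) * op k l n - op i j m * op k l (n + 2)
    + theta_times (- k) j (op i (- k) (m + 1) * op (- j) l n - op i (- k) m * op (- j) l (n + 1))
    - (op k j (m + 1) * op i l n + op k j m * op i l (n + 1)) - theta_times (- i) j (op k (- i) m * op (- j) l n)
    - (op k l n * op i j (m + 2) - op k l (n + 2) * op i j m)
    - theta_times i (- l) (op k (- i) n * op (- l) j (m + 1) - op k (- i) (n + 1) * op (- l) j m)
    + (op k j n * op i l (m + 1) + op k j (n + 1) * op i l m) + theta_times i (- j) (op k (- i) n * op (- j) l m) = 0"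
proof -
  have "E (coeff_uv ((fu - fv) * ((fu + fv) * reflection_defect $ (i, k) $ (j, l))) m n) = 0"
    by (simp add: left_diff_distrib distrib_right coeff_uv_add coeff_uv_diff coeff_uv_fu coeff_uv_fv E_diff E_add E_coeff_defect)
  then have "E (coeff_uv ((fu - fv) * ((fu + fv) * (s_u i j * s_v k l) + theta (- k) j * (s_u i (- k) * s_v (- j) l))) m n)
   - E (coeff_uv ((fu + fv) * (s_u k j * s_v i l) + theta (- i) j * (s_u k (- i) * s_v (- j) l)) m n)
   - E (coeff_uv ((fu - fv) * ((fu + fv) * (s_v k l * s_u i j) + theta i (- l) * (s_v k (- i) * s_u (- l) j))) m n)
   + E (coeff_uv ((fu + fv) * (s_v k j * s_u i l) + theta i (- j) * (s_v k (- i) * s_u (- j) l)) m n) = 0"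
    unfolding reflection_entry by (simp only: coeff_uv_add coeff_uv_diff E_add E_diff)
  then show ?thesis
    by (simp only: left_diff_distrib distrib_right distrib_left [of fu] distrib_left [of fv]
      coeff_uv_add coeff_uv_diff coeff_uv_fu coeff_uv_fv coeff_uv_theta E_diff E_add E_theta coeff_uv_s_u_s_v coeff_uv_s_v_s_u)
     (cases "- k = j"; cases "- i = j"; cases "i = - l"; cases "i = - j";
       simp add: theta_times_def E_mult op_def [symmetric] algebra_simps)
qed

abbreviation "A \<equiv> op MinusOne MinusOne"
abbreviation "B \<equiv> op MinusOne PlusOne"
abbreviation "C \<equiv> op PlusOne MinusOne"
abbreviation "D \<equiv> op PlusOne PlusOne"

lemma CC: "C (m + 2) * C n - C n * C (m + 2) - (C m * C (n + 2) - C (n + 2) * C m)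
    - (C m * C (n + 1) - C (n + 1) * C m) - (C m * C (n + 1) - C (n + 1) * C m) - (C m * C n - C n * C m) = 0"
  using reflection_op [of PlusOne MinusOne m PlusOne MinusOne n]
  by (simp add: theta_times_def algebra_simps)

text \<open>Arranged so that every term on the right ends in a coefficient of b(u) and disappears on
  vectors killed by all of them.\<close>

lemma DD: "D (m + 2) * D n - D n * D (m + 2) - (D m * D (n + 2) - D (n + 2) * D m)
    - (D (m + 1) * D n - D n * D (m + 1)) - (D m * D (n + 1) - D (n + 1) * D m)
    = C (m + 1) * B n - C m * B (n + 1) - (C n * B (m + 1) - C (n + 1) * B m)
      - (C m * B n - C n * B m)"
  using reflection_op [of PlusOne PlusOne m PlusOne PlusOne n]
  by (simp add: theta_times_def algebra_simps)

text \<open>The coefficients of a(u) that occur here are eliminated later by the symmetry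
  relation.\<close>

lemma CD: "C (m + 2) * D n - D n * C (m + 2) - (C m * D (n + 2) - D (n + 2) * C m)
   = (C (m + 1) * D n + C m * D (n + 1) - (C n * D (m + 1) + C (n + 1) * D m))
    - (C (m + 1) * D n - C m * D (n + 1)) - (C n * A (m + 1) - C (n + 1) * A m)
    + (C m * D n - C n * D m)"
  using reflection_op [of PlusOne MinusOne m PlusOne PlusOne n]
  by (simp add: theta_times_def algebra_simps)

lemma op_zero: "i \<noteq> j \<Longrightarrow> op i j 0 = 0" "op i i 0 = E 1"
  by (simp_all add: op_def s_int_def s_free_def)

lemma E1: "E 1 * x = x" "op i j m * E 1 = op i j m"
  by (auto intro!: endo_eqI simp: app_E_one)

text \<open>The case \<open>m = - 1\<close>, that is, the coefficient of \<open>u\<close>.\<close>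

lemma BC: "B 1 * C n - C n * B 1 = A n + A n - D n - D n"
  using reflection_op [of MinusOne PlusOne "- 1" PlusOne MinusOne n]
  by (simp add: theta_times_def op_zero op_neg E1 algebra_simps)

text \<open>Since D 1 is the action of F_11, the coefficients of b(u) lower weights by 2; those of
  c(u) raise them by 2 by \<open>D1_C\<close>.\<close>

lemma D1_B: "D 1 * B n - B n * D 1 = - (B n) - B n"
  using reflection_op [of PlusOne PlusOne "- 1" MinusOne PlusOne n]
  by (simp add: theta_times_def op_zero op_neg E1 algebra_simps)

lemma D1_C: "D 1 * C n - C n * D 1 = C n + C n"
  using reflection_op [of PlusOne PlusOne "- 1" PlusOne MinusOne n]
  by (simp add: theta_times_def op_zero op_neg E1 algebra_simps)

lemma D1_D: "D 1 * D n - D n * D 1 = 0"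
  using reflection_op [of PlusOne PlusOne "- 1" PlusOne PlusOne n]
  by (simp add: theta_times_def op_zero op_neg E1 algebra_simps)

end

section \<open>Generating series of operators\<close>

definition alt_sign :: "nat \<Rightarrow> 'a::group_add \<Rightarrow> 'a" where
  "alt_sign r x = (if even r then x else - x)"

lemma neg_one_power_mult: "(- 1) ^ r * x = (alt_sign r x :: 'a::ring_1)"
  by (simp add: alt_sign_def)

lemma symmetry_nth:
  "fps_nth (symmetry_defect $ i $ j) r
    = theta i j * alt_sign r (s_free (- j) (- i) r)
      - (s_free i j r - free_scalar (1/2) * (if r = 0 then 0 else s_free i j (r - 1) - alt_sign (r - 1) (s_free i j (r - 1))))"
proof -
  have 1: "fps_nth (theta i j * f) r = theta i j * fps_nth f r" for f :: "'a free_alg fps"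
    by (cases i; cases j) (simp_all add: theta_def sgn_idx_def)
  have 2: "fps_nth (fps_const c * fps_X * f) r = c * (if r = 0 then 0 else fps_nth f (r - 1))" for c and f :: "'a free_alg fps"
    by (simp add: mult.assoc)
  show ?thesis
    unfolding symmetry_defect_def prime_mat_def
    by (simp only: vector_minus_component vec_lambda_beta fps_sub_nth 1 2)
      (simp add: S_neg_u_def S_u_def neg_u_def neg_one_power_mult)
qed

text \<open>Any lower bounds of the supports serve. This matters for embedded scalar series, whose
  subdegree can change when \<open>'v\<close> is trivial.\<close>

lemma fls_times_nth_range:
  fixes f g :: "'a::ring fls"
  assumes "\<And>i. i < a \<Longrightarrow> fls_nth f i = 0" "\<And>i. i < b \<Longrightarrow> fls_nth g i = 0"
  shows "fls_nth (f * g) n = (\<Sum>i=a..n - b. fls_nth f i * fls_nth g (n - i))"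
  unfolding fls_times_nth(2)
proof (rule sum.mono_neutral_cong)
  show "fls_nth f i * fls_nth g (n - i) = 0" if "i \<in> {a..n - b} - {fls_subdegree f..n - fls_subdegree g}" for i
    using that by (cases "i < fls_subdegree f") auto
  show "fls_nth f i * fls_nth g (n - i) = 0" if "i \<in> {fls_subdegree f..n - fls_subdegree g} - {a..n - b}" for i
    using that assms(1) [of i] assms(2) [of "n - i"] by (cases "i < a") auto
qed auto

lemma fls_commute_coeffs:
  fixes f g :: "'a::ring fls"
  assumes "\<And>i j. fls_nth f i * fls_nth g j = fls_nth g j * fls_nth f i"
  shows "f * g = g * f"
proof (rule fls_eqI)
  fix n
  show "fls_nth (f * g) n = fls_nth (g * f) n"
    unfolding fls_times_nth(2) [of f g] fls_times_nth(2) [of g f]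
    by (rule sum.reindex_bij_witness [of _ "\<lambda>i. n - i" "\<lambda>i. n - i"]) (auto simp: assms)
qed

context twisted_rep
begin

definition scalar :: "'k \<Rightarrow> 'v endo" where "scalar c = E (free_scalar c)"

lemma app_scalar [simp]: "app (scalar c) v = scl c v"
  by (simp add: scalar_def app_E_scalar)

lemma scalar_simps: "scalar (c + d) = scalar c + scalar d" "scalar (c * d) = scalar c * scalar d" "scalar 0 = 0" "scalar (- c) = - scalar c"
    "scalar 1 * x = x"
  by (auto intro!: endo_eqI simp: V.scale_left_distrib)

lemma op_scalar: "op i j m * scalar c = scalar c * op i j m"
  by (auto intro!: endo_eqI simp: app_op_scale)

lemma E_alt_sign: "E (alt_sign r x) = alt_sign r (E x)"
  by (simp add: alt_sign_def E_uminus)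

text \<open>The relation is doubled, so that its coefficient 1/2 disappears.\<close>

lemma symmetry_op:
  "theta_times i j (alt_sign r (op (- j) (- i) (int r))) + theta_times i j (alt_sign r (op (- j) (- i) (int r)))
    = op i j (int r) + op i j (int r)
      - (op i j (int r - 1) - alt_sign (r - 1) (op i j (int r - 1)))"
proof -
  have half: "E (free_scalar (1/2) * x) + E (free_scalar (1/2) * x) = E x" for x :: "'k free_alg"
  proof -
    have "scalar (1/2) * E x + scalar (1/2) * E x = scalar (1/2 + 1/2) * E x"
      by (simp only: scalar_simps distrib_right)
    also have "(1/2 + 1/2 :: 'k) = 1"
      using two by (metis add_divide_distrib divide_self one_add_one)
    finally show ?thesis by (simp add: scalar_simps E_mult scalar_def [symmetric])
  qed
  have "E (fps_nth (symmetry_defect $ i $ j) r) = 0"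
    by (rule E_relator) (unfold yangian_relators_def, blast)
  then have *: "theta_times i j (alt_sign r (E (s_free (- j) (- i) r)))
     = E (s_free i j r) - E (free_scalar (1/2) * (if r = 0 then 0 else s_free i j (r - 1) - alt_sign (r - 1) (s_free i j (r - 1))))"
    unfolding symmetry_nth by (simp add: E_diff E_theta E_alt_sign)
  have E: "op a b (int q) = E (s_free a b q)" for a b q
    by (simp add: op_def s_int_def)
  have E': "op a b (int r - 1) = (if r = 0 then 0 else E (s_free a b (r - 1)))" for a b
  proof (cases "r = 0")
    case False
    then have "int r - 1 = int (r - 1)" by simp
    with False show ?thesis by (simp only: E) simp
  qed (simp add: op_neg)
  have "theta_times i j (alt_sign r (E (s_free (- j) (- i) r))) + theta_times i j (alt_sign r (E (s_free (- j) (- i) r)))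
    = E (s_free i j r) + E (s_free i j r) - E (if r = 0 then 0 else s_free i j (r - 1) - alt_sign (r - 1) (s_free i j (r - 1)))"
    unfolding * using half by (simp add: algebra_simps)
  then show ?thesis
    by (auto simp: E E' E_diff E_add E_uminus alt_sign_def)
qed

section \<open>Series of operators specialised at u = 1 / (\<alpha> X)\<close>

definition emb :: "'k fls \<Rightarrow> 'v endo fls" where
  "emb f = Abs_fls (\<lambda>n. scalar (fls_nth f n))"

lemma emb_nth [simp]: "fls_nth (emb f) n = scalar (fls_nth f n)"
  unfolding emb_def
  by (rule nth_Abs_fls_lower_bound [of "fls_subdegree f"]) (simp add: scalar_simps)

definition sF :: "'k fls \<Rightarrow> 'v endo fls \<Rightarrow> 'v endo fls" where
  "sF f x = emb f * x"

lemma emb_add: "emb (f + g) = emb f + emb g"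
  by (rule fls_eqI) (simp add: scalar_simps)

lemma scalar_sum: "scalar (sum f I) = (\<Sum>i\<in>I. scalar (f i))"
  by (induction I rule: infinite_finite_induct) (simp_all add: scalar_simps)

lemma emb_mult: "emb (f * g) = emb f * emb g"
proof (rule fls_eqI)
  fix n
  have "fls_nth (emb f * emb g) n
      = (\<Sum>i=fls_subdegree f..n - fls_subdegree g. fls_nth (emb f) i * fls_nth (emb g) (n - i))"
    by (rule fls_times_nth_range) (simp_all add: scalar_simps)
  then show "fls_nth (emb (f * g)) n = fls_nth (emb f * emb g) n"
    by (simp add: fls_times_nth(2) scalar_sum scalar_simps)
qed

lemma emb_monom_mult_nth:
  "fls_nth (emb (fls_const c * fls_X ^ k) * x) n = scalar c * fls_nth x (n - int k)"
proof -
  have c: "fls_nth (fls_const c * fls_X ^ k) i = (if i = int k then c else 0)" for i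
    by (simp add: fls_X_power_conv_shift_1)
  have "fls_nth (emb (fls_const c * fls_X ^ k) * x) n
      = (\<Sum>i=int k..n - fls_subdegree x. fls_nth (emb (fls_const c * fls_X ^ k)) i * fls_nth x (n - i))"
    by (rule fls_times_nth_range) (simp_all add: c scalar_simps)
  also have "\<dots> = (\<Sum>i=int k..n - fls_subdegree x. if i = int k then scalar c * fls_nth x (n - i) else 0)"
    by (rule sum.cong) (auto simp: c scalar_simps mult.assoc)
  finally show ?thesis by simp
qed

sublocale M: vector_space sF
proof
  show "sF 1 x = x" for x
    using emb_monom_mult_nth [of 1 0 x]
    by (intro fls_eqI) (simp add: sF_def scalar_simps)
qed (simp_all add: sF_def emb_add emb_mult algebra_simps)

text \<open>The value at u = 1 / (\<alpha> X) of the sum of the T_r u^(-r).\<close>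

definition ser :: "(int \<Rightarrow> 'v endo) \<Rightarrow> 'k \<Rightarrow> 'v endo fls" where
  "ser T \<alpha> = fps_to_fls (Abs_fps (\<lambda>r. T (int r) * scalar (\<alpha> ^ r)))"

lemma ser_nth: "fls_nth (ser T \<alpha>) n = (if n < 0 then 0 else T n * scalar (\<alpha> ^ nat n))"
  by (simp add: ser_def)

text \<open>A double series in 1/u and 1/v at 1/u = \<alpha> X and 1/v = \<beta> X. Each power of X
  collects finitely many terms, so identities between double coefficients pass to the
  specialisation.\<close>

definition Ev :: "'k \<Rightarrow> 'k \<Rightarrow> (int \<Rightarrow> int \<Rightarrow> 'v endo) \<Rightarrow> 'v endo fls" where
  "Ev \<alpha> \<beta> T = fps_to_fls (Abs_fps (\<lambda>N. \<Sum>i=0..N. T (int i) (int (N - i)) * scalar (\<alpha> ^ i * \<beta> ^ (N - i))))"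

lemma Ev_add: "Ev \<alpha> \<beta> (\<lambda>m n. S m n + T m n) = Ev \<alpha> \<beta> S + Ev \<alpha> \<beta> T"
  and Ev_diff: "Ev \<alpha> \<beta> (\<lambda>m n. S m n - T m n) = Ev \<alpha> \<beta> S - Ev \<alpha> \<beta> T"
  by (auto intro!: fls_eqI simp: Ev_def sum.distrib sum_subtractf distrib_right left_diff_distrib)

lemma Ev_zero: "Ev \<alpha> \<beta> (\<lambda>m n. 0) = 0"
  by (simp add: Ev_def fps_zero_def [symmetric])

text \<open>Linearity of the coefficients over the ground field; it makes multiplication by the
  series linear over K((X)).\<close>

definition central :: "(int \<Rightarrow> 'v endo) \<Rightarrow> bool" where
  "central T \<longleftrightarrow> (\<forall>m c. T m * scalar c = scalar c * T m)"

lemma central_op [simp]: "central (op i j)"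
  by (simp add: central_def op_scalar)

lemma central_mult:
  assumes "\<And>c. Y * scalar c = scalar c * Y"
  shows "X * scalar a * (Y * scalar b) = X * Y * scalar (a * b)"
proof -
  have "X * scalar a * (Y * scalar b) = X * (scalar a * Y) * scalar b"
    by (simp only: mult.assoc)
  also have "\<dots> = X * Y * scalar (a * b)"
    by (simp only: assms [symmetric] mult.assoc scalar_simps(2))
  finally show ?thesis .
qed

lemma ser_mult:
  assumes "central G"
  shows "ser F \<alpha> * ser G \<beta> = Ev \<alpha> \<beta> (\<lambda>m n. F m * G n)"
proof -
  have "F i * scalar a * (G j * scalar b) = F i * G j * scalar (a * b)" for i j a b
    by (rule central_mult) (use assms in \<open>simp add: central_def\<close>)
  then show ?thesis
    unfolding ser_def Ev_def fls_times_fps_to_fls [symmetric]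
    by (intro arg_cong [of _ _ fps_to_fls] fps_ext) (simp add: fps_mult_nth)
qed

text \<open>The operators change places while \<alpha> still belongs to m and \<beta> to n, so that
  both orders of a commutator fit under one \<open>Ev\<close>.\<close>

lemma ser_mult':
  assumes "central F"
  shows "ser G \<beta> * ser F \<alpha> = Ev \<alpha> \<beta> (\<lambda>m n. G n * F m)"
proof -
  have *: "G i * scalar a * (F j * scalar b) = G i * F j * scalar (b * a)" for i j a b
    by (subst mult.commute [of b]) (rule central_mult, use assms in \<open>simp add: central_def\<close>)
  have "(\<Sum>i=0..N. G (int i) * scalar (\<beta> ^ i) * (F (int (N - i)) * scalar (\<alpha> ^ (N - i))))
      = (\<Sum>i=0..N. G (int (N - i)) * F (int i) * scalar (\<alpha> ^ i * \<beta> ^ (N - i)))" for N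
    unfolding * by (rule sum.reindex_bij_witness [of _ "\<lambda>i. N - i" "\<lambda>i. N - i"]) auto
  then show ?thesis
    unfolding ser_def Ev_def fls_times_fps_to_fls [symmetric]
    by (intro arg_cong [of _ _ fps_to_fls] fps_ext) (simp add: fps_mult_nth)
qed

definition uX :: "'k \<Rightarrow> 'k fls" where "uX \<alpha> = fls_const \<alpha> * fls_X"

lemma sF_uX_nth: "fls_nth (sF (uX \<alpha>) x) n = scalar \<alpha> * fls_nth x (n - 1)"
  using emb_monom_mult_nth [of \<alpha> 1 x n] by (simp add: sF_def uX_def)

lemma scalar_mult_left: assumes "\<And>c. T * scalar c = scalar c * T" shows "scalar a * (T * scalar b) = T * scalar (a * b)"
  by (simp only: assms [symmetric] mult.assoc [symmetric] scalar_simps(2))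

lemma ser_shift:
  assumes "T (- 1) = 0" "central T"
  shows "ser (\<lambda>r. T (r - 1)) \<alpha> = sF (uX \<alpha>) (ser T \<alpha>)"
proof (rule fls_eqI)
  fix n :: int
  consider "n < 0" | "n = 0" | "n > 0" by linarith
  then show "fls_nth (ser (\<lambda>r. T (r - 1)) \<alpha>) n = fls_nth (sF (uX \<alpha>) (ser T \<alpha>)) n"
  proof cases
    case 3
    then have "\<alpha> ^ nat n = \<alpha> * \<alpha> ^ nat (n - 1)"
    proof -
      from 3 have "nat n = Suc (nat (n - 1))" by simp
      then show ?thesis by (metis power_Suc)
    qed
    with 3 show ?thesis
      using assms(2) scalar_mult_left [of "T (n - 1)" \<alpha> "\<alpha> ^ nat (n - 1)"]
      by (simp add: sF_uX_nth ser_nth central_def del: mult.assoc)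
  qed (use assms(1) in \<open>simp_all add: sF_uX_nth ser_nth\<close>)
qed

lemma Ev_nth: "fls_nth (Ev \<alpha> \<beta> T) (int N) = (\<Sum>i=0..N. T (int i) (int (N - i)) * scalar (\<alpha> ^ i * \<beta> ^ (N - i)))"
  by (simp add: Ev_def)

lemma of_nat_Suc_diff: "int (Suc k) - 1 = int k"
  by simp

lemma Ev_shift1:
  assumes "\<And>n. T (- 1) n = 0" "\<And>m n c. T m n * scalar c = scalar c * T m n"
  shows "Ev \<alpha> \<beta> (\<lambda>m n. T (m - 1) n) = sF (uX \<alpha>) (Ev \<alpha> \<beta> T)"
proof (rule fls_eqI)
  fix n :: int
  consider "n < 0" | "n = 0" | k where "n = int (Suc k)"
  proof -
    have "n < 0 \<or> n = 0 \<or> n = int (Suc (nat (n - 1)))" by auto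
    with that show ?thesis by blast
  qed
  then show "fls_nth (Ev \<alpha> \<beta> (\<lambda>m n. T (m - 1) n)) n = fls_nth (sF (uX \<alpha>) (Ev \<alpha> \<beta> T)) n"
  proof cases
    case (3 k)
    have "(\<Sum>i=0..Suc k. T (int i - 1) (int (Suc k - i)) * scalar (\<alpha> ^ i * \<beta> ^ (Suc k - i)))
        = (\<Sum>i=0..k. T (int i) (int (k - i)) * scalar (\<alpha> * (\<alpha> ^ i * \<beta> ^ (k - i))))"
      by (subst sum.atLeast0_atMost_Suc_shift) (simp add: assms(1) mult.assoc)
    also have "\<dots> = scalar \<alpha> * (\<Sum>i=0..k. T (int i) (int (k - i)) * scalar (\<alpha> ^ i * \<beta> ^ (k - i)))"
      by (simp only: sum_distrib_left scalar_mult_left [OF assms(2)])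
    finally show ?thesis
      unfolding sF_uX_nth 3 by (simp only: Ev_nth of_nat_Suc_diff)
  qed (use assms(1) in \<open>simp_all add: sF_uX_nth Ev_def\<close>)
qed

lemma Ev_shift2:
  assumes "\<And>m. T m (- 1) = 0" "\<And>m n c. T m n * scalar c = scalar c * T m n"
  shows "Ev \<alpha> \<beta> (\<lambda>m n. T m (n - 1)) = sF (uX \<beta>) (Ev \<alpha> \<beta> T)"
proof (rule fls_eqI)
  fix n :: int
  consider "n < 0" | "n = 0" | k where "n = int (Suc k)"
  proof -
    have "n < 0 \<or> n = 0 \<or> n = int (Suc (nat (n - 1)))" by auto
    with that show ?thesis by blast
  qed
  then show "fls_nth (Ev \<alpha> \<beta> (\<lambda>m n. T m (n - 1))) n = fls_nth (sF (uX \<beta>) (Ev \<alpha> \<beta> T)) n"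
  proof cases
    case (3 k)
    have "(\<Sum>i=0..Suc k. T (int i) (int (Suc k - i) - 1) * scalar (\<alpha> ^ i * \<beta> ^ (Suc k - i)))
        = (\<Sum>i=0..k. T (int i) (int (k - i)) * scalar (\<beta> * (\<alpha> ^ i * \<beta> ^ (k - i))))"
      by (subst sum.atLeast0_atMost_Suc) (auto simp: assms(1) Suc_diff_le mult_ac intro!: sum.cong)
    also have "\<dots> = scalar \<beta> * (\<Sum>i=0..k. T (int i) (int (k - i)) * scalar (\<alpha> ^ i * \<beta> ^ (k - i)))"
      by (simp only: sum_distrib_left scalar_mult_left [OF assms(2)])
    finally show ?thesis
      unfolding sF_uX_nth 3 by (simp only: Ev_nth of_nat_Suc_diff)
  qed (use assms(1) in \<open>simp_all add: sF_uX_nth Ev_def\<close>)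
qed

text \<open>Turns index shifts in a coefficient relation into factors 1/u and 1/v; vanishing at
  negative indices makes the boundary terms agree.\<close>

lemma Ev_shift:
  assumes "\<And>m n. m < 0 \<or> n < 0 \<Longrightarrow> T m n = 0" "\<And>m n c. T m n * scalar c = scalar c * T m n"
  shows "Ev \<alpha> \<beta> (\<lambda>m n. T (m - int a) (n - int b)) = sF (uX \<alpha> ^ a * uX \<beta> ^ b) (Ev \<alpha> \<beta> T)"
proof (induction a)
  case 0
  show ?case
  proof (induction b)
    case (Suc b)
    have "Ev \<alpha> \<beta> (\<lambda>m n. T m (n - 1 - int b)) = sF (uX \<beta>) (Ev \<alpha> \<beta> (\<lambda>m n. T m (n - int b)))"
      by (rule Ev_shift2 [of "\<lambda>m n. T m (n - int b)"]) (use assms in auto)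
    with Suc show ?case by (simp add: algebra_simps)
  qed simp
next
  case (Suc a)
  have "Ev \<alpha> \<beta> (\<lambda>m n. T (m - 1 - int a) (n - int b)) = sF (uX \<alpha>) (Ev \<alpha> \<beta> (\<lambda>m n. T (m - int a) (n - int b)))"
    by (rule Ev_shift1 [of "\<lambda>m n. T (m - int a) (n - int b)"]) (use assms in auto)
  with Suc show ?case by (simp add: algebra_simps)
qed

end

context twisted_rep
begin

lemma ser_add: "ser (\<lambda>r. S r + T r) \<alpha> = ser S \<alpha> + ser T \<alpha>"
  and ser_diff: "ser (\<lambda>r. S r - T r) \<alpha> = ser S \<alpha> - ser T \<alpha>"
  by (auto intro!: fls_eqI simp: ser_nth distrib_right left_diff_distrib)

lemma const_ser: "fls_const b * ser T \<alpha> = ser (\<lambda>r. b * T r) \<alpha>"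
  by (rule fls_eqI) (simp add: ser_nth mult.assoc)

lemma ser_const: "(\<And>c. b * scalar c = scalar c * b) \<Longrightarrow> ser T \<alpha> * fls_const b = ser (\<lambda>r. T r * b) \<alpha>"
  by (rule fls_eqI) (simp add: ser_nth mult.assoc)

lemma central_emb: "central T \<Longrightarrow> ser T \<alpha> * emb f = emb f * ser T \<alpha>"
proof (rule fls_commute_coeffs)
  fix i j assume c: "central T"
  have "T i * scalar a * scalar b = scalar b * (T i * scalar a)" for a b
  proof -
    have "T i * scalar a * scalar b = T i * scalar (b * a)"
      by (simp only: mult.assoc scalar_simps(2) [symmetric] mult.commute)
    then show ?thesis
      using scalar_mult_left [of "T i" b a] c by (simp add: central_def)
  qed
  then show "fls_nth (ser T \<alpha>) i * fls_nth (emb f) j = fls_nth (emb f) j * fls_nth (ser T \<alpha>) i"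
    by (simp add: ser_nth)
qed

lemma const_emb: "(\<And>c. b * scalar c = scalar c * b) \<Longrightarrow> fls_const b * emb f = emb f * fls_const b"
  by (rule fls_commute_coeffs) simp

lemma ser_sF: "central T \<Longrightarrow> ser T \<alpha> * sF f w = sF f (ser T \<alpha> * w)"
  unfolding sF_def by (simp add: mult.assoc [symmetric] central_emb)

lemma const_sF: "(\<And>c. b * scalar c = scalar c * b) \<Longrightarrow> fls_const b * sF f w = sF f (fls_const b * w)"
  unfolding sF_def by (simp add: mult.assoc [symmetric] const_emb)

lemma sF_mult_right: "sF f (x * y) = sF f x * y"
  by (simp add: sF_def mult.assoc)

lemma linear_const: "(\<And>c. b * scalar c = scalar c * b) \<Longrightarrow> Vector_Spaces.linear sF sF (\<lambda>w. fls_const b * w)"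
  by unfold_locales (simp_all add: distrib_left const_sF)

lemma sF_two: "sF 2 x = x + x"
  using M.scale_left_distrib [of 1 1 x] by simp

lemma alt_sign_mult_scalar: "T * scalar ((- \<alpha>) ^ r) = alt_sign r (T * scalar (\<alpha> ^ r))"
  by (auto simp: alt_sign_def scalar_simps)

lemma ser_nth_nat: "fls_nth (ser T \<alpha>) (int r) = T (int r) * scalar (\<alpha> ^ r)"
  by (simp add: ser_nth)

lemma ser_eqI: "(\<And>r. fls_nth x (int r) = fls_nth y (int r)) \<Longrightarrow> (\<And>n. n < 0 \<Longrightarrow> fls_nth x n = fls_nth y n) \<Longrightarrow> x = y"
  by (rule fls_eqI) (metis int_nat_eq linorder_not_less nat_0_le)

lemma uX_uminus: "uX (- \<alpha>) = - uX \<alpha>"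
  by (rule fls_eqI) (simp add: uX_def fls_X_times_conv_shift)

lemma shift_ser_uminus:
  assumes "T (- 1) = 0" "central T"
  shows "sF (uX \<alpha>) (ser T (- \<alpha>)) = - ser (\<lambda>r. T (r - 1)) (- \<alpha>)"
  using ser_shift [OF assms, of "- \<alpha>"] by (simp add: uX_uminus)

text \<open>The diagonal entry of the symmetry relation, solved for a(u) in order to eliminate it;
  \<open>uX \<alpha>\<close> is 1/u and \<open>- \<alpha>\<close> stands for - u.\<close>

lemma A_ser: "sF 2 (ser A \<alpha>) = sF (2 + uX \<alpha>) (ser D (- \<alpha>)) - sF (uX \<alpha>) (ser D \<alpha>)"
proof -
  have D: "D (- 1) = 0" "central D" by (simp_all add: op_neg)
  have key: "A (int r) + A (int r) = alt_sign r (D (int r)) + alt_sign r (D (int r)) - alt_sign r (D (int r - 1)) - D (int r - 1)" for r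
    using symmetry_op [of PlusOne PlusOne r]
    by (cases "r = 0") (auto simp: theta_times_def alt_sign_def op_neg algebra_simps eq_neg_iff_add_eq_0 neg_eq_iff_add_eq_0 split: if_splits)
  show ?thesis
    unfolding M.scale_left_distrib sF_two shift_ser_uminus [OF D] ser_shift [OF D, symmetric]
  proof (rule ser_eqI)
    fix r
    have "(A (int r) + A (int r)) * scalar (\<alpha> ^ r) = (alt_sign r (D (int r)) + alt_sign r (D (int r)) - alt_sign r (D (int r - 1)) - D (int r - 1)) * scalar (\<alpha> ^ r)"
      by (simp only: key)
    then show "fls_nth (ser A \<alpha> + ser A \<alpha>) (int r) = fls_nth (ser D (- \<alpha>) + ser D (- \<alpha>) + - ser (\<lambda>r. D (r - 1)) (- \<alpha>) - ser (\<lambda>r. D (r - 1)) \<alpha>) (int r)"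
      by (simp only: fls_plus_nth fls_minus_nth fls_uminus_nth ser_nth_nat alt_sign_mult_scalar)
        (auto simp: alt_sign_def algebra_simps)
  qed (simp add: ser_nth)
qed

text \<open>The off-diagonal entry of the symmetry relation. Multiplied by u, it says that (2u - 1)
  c(u) is even, which is the reason for the factor in gamma.\<close>

lemma C_ser: "sF (2 - uX \<alpha>) (ser C \<alpha>) = - sF (2 + uX \<alpha>) (ser C (- \<alpha>))"
proof -
  have C: "C (- 1) = 0" "central C" by (simp_all add: op_neg)
  have key: "C (int r) + C (int r) - C (int r - 1) = - alt_sign r (C (int r)) - alt_sign r (C (int r)) + alt_sign r (C (int r - 1))" for r
    using symmetry_op [of PlusOne MinusOne r]
    by (cases "r = 0") (auto simp: theta_times_def alt_sign_def op_neg algebra_simps split: if_splits)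
  show ?thesis
    unfolding M.scale_left_distrib M.scale_left_diff_distrib sF_two shift_ser_uminus [OF C] ser_shift [OF C, symmetric]
  proof (rule ser_eqI)
    fix r
    have "(C (int r) + C (int r) - C (int r - 1)) * scalar (\<alpha> ^ r) = (- alt_sign r (C (int r)) - alt_sign r (C (int r)) + alt_sign r (C (int r - 1))) * scalar (\<alpha> ^ r)"
      by (simp only: key)
    then show "fls_nth (ser C \<alpha> + ser C \<alpha> - ser (\<lambda>r. C (r - 1)) \<alpha>) (int r) = fls_nth (- (ser C (- \<alpha>) + ser C (- \<alpha>) + - ser (\<lambda>r. C (r - 1)) (- \<alpha>))) (int r)"
      by (simp only: fls_plus_nth fls_minus_nth fls_uminus_nth ser_nth_nat alt_sign_mult_scalar)
        (auto simp: alt_sign_def algebra_simps)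
  qed (simp add: ser_nth)
qed

lemma B_C_ser: "fls_const (B 1) * ser C \<alpha> = ser C \<alpha> * fls_const (B 1) + sF 2 (ser A \<alpha>) - sF 2 (ser D \<alpha>)"
proof -
  have "fls_const (B 1) * ser C \<alpha> = ser (\<lambda>r. C r * B 1 + (A r + A r) - (D r + D r)) \<alpha>"
    unfolding const_ser using BC by (intro arg_cong2 [of _ _ _ _ ser] ext refl) (simp add: algebra_simps)
  then show ?thesis
    by (simp only: ser_add ser_diff sF_two ser_const [OF op_scalar])
qed

text \<open>The relation \<open>CC\<close> at m - 2 expresses the commutator with first index m by
  commutators with first index m - 2, and negative indices give 0.\<close>

lemma CC_commute: "C m * C n = C n * C m"
proof -
  have "C (m + 0) * C n - C n * C m = 0"
  proof (induction "nat m" arbitrary: m n rule: less_induct)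
    case less
    have IH: "C m' * C n' = C n' * C m'" if "m' < m" for m' n'
    proof (cases "m' < 0")
      case False
      with less [of m' n'] that show ?thesis by simp
    qed (simp add: op_neg)
    show ?case
      using CC [of "m - 2" n] IH [of "m - 2" "n + 2"] IH [of "m - 2" "n + 1"] IH [of "m - 2" n] by simp
  qed
  then show ?thesis by simp
qed

lemma ser_C_commute: "ser C \<alpha> * ser C \<beta> = ser C \<beta> * ser C \<alpha>"
  by (subst ser_mult, simp, subst ser_mult' [where G = C and F = C], simp) (simp only: CC_commute)

lemma Ev_product:
  assumes "central S" "central T" "\<And>m. m < 0 \<Longrightarrow> S m = 0" "\<And>m. m < 0 \<Longrightarrow> T m = 0"
  shows "Ev \<alpha> \<beta> (\<lambda>m n. S (m - int a) * T (n - int b)) = sF (uX \<alpha> ^ a * uX \<beta> ^ b) (ser S \<alpha> * ser T \<beta>)"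
    and "Ev \<alpha> \<beta> (\<lambda>m n. T (n - int b) * S (m - int a)) = sF (uX \<alpha> ^ a * uX \<beta> ^ b) (ser T \<beta> * ser S \<alpha>)"
proof -
  have c: "S m * T n * scalar c = scalar c * (S m * T n)" "T n * S m * scalar c = scalar c * (T n * S m)" for m n c
    using assms(1,2) by (metis central_def mult.assoc)+
  show "Ev \<alpha> \<beta> (\<lambda>m n. S (m - int a) * T (n - int b)) = sF (uX \<alpha> ^ a * uX \<beta> ^ b) (ser S \<alpha> * ser T \<beta>)"
    by (subst ser_mult [OF assms(2)], rule Ev_shift [of "\<lambda>m n. S m * T n"]) (use assms(3,4) c in auto)
  show "Ev \<alpha> \<beta> (\<lambda>m n. T (n - int b) * S (m - int a)) = sF (uX \<alpha> ^ a * uX \<beta> ^ b) (ser T \<beta> * ser S \<alpha>)"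
    by (subst ser_mult' [OF assms(1)], rule Ev_shift [of "\<lambda>m n. T n * S m"]) (use assms(3,4) c in auto)
qed

text \<open>Here a = 1/u and b = 1/v. The factor 2 allows 2 a(u) to be replaced by the symmetry
  relation, and b^2 - a^2 is (u^2 - v^2) / (u^2 v^2).\<close>

lemma CD_ser:
  fixes \<alpha> \<beta> :: 'k
  defines "a \<equiv> uX \<alpha>" and "b \<equiv> uX \<beta>"
  shows "sF (2 * (b\<^sup>2 - a\<^sup>2)) (ser D \<beta> * ser C \<alpha>)
    = sF (2 * (b\<^sup>2 - a\<^sup>2 - 2 * a\<^sup>2 * b - a\<^sup>2 * b\<^sup>2)) (ser C \<alpha> * ser D \<beta>)
      + sF (2 * (a * b\<^sup>2 + a\<^sup>2 * b + a\<^sup>2 * b\<^sup>2) - a * (a * b\<^sup>2 - a\<^sup>2 * b)) (ser C \<beta> * ser D \<alpha>)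
      + sF ((2 + a) * (a * b\<^sup>2 - a\<^sup>2 * b)) (ser C \<beta> * ser D (- \<alpha>))"
proof -
  let ?cd = "ser C \<alpha> * ser D \<beta>" and ?dc = "ser D \<beta> * ser C \<alpha>" and ?cd' = "ser C \<beta> * ser D \<alpha>" and ?ca = "ser C \<beta> * ser A \<alpha>"
  have e1: "Ev \<alpha> \<beta> (\<lambda>m n. C (m - int i) * D (n - int j)) = sF (a ^ i * b ^ j) ?cd"
    and e2: "Ev \<alpha> \<beta> (\<lambda>m n. D (n - int j) * C (m - int i)) = sF (a ^ i * b ^ j) ?dc"
    and e3: "Ev \<alpha> \<beta> (\<lambda>m n. C (n - int j) * D (m - int i)) = sF (a ^ i * b ^ j) ?cd'"
    and e4: "Ev \<alpha> \<beta> (\<lambda>m n. C (n - int j) * A (m - int i)) = sF (a ^ i * b ^ j) ?ca" for i j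
    unfolding a_def b_def by (rule Ev_product; simp add: op_neg)+
  \<comment> \<open>Zero shifts are written out, so that every term has the shape of
    \<open>Ev_product\<close>.\<close>
  have rel: "C (m - int 0) * D (n - int 2) - D (n - int 2) * C (m - int 0) - (C (m - int 2) * D (n - int 0) - D (n - int 0) * C (m - int 2))
   - (C (m - int 1) * D (n - int 2) + C (m - int 2) * D (n - int 1) - (C (n - int 2) * D (m - int 1) + C (n - int 1) * D (m - int 2)))
    + (C (m - int 1) * D (n - int 2) - C (m - int 2) * D (n - int 1)) + (C (n - int 2) * A (m - int 1) - C (n - int 1) * A (m - int 2))
    - (C (m - int 2) * D (n - int 2) - C (n - int 2) * D (m - int 2)) = 0" for m n
    using CD [of "m - 2" "n - 2"] by (simp add: algebra_simps)
  have "sF (a ^ 0 * b ^ 2) ?cd - sF (a ^ 0 * b ^ 2) ?dc - (sF (a ^ 2 * b ^ 0) ?cd - sF (a ^ 2 * b ^ 0) ?dc)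
    - (sF (a ^ 1 * b ^ 2) ?cd + sF (a ^ 2 * b ^ 1) ?cd - (sF (a ^ 1 * b ^ 2) ?cd' + sF (a ^ 2 * b ^ 1) ?cd'))
    + (sF (a ^ 1 * b ^ 2) ?cd - sF (a ^ 2 * b ^ 1) ?cd) + (sF (a ^ 1 * b ^ 2) ?ca - sF (a ^ 2 * b ^ 1) ?ca)
    - (sF (a ^ 2 * b ^ 2) ?cd - sF (a ^ 2 * b ^ 2) ?cd') = 0"
    unfolding e1 [symmetric] e2 [symmetric] e3 [symmetric] e4 [symmetric] Ev_add [symmetric] Ev_diff [symmetric]
    unfolding rel by (rule Ev_zero)
  then have main: "sF (b\<^sup>2 - a\<^sup>2) ?dc = sF (b\<^sup>2 - a\<^sup>2 - 2 * a\<^sup>2 * b - a\<^sup>2 * b\<^sup>2) ?cd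
      + sF (a * b\<^sup>2 + a\<^sup>2 * b + a\<^sup>2 * b\<^sup>2) ?cd' + sF (a * b\<^sup>2 - a\<^sup>2 * b) ?ca"
  proof -
    have *: "y0 - y2 = x0 - x2 - (x21 + x21) - x22 + (z12 + z21 + z22) + (w12 - w21)"
      if "x0 - y0 - (x2 - y2) - (x12 + x21 - (z12 + z21)) + (x12 - x21) + (w12 - w21) - (x22 - z22) = 0"
      for x0 x2 x12 x21 x22 y0 y2 z12 z21 z22 w12 w21 :: "'v endo fls"
      using that by (simp add: algebra_simps)
    assume "sF (a ^ 0 * b ^ 2) ?cd - sF (a ^ 0 * b ^ 2) ?dc - (sF (a ^ 2 * b ^ 0) ?cd - sF (a ^ 2 * b ^ 0) ?dc)
      - (sF (a ^ 1 * b ^ 2) ?cd + sF (a ^ 2 * b ^ 1) ?cd - (sF (a ^ 1 * b ^ 2) ?cd' + sF (a ^ 2 * b ^ 1) ?cd'))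
      + (sF (a ^ 1 * b ^ 2) ?cd - sF (a ^ 2 * b ^ 1) ?cd) + (sF (a ^ 1 * b ^ 2) ?ca - sF (a ^ 2 * b ^ 1) ?ca)
      - (sF (a ^ 2 * b ^ 2) ?cd - sF (a ^ 2 * b ^ 2) ?cd') = 0"
    note ** = * [OF this, folded M.scale_left_distrib M.scale_left_diff_distrib]
    have "2 * a\<^sup>2 * b = a ^ 2 * b ^ 1 + a ^ 2 * b ^ 1"
      by simp
    with ** show ?thesis by simp
  qed
  have ca: "sF 2 ?ca = sF (2 + a) (ser C \<beta> * ser D (- \<alpha>)) - sF a ?cd'"
  proof -
    have "sF 2 ?ca = ser C \<beta> * sF 2 (ser A \<alpha>)" by (simp add: ser_sF)
    then show ?thesis
      unfolding A_ser a_def by (simp add: right_diff_distrib ser_sF)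
  qed
  have ca': "sF (2 * x) ?ca = sF (x * (2 + a)) (ser C \<beta> * ser D (- \<alpha>)) - sF (x * a) ?cd'" for x
  proof -
    have "sF (2 * x) ?ca = sF x (sF 2 ?ca)" by (simp add: mult.commute)
    then show ?thesis unfolding ca by (simp add: M.scale_right_diff_distrib)
  qed
  have "sF (2 * (b\<^sup>2 - a\<^sup>2)) ?dc = sF 2 (sF (b\<^sup>2 - a\<^sup>2) ?dc)" by simp
  also have "\<dots> = sF (2 * (b\<^sup>2 - a\<^sup>2 - 2 * a\<^sup>2 * b - a\<^sup>2 * b\<^sup>2)) ?cd
      + sF (2 * (a * b\<^sup>2 + a\<^sup>2 * b + a\<^sup>2 * b\<^sup>2)) ?cd' + sF (2 * (a * b\<^sup>2 - a\<^sup>2 * b)) ?ca"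
    unfolding main by (simp only: M.scale_right_distrib M.scale_scale)
  finally show ?thesis
    unfolding ca' by (simp only: M.scale_left_diff_distrib [of "2 * (a * b\<^sup>2 + a\<^sup>2 * b + a\<^sup>2 * b\<^sup>2)"] mult.commute [of _ "a * b\<^sup>2 - a\<^sup>2 * b"])
      (simp only: add_diff_eq diff_add_eq add.assoc add.commute add.left_commute)
qed

end

section \<open>The exchange relations at the spectral parameters\<close>

context twisted_rep
begin

definition spectral :: "'k \<Rightarrow> 'k fls" where "spectral \<alpha> = inverse (uX \<alpha>)"

text \<open>Recovers \<open>\<alpha>\<close> from the spectral parameter \<open>u = 1 / (\<alpha> X)\<close>.\<close>

definition al :: "'k fls \<Rightarrow> 'k" where "al u = fls_nth (inverse u) 1"

lemma uX_nth: "fls_nth (uX \<alpha>) n = (if n = 1 then \<alpha> else 0)"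
  by (simp add: uX_def)

lemma uX_eq_0_iff: "uX \<alpha> = 0 \<longleftrightarrow> \<alpha> = 0"
  by (auto simp: uX_def)

lemma al_spectral [simp]: "al (spectral \<alpha>) = \<alpha>"
  by (simp add: al_def spectral_def uX_nth)

lemma spectral_uminus: "- spectral \<alpha> = spectral (- \<alpha>)"
  by (simp add: spectral_def uX_uminus)

lemma two_F: "(2 :: 'k fls) \<noteq> 0"
proof
  assume "(2 :: 'k fls) = 0"
  then have "fls_nth (of_nat 2 :: 'k fls) 0 = 0" by simp
  then show False using two unfolding fls_of_nat_nth by simp
qed

lemma spectral_nonzero: "\<alpha> \<noteq> 0 \<Longrightarrow> spectral \<alpha> \<noteq> 0"
  by (simp add: spectral_def uX_eq_0_iff)

lemma spectral_half: "\<alpha> \<noteq> 0 \<Longrightarrow> 2 * spectral \<alpha> - 1 \<noteq> 0"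
proof
  assume a: "\<alpha> \<noteq> 0" and "2 * spectral \<alpha> - 1 = 0"
  then have "uX \<alpha> = 2"
    by (simp add: spectral_def uX_eq_0_iff field_simps)
  then have "fls_nth (uX \<alpha>) 1 = fls_nth (of_nat 2) 1" by simp
  with a show False unfolding fls_of_nat_nth by (simp add: uX_nth)
qed

lemma bethe_G_spectral: "\<alpha> \<noteq> 0 \<Longrightarrow> bethe_G (spectral \<alpha>) = - (2 * spectral \<alpha> - 1) * (2 + uX \<alpha>)"
  using uX_eq_0_iff [of \<alpha>] by (simp add: bethe_G_def spectral_def field_simps power2_eq_square)

definition gam :: "'k fls \<Rightarrow> 'v endo fls \<Rightarrow> 'v endo fls" where
  "gam u w = sF (2 * u - 1) (ser C (al u) * w)"

definition del :: "'k fls \<Rightarrow> 'v endo fls \<Rightarrow> 'v endo fls" where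
  "del u w = ser D (al u) * w"

text \<open>The value \<alpha> = 0 would correspond to u = infinity.\<close>

definition UU :: "'k fls set" where "UU = spectral ` (UNIV - {0})"

definition muS :: "'k fps \<Rightarrow> 'k fls \<Rightarrow> 'k fls" where
  "muS \<mu> u = fps_to_fls (Abs_fps (\<lambda>r. fps_nth \<mu> r * al u ^ r))"

lemma gam_spectral_uminus:
  assumes "\<alpha> \<noteq> 0"
  shows "gam (- spectral \<alpha>) = gam (spectral \<alpha>)"
proof
  fix w
  have X: "uX \<alpha> \<noteq> 0" using assms by (simp add: uX_eq_0_iff)
  have "sF (spectral \<alpha>) (sF (2 - uX \<alpha>) (ser C \<alpha>)) = sF (spectral \<alpha>) (- sF (2 + uX \<alpha>) (ser C (- \<alpha>)))"
    by (simp only: C_ser)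
  then have "sF (spectral \<alpha> * (2 - uX \<alpha>)) (ser C \<alpha>) = sF (- (spectral \<alpha> * (2 + uX \<alpha>))) (ser C (- \<alpha>))"
    by (simp add: M.scale_minus_left)
  moreover have "spectral \<alpha> * (2 - uX \<alpha>) = 2 * spectral \<alpha> - 1" "- (spectral \<alpha> * (2 + uX \<alpha>)) = 2 * (- spectral \<alpha>) - 1"
    using X by (simp_all add: spectral_def field_simps)
  ultimately have "sF (2 * spectral \<alpha> - 1) (ser C \<alpha>) = sF (2 * (- spectral \<alpha>) - 1) (ser C (- \<alpha>))"
    by simp
  then have "sF (2 * spectral \<alpha> - 1) (ser C \<alpha>) * w = sF (2 * (- spectral \<alpha>) - 1) (ser C (- \<alpha>)) * w"
    by simp
  then show "gam (- spectral \<alpha>) w = gam (spectral \<alpha>) w"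
    unfolding gam_def by (simp only: sF_mult_right [symmetric] al_spectral spectral_uminus)
qed

text \<open>The commutator of b_1 with c(u) is 2 a(u) - 2 d(u) = (2 + 1/u)(d(- u) - d(u)). The
  factor 2u - 1 turns the coefficients into G(- u) and G(u).\<close>

lemma e_gam:
  assumes "\<alpha> \<noteq> 0"
  shows "fls_const (B 1) * gam (spectral \<alpha>) w = gam (spectral \<alpha>) (fls_const (B 1) * w)
    + sF (bethe_G (spectral \<alpha>)) (del (spectral \<alpha>) w) + sF (bethe_G (- spectral \<alpha>)) (del (- spectral \<alpha>) w)"
proof -
  have "fls_const (B 1) * ser C \<alpha> = ser C \<alpha> * fls_const (B 1) + sF (2 + uX \<alpha>) (ser D (- \<alpha>)) - sF (2 + uX \<alpha>) (ser D \<alpha>)"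
    unfolding B_C_ser A_ser by (simp add: M.scale_left_distrib algebra_simps)
  then have *: "fls_const (B 1) * (ser C \<alpha> * w) = ser C \<alpha> * (fls_const (B 1) * w)
      + sF (2 + uX \<alpha>) (ser D (- \<alpha>) * w) - sF (2 + uX \<alpha>) (ser D \<alpha> * w)"
    by (simp add: mult.assoc [symmetric] distrib_right left_diff_distrib sF_mult_right)
  have "fls_const (B 1) * gam (spectral \<alpha>) w = sF (2 * spectral \<alpha> - 1) (fls_const (B 1) * (ser C \<alpha> * w))"
    unfolding gam_def by (simp add: const_sF op_scalar)
  also have "\<dots> = gam (spectral \<alpha>) (fls_const (B 1) * w) + sF ((2 * spectral \<alpha> - 1) * (2 + uX \<alpha>)) (ser D (- \<alpha>) * w)
      - sF ((2 * spectral \<alpha> - 1) * (2 + uX \<alpha>)) (ser D \<alpha> * w)"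
    unfolding * gam_def by (simp add: M.scale_right_distrib M.scale_right_diff_distrib)
  also have "(2 * spectral \<alpha> - 1) * (2 + uX \<alpha>) = - bethe_G (spectral \<alpha>)"
    by (simp only: bethe_G_spectral [OF assms] mult_minus_left minus_minus)
  finally have 1: "fls_const (B 1) * gam (spectral \<alpha>) w = gam (spectral \<alpha>) (fls_const (B 1) * w)
    + sF (- bethe_G (spectral \<alpha>)) (ser D (- \<alpha>) * w) - sF (- bethe_G (spectral \<alpha>)) (ser D \<alpha> * w)" .
  have "bethe_G (- spectral \<alpha>) = - bethe_G (spectral \<alpha>)" by (simp add: bethe_G_def)
  with 1 show ?thesis
    by (simp add: del_def spectral_uminus M.scale_minus_left)
qed

text \<open>Rewritten in u and v, the coefficients of \<open>CD_ser\<close> are those of the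
  abstract relation; the factors 2u - 1 and 2v - 1 turn c(u) and c(v) into gamma(u) and
  gamma(v).\<close>

lemma d_gam_coefficients:
  fixes u v :: "'f::field"
  assumes "u \<noteq> 0" "v \<noteq> 0" "v\<^sup>2 \<noteq> u\<^sup>2" "(2::'f) \<noteq> 0" "2 * v - 1 \<noteq> 0"
  defines "a \<equiv> inverse u" and "b \<equiv> inverse v"
  shows "(2 * u - 1) * (2 * (b\<^sup>2 - a\<^sup>2 - 2 * a\<^sup>2 * b - a\<^sup>2 * b\<^sup>2)) = 2 * (b\<^sup>2 - a\<^sup>2) * (bethe_g v u * (2 * u - 1))"
    and "(2 * u - 1) * (2 * (a * b\<^sup>2 + a\<^sup>2 * b + a\<^sup>2 * b\<^sup>2) - a * (a * b\<^sup>2 - a\<^sup>2 * b)) = 2 * (b\<^sup>2 - a\<^sup>2) * (bethe_k v u * (2 * v - 1))"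
    and "(2 * u - 1) * ((2 + a) * (a * b\<^sup>2 - a\<^sup>2 * b)) = 2 * (b\<^sup>2 - a\<^sup>2) * (bethe_k v (- u) * (2 * v - 1))"
    and "2 * (b\<^sup>2 - a\<^sup>2) \<noteq> 0"
proof -
  have uv: "u - v \<noteq> 0" "u + v \<noteq> 0"
    using assms(3) by (auto simp: add_eq_0_iff)
  have D: "b\<^sup>2 - a\<^sup>2 = (u\<^sup>2 - v\<^sup>2) * (a\<^sup>2 * b\<^sup>2)"
    using assms by (simp add: a_def b_def field_simps)
  have a1: "a * b\<^sup>2 - a\<^sup>2 * b = (u - v) * (a\<^sup>2 * b\<^sup>2)"
    and a2: "a * b\<^sup>2 + a\<^sup>2 * b + a\<^sup>2 * b\<^sup>2 = (u + v + 1) * (a\<^sup>2 * b\<^sup>2)"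
    and a3: "b\<^sup>2 - a\<^sup>2 - 2 * a\<^sup>2 * b - a\<^sup>2 * b\<^sup>2 = (u\<^sup>2 - (v + 1)\<^sup>2) * (a\<^sup>2 * b\<^sup>2)"
    using assms by (simp_all add: a_def b_def field_simps power2_eq_square)
  have g: "(u\<^sup>2 - v\<^sup>2) * bethe_g v u = u\<^sup>2 - (v + 1)\<^sup>2"
  proof -
    have "bethe_g v u = (u\<^sup>2 - (v + 1)\<^sup>2) / (u\<^sup>2 - v\<^sup>2)"
      unfolding bethe_g_def by (metis minus_diff_eq minus_divide_divide)
    then show ?thesis using assms(3) by simp
  qed
  have sq: "u\<^sup>2 - v\<^sup>2 = (u - v) * (u + v)" "4 * u\<^sup>2 - 1 = (2 * u - 1) * (2 * u + 1)"
    by (simp_all add: algebra_simps power2_eq_square)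
  have k: "2 * (u\<^sup>2 - v\<^sup>2) * (bethe_k v u * (2 * v - 1)) = (2 * u - 1) * ((2 * u + 1) * (u + v) * a)"
    unfolding bethe_k_def sq a_def using assms uv by (simp add: divide_simps)
  have k': "2 * (u\<^sup>2 - v\<^sup>2) * (bethe_k v (- u) * (2 * v - 1)) = (2 * u - 1) * ((2 * u + 1) * (u - v) * a)"
  proof -
    have e: "2 * (- u) * (- u - v) = 2 * u * (u + v)" by (simp add: algebra_simps)
    show ?thesis
      unfolding bethe_k_def power2_minus e sq a_def using assms uv by (simp add: divide_simps)
  qed
  show "(2 * u - 1) * (2 * (b\<^sup>2 - a\<^sup>2 - 2 * a\<^sup>2 * b - a\<^sup>2 * b\<^sup>2)) = 2 * (b\<^sup>2 - a\<^sup>2) * (bethe_g v u * (2 * u - 1))"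
    unfolding a3 unfolding D g [symmetric] by (simp only: mult_ac)
  have ua: "u * a = 1" using assms by (simp add: a_def)
  show "(2 * u - 1) * (2 * (a * b\<^sup>2 + a\<^sup>2 * b + a\<^sup>2 * b\<^sup>2) - a * (a * b\<^sup>2 - a\<^sup>2 * b)) = 2 * (b\<^sup>2 - a\<^sup>2) * (bethe_k v u * (2 * v - 1))"
  proof -
    have "2 * (u + v + 1) - a * (u - v) = (2 * u + 1) * (u + v) * a"
      using assms(1) unfolding a_def by (simp add: field_simps)
    then have *: "(2 * u - 1) * (2 * (u + v + 1) - a * (u - v)) = 2 * (u\<^sup>2 - v\<^sup>2) * (bethe_k v u * (2 * v - 1))"
      unfolding k by simp
    have h: "(2 * u - 1) * (2 * ((u + v + 1) * X) - a * ((u - v) * X)) = (2 * u - 1) * (2 * (u + v + 1) - a * (u - v)) * X" for X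
      by (simp add: algebra_simps)
    then show ?thesis
      unfolding a1 a2 D unfolding h * by (simp only: mult_ac)
  qed
  show "(2 * u - 1) * ((2 + a) * (a * b\<^sup>2 - a\<^sup>2 * b)) = 2 * (b\<^sup>2 - a\<^sup>2) * (bethe_k v (- u) * (2 * v - 1))"
  proof -
    have "(2 + a) = (2 * u + 1) * a"
      using assms(1) unfolding a_def by (simp add: field_simps)
    then have *: "(2 * u - 1) * ((2 + a) * (u - v)) = 2 * (u\<^sup>2 - v\<^sup>2) * (bethe_k v (- u) * (2 * v - 1))"
      unfolding k' by (simp only: mult_ac)
    have h: "(2 * u - 1) * ((2 + a) * ((u - v) * X)) = (2 * u - 1) * ((2 + a) * (u - v)) * X" for X
      by (simp only: mult_ac)
    then show ?thesis
      unfolding a1 D unfolding h * by (simp only: mult_ac)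
  qed
  show "2 * (b\<^sup>2 - a\<^sup>2) \<noteq> 0"
    using assms by (simp add: a_def b_def power_inverse)
qed

lemma spectral_inverse: "inverse (spectral \<alpha>) = uX \<alpha>"
  by (simp add: spectral_def)

lemma d_gam:
  assumes "\<alpha> \<noteq> 0" "\<beta> \<noteq> 0" "(spectral \<beta>)\<^sup>2 \<noteq> (spectral \<alpha>)\<^sup>2"
  shows "del (spectral \<beta>) (gam (spectral \<alpha>) w) = sF (bethe_g (spectral \<beta>) (spectral \<alpha>)) (gam (spectral \<alpha>) (del (spectral \<beta>) w))
    + sF (bethe_k (spectral \<beta>) (spectral \<alpha>)) (gam (spectral \<beta>) (del (spectral \<alpha>) w)) + sF (bethe_k (spectral \<beta>) (- spectral \<alpha>)) (gam (spectral \<beta>) (del (- spectral \<alpha>) w))"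
proof -
  note coef = d_gam_coefficients [OF spectral_nonzero [OF assms(1)] spectral_nonzero [OF assms(2)] assms(3) two_F spectral_half [OF assms(2)], unfolded spectral_inverse]
  let ?u = "spectral \<alpha>" and ?v = "spectral \<beta>"
  let ?k = "2 * ((uX \<beta>)\<^sup>2 - (uX \<alpha>)\<^sup>2)"
  have "sF ?k (sF (2 * ?u - 1) (ser D \<beta> * ser C \<alpha> * w)) = sF (2 * ?u - 1) (sF ?k (ser D \<beta> * ser C \<alpha>) * w)"
    by (simp add: mult.commute sF_mult_right)
  also have "\<dots> = sF ?k (sF (bethe_g ?v ?u * (2 * ?u - 1)) (ser C \<alpha> * ser D \<beta> * w)
      + sF (bethe_k ?v ?u * (2 * ?v - 1)) (ser C \<beta> * ser D \<alpha> * w)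
      + sF (bethe_k ?v (- ?u) * (2 * ?v - 1)) (ser C \<beta> * ser D (- \<alpha>) * w))"
    unfolding CD_ser distrib_right [where c = w] M.scale_right_distrib sF_mult_right [symmetric] M.scale_scale coef(1-3) ..
  finally have "sF (2 * ?u - 1) (ser D \<beta> * ser C \<alpha> * w) = sF (bethe_g ?v ?u * (2 * ?u - 1)) (ser C \<alpha> * ser D \<beta> * w)
      + sF (bethe_k ?v ?u * (2 * ?v - 1)) (ser C \<beta> * ser D \<alpha> * w)
      + sF (bethe_k ?v (- ?u) * (2 * ?v - 1)) (ser C \<beta> * ser D (- \<alpha>) * w)"
    using coef(4) by (simp only: M.scale_left_imp_eq)
  then show ?thesis
    unfolding gam_def del_def spectral_uminus by (simp add: ser_sF mult.assoc)
qed

end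

text \<open>Vectors of the abstract setting are series of endomorphisms. The highest weight vector
  is therefore represented by an endomorphism \<open>P\<close> with values in its line: left
  multiplication by b_1 and d_r acts on \<open>P\<close> as these operators act on the
  vector.\<close>

locale twisted_hw = twisted_rep scl \<rho>
  for scl :: "'k::field \<Rightarrow> 'v \<Rightarrow> 'v::ab_group_add" and \<rho> :: "'k free_alg set \<Rightarrow> 'v \<Rightarrow> 'v" +
  fixes P :: "'v endo" and \<mu> :: "'k fps"
  assumes B1_P: "B 1 * P = 0" and D_P: "D (int r) * P = scalar (fps_nth \<mu> r) * P"
begin

sublocale bethe sF "\<lambda>w. fls_const (B 1) * w" gam del UU "muS \<mu>" "fls_const P"
proof
  interpret e: Vector_Spaces.linear sF sF "\<lambda>w. fls_const (B 1) * w"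
    by (rule linear_const) (rule op_scalar)
  show "fls_const (B 1) * (x + y) = fls_const (B 1) * x + fls_const (B 1) * y" for x y
    by (rule e.add)
  show "fls_const (B 1) * sF r x = sF r (fls_const (B 1) * x)" for r x
    by (rule e.scale)
  show "gam u (x + y) = gam u x + gam u y" for u x y
    by (simp add: gam_def distrib_left M.scale_right_distrib)
  show "gam u (sF r x) = sF r (gam u x)" for u r x
    by (simp add: gam_def ser_sF mult.commute)
  show "- u \<in> UU" "u \<noteq> 0" "2 * u - 1 \<noteq> 0" if "u \<in> UU" for u
    using that spectral_nonzero spectral_half by (auto simp: UU_def spectral_uminus)
  show "(2 :: 'k fls) \<noteq> 0" by (rule two_F)
  show "gam u (gam v w) = gam v (gam u w)" for u v w
    unfolding gam_def ser_sF [OF central_op] M.scale_scale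
    by (simp add: mult.assoc [symmetric] ser_C_commute [of "al u"] mult.commute [of "2 * u - 1"])
  show "gam (- u) = gam u" if "u \<in> UU" for u
    using that gam_spectral_uminus by (auto simp: UU_def)
  show "fls_const (B 1) * gam u w = gam u (fls_const (B 1) * w) + sF (bethe_G u) (del u w) + sF (bethe_G (- u)) (del (- u) w)"
    if "u \<in> UU" for u w
    using that e_gam by (auto simp: UU_def)
  show "del v (gam u w) = sF (bethe_g v u) (gam u (del v w)) + sF (bethe_k v u) (gam v (del u w)) + sF (bethe_k v (- u)) (gam v (del (- u) w))"
    if "u \<in> UU" "v \<in> UU" "v\<^sup>2 \<noteq> u\<^sup>2" for u v w
    using that d_gam by (auto simp: UU_def)
  show "fls_const (B 1) * fls_const P = 0"
    by (simp add: B1_P)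
  show "del u (fls_const P) = sF (muS \<mu> u) (fls_const P)" for u
  proof (rule fls_eqI)
    fix n
    have "D (int r) * (scalar c * P) = scalar (fps_nth \<mu> r * c) * P" for r c
    proof -
      have "D (int r) * (scalar c * P) = scalar c * (D (int r) * P)"
        by (simp only: mult.assoc [symmetric] op_scalar)
      then show ?thesis
        by (simp only: D_P mult.assoc [symmetric] scalar_simps(2) [symmetric] mult.commute [of c])
    qed
    from this [of "nat n"] show "fls_nth (del u (fls_const P)) n = fls_nth (sF (muS \<mu> u) (fls_const P)) n"
      by (cases "n < 0") (simp_all add: del_def sF_def muS_def ser_nth mult.assoc scalar_simps(3))
  qed
qed

end

section \<open>The polynomial attached to a highest weight vector\<close>

lemma fps_to_fls_sum: "fps_to_fls (sum f I) = (\<Sum>i\<in>I. fps_to_fls (f i))"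
  by (rule fls_eqI) (simp add: fls_nth_sum fps_sum_nth)

context twisted_hw
begin

lemma emb_const: "emb (fls_const c) = fls_const (scalar c)"
  by (rule fls_eqI) (simp add: scalar_simps)

lemma D1_gam: "fls_const (D 1) * gam u w = gam u (fls_const (D 1) * w) + sF 2 (gam u w)"
proof -
  have "fls_const (D 1) * ser C \<alpha> = ser C \<alpha> * fls_const (D 1) + sF 2 (ser C \<alpha>)" for \<alpha>
  proof -
    have "fls_const (D 1) * ser C \<alpha> = ser (\<lambda>r. C r * D 1 + (C r + C r)) \<alpha>"
      unfolding const_ser using D1_C by (intro arg_cong2 [of _ _ _ _ ser] ext refl) (simp add: algebra_simps)
    then show ?thesis
      by (simp only: ser_add sF_two ser_const [OF op_scalar])
  qed
  then have "fls_const (D 1) * (ser C \<alpha> * w) = ser C \<alpha> * (fls_const (D 1) * w) + sF 2 (ser C \<alpha> * w)" for \<alpha>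
    by (simp add: mult.assoc [symmetric] distrib_right sF_mult_right)
  then show ?thesis
    by (simp add: gam_def const_sF op_scalar M.scale_right_distrib mult.commute)
qed

lemma D1_\<Gamma>:
  assumes "admissible I u" and m: "fps_nth \<mu> 1 = m"
  shows "fls_const (D 1) * \<Gamma> I u = sF (fls_const (of_nat (2 * card I) + m)) (\<Gamma> I u)"
proof -
  have "finite I" using assms(1) by (simp add: admissible_def)
  then show ?thesis using assms(1)
  proof (induction I)
    case empty
    show ?case
      using D_P [of 1] m by (simp add: sF_def emb_const)
  next
    case (insert a I)
    have admissible: "admissible I u" using insert.prems admissible_mono by blast
    have U: "\<And>i. i \<in> insert a I \<Longrightarrow> u i \<in> UU" using insert.prems by (auto simp: admissible_def)
    interpret ga: Vector_Spaces.linear sF sF "gam (u a)" by (rule linear_\<gamma>) (use U in auto)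
    have G: "\<Gamma> (insert a I) u = gam (u a) (\<Gamma> I u)"
      by (rule \<Gamma>_insert) (use insert.hyps U in auto)
    have "fls_const (D 1) * gam (u a) (\<Gamma> I u) = sF (fls_const (of_nat (2 * card I) + m) + 2) (gam (u a) (\<Gamma> I u))"
      unfolding D1_gam insert.IH [OF admissible] ga.scale M.scale_left_distrib ..
    moreover have "fls_const (of_nat (2 * card I) + m) + 2 = fls_const (of_nat (2 * card (insert a I)) + m)"
    proof -
      have "(2 :: 'k fls) = fls_const 2"
        by (metis fls_of_nat of_nat_numeral)
      then show ?thesis
        using insert.hyps by (simp add: fls_plus_const [symmetric] algebra_simps)
    qed
    ultimately show ?case unfolding G by simp
  qed
qed

text \<open>With n + 1 gammas the weight becomes - n + 2 (n + 1) = n + 2, which is not an eigenvalue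
  of D 1; so every coefficient of the Bethe vector vanishes.\<close>

lemma exists_Q_series:
  assumes "P \<noteq> 0" and m: "fps_nth \<mu> 1 = - of_nat n" and fact: "of_nat (fact (Suc n)) \<noteq> (0::'k)"
    and no_weight: "\<And>v. app (D 1) v = scl (of_nat n + 2) v \<Longrightarrow> v = 0"
  shows "\<exists>Q E. Q \<noteq> 0 \<and> finite E \<and>
    (\<forall>v\<in>UU. v\<^sup>2 \<notin> E \<longrightarrow> muS \<mu> v * poly Q (v\<^sup>2 + v) = muS \<mu> (- v) * poly Q (v\<^sup>2 - v))"
proof (rule exists_Q [of "Suc n"])
  show "fls_const P \<noteq> 0" using assms(1) by simp
  show "of_nat (fact (Suc n)) \<noteq> (0 :: 'k fls)"
    using fact unfolding fls_of_nat by simp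
  fix I u assume I: "admissible I u" "card I = Suc n"
  show "\<Gamma> I u = 0"
  proof (rule fls_eqI)
    fix k
    have "fls_nth (fls_const (D 1) * \<Gamma> I u) k = fls_nth (sF (fls_const (of_nat (2 * card I) + - of_nat n)) (\<Gamma> I u)) k"
      by (simp only: D1_\<Gamma> [OF I(1) m])
    moreover have "of_nat (2 * card I) + - of_nat n = (of_nat n + 2 :: 'k)"
      unfolding I(2) by simp
    ultimately have "D 1 * fls_nth (\<Gamma> I u) k = scalar (of_nat n + 2) * fls_nth (\<Gamma> I u) k"
      by (simp add: sF_def emb_const)
    then have "app (D 1 * fls_nth (\<Gamma> I u) k) v = app (scalar (of_nat n + 2) * fls_nth (\<Gamma> I u) k) v" for v
      by simp
    then have "app (fls_nth (\<Gamma> I u) k) v = 0" for v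
      by (intro no_weight) simp
    then show "fls_nth (\<Gamma> I u) k = fls_nth 0 k"
      by (auto intro: endo_eqI)
  qed
qed

end

section \<open>Descent from K((X)) to polynomials over the ground field\<close>

definition fps_scale :: "'a::comm_ring_1 \<Rightarrow> 'a fps \<Rightarrow> 'a fps" where
  "fps_scale c f = Abs_fps (\<lambda>r. fps_nth f r * c ^ r)"

lemma fps_scale_altdef: "fps_scale c f = fps_compose f (fps_const c * fps_X)"
  unfolding fps_compose_linear by (simp add: fps_scale_def mult.commute)

lemma fps_scale_simps:
  fixes c :: "'a::idom"
  shows "fps_scale c (f * g) = fps_scale c f * fps_scale c g" "fps_scale c (f + g) = fps_scale c f + fps_scale c g"
    "fps_scale c (f - g) = fps_scale c f - fps_scale c g" "fps_scale c (f ^ n) = fps_scale c f ^ n"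
    "fps_scale c 1 = 1" "fps_scale c fps_X = fps_const c * fps_X"
  by (simp_all add: fps_scale_altdef fps_compose_mult_distrib fps_compose_add_distrib fps_compose_sub_distrib fps_compose_power)

lemma fps_scale_neg_u: "fps_scale c (neg_u \<mu>) = fps_scale (- c) \<mu>"
  by (rule fps_ext) (simp add: fps_scale_def neg_u_def power_minus [of c] mult_ac)

text \<open>Applied to the coefficients of Q, this makes them power series in X.\<close>

lemma fls_common_shift:
  fixes q :: "nat \<Rightarrow> 'k::field fls"
  shows "\<exists>L p. \<forall>j\<le>N. fls_X ^ L * q j = fps_to_fls (p j)"
proof -
  have "\<exists>L. \<exists>p. fls_X ^ L * q j = fps_to_fls p" for j
  proof -
    have "fls_subdegree (fls_X ^ nat (- fls_subdegree (q j)) * q j) \<ge> 0"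
      by (cases "q j = 0") simp_all
    then show ?thesis by (metis fls_regpart_to_fls_trivial)
  qed
  then obtain l p where lp: "\<And>j. fls_X ^ l j * q j = fps_to_fls (p j)" by metis
  define L where "L = (\<Sum>j\<le>N. l j)"
  have "fls_X ^ L * q j = fps_to_fls (fps_X ^ (L - l j) * p j)" if "j \<le> N" for j
  proof -
    have "l j \<le> L" unfolding L_def using that by (intro member_le_sum) auto
    then have "L = (L - l j) + l j" by simp
    then have "fls_X ^ L * q j = fls_X ^ (L - l j) * (fls_X ^ l j * q j)"
      by (metis power_add mult.assoc)
    then show ?thesis
      by (simp add: lp fls_times_fps_to_fls fps_to_fls_power)
  qed
  then show ?thesis
    by (intro exI [of _ L] exI [of _ "\<lambda>j. fps_X ^ (L - l j) * p j"]) auto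
qed

text \<open>The coefficient of \<open>X\<^sup>s\<^sup>+\<^sup>t\<close> is a polynomial in \<open>\<alpha>\<close> with infinitely many zeros.\<close>

lemma rescaled_series_independent:
  fixes p \<phi> :: "nat \<Rightarrow> 'k::field fps"
  assumes "infinite S" and eq: "\<And>\<alpha>. \<alpha> \<in> S \<Longrightarrow> (\<Sum>j\<le>N. p j * fps_scale \<alpha> (\<phi> j)) = 0"
  shows "(\<Sum>j\<le>N. fps_nth (p j) s * fps_nth (\<phi> j) t) = 0"
proof -
  define k where "k = s + t"
  define f where "f = (\<Sum>i\<le>k. monom (\<Sum>j\<le>N. fps_nth (p j) (k - i) * fps_nth (\<phi> j) i) i)"
  have "poly f \<alpha> = 0" if "\<alpha> \<in> S" for \<alpha>
  proof -
    have "0 = fps_nth (\<Sum>j\<le>N. fps_scale \<alpha> (\<phi> j) * p j) k"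
      using eq [OF that] by (simp add: mult.commute)
    also have "\<dots> = (\<Sum>j\<le>N. \<Sum>i\<le>k. fps_nth (\<phi> j) i * \<alpha> ^ i * fps_nth (p j) (k - i))"
      by (simp add: fps_sum_nth fps_mult_nth fps_scale_def atLeast0AtMost)
    also have "\<dots> = poly f \<alpha>"
      by (subst sum.swap) (simp add: f_def poly_sum poly_monom sum_distrib_left sum_distrib_right mult_ac)
    finally show ?thesis by simp
  qed
  then have "S \<subseteq> {x. poly f x = 0}" by auto
  then have "f = 0"
    using assms(1) poly_roots_finite finite_subset by blast
  moreover have "coeff f t = (\<Sum>j\<le>N. fps_nth (p j) s * fps_nth (\<phi> j) t)"
    by (simp add: f_def coeff_sum k_def sum.delta if_distrib cong: if_cong)
  ultimately show ?thesis by simp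
qed

lemma poly_in_u_pCons: "poly_in_u (pCons a p) = fls_const a + fls_X_inv * poly_in_u p"
  by (simp add: poly_in_u_def map_poly_pCons)

lemma poly_in_u_0 [simp]: "poly_in_u 0 = 0"
  by (simp add: poly_in_u_def)

lemma poly_in_u_add: "poly_in_u (p + q) = poly_in_u p + poly_in_u q"
  by (induction p q rule: poly_induct2) (simp_all add: poly_in_u_pCons fls_plus_const [symmetric] algebra_simps)

lemma poly_in_u_smult: "poly_in_u (smult c p) = fls_const c * poly_in_u p"
  by (induction p) (simp_all add: poly_in_u_pCons algebra_simps)

lemma poly_in_u_mult: "poly_in_u (p * q) = poly_in_u p * poly_in_u q"
  by (induction p) (simp_all add: poly_in_u_pCons poly_in_u_add poly_in_u_smult algebra_simps)

lemma poly_in_u_pcompose: "poly_in_u (pcompose p q) = (\<Sum>j\<le>degree p. fls_const (coeff p j) * poly_in_u q ^ j)"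
proof -
  have "poly_in_u (pcompose p q) = poly (map_poly fls_const p) (poly_in_u q)"
    by (induction p) (simp_all add: poly_in_u_pCons poly_in_u_add poly_in_u_mult pcompose_pCons map_poly_pCons)
  also have "\<dots> = (\<Sum>j\<le>degree p. fls_const (coeff p j) * poly_in_u q ^ j)"
  proof -
    have "degree (map_poly fls_const p) = degree p"
      by (rule degree_map_poly) simp
    then show ?thesis by (simp add: poly_altdef coeff_map_poly)
  qed
  finally show ?thesis .
qed

text \<open>The coefficient at X^(- degree p) is the leading coefficient of p.\<close>

lemma poly_in_u_eq_0_iff: "poly_in_u p = 0 \<longleftrightarrow> p = 0"
proof
  assume p: "poly_in_u p = 0"
  have "poly_in_u p = (\<Sum>j\<le>degree p. fls_const (coeff p j) * fls_X_inv ^ j)"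
  proof -
    have "degree (map_poly fls_const p) = degree p"
      by (rule degree_map_poly) simp
    then show ?thesis by (simp add: poly_in_u_def poly_altdef coeff_map_poly)
  qed
  moreover have "fls_nth (\<Sum>j\<le>degree p. fls_const (coeff p j) * fls_X_inv ^ j) (- int (degree p)) = lead_coeff p"
  proof -
    have "fls_nth (fls_const c * fls_X_inv ^ j) (- int d) = (if j = d then c else 0)" for c :: 'a and j d
      by (simp add: fls_X_inv_power_conv_shift_1)
    then show ?thesis by (simp add: fls_nth_sum)
  qed
  ultimately show "p = 0" using p by simp
qed simp

context twisted_rep
begin

lemma spectral_eq_iff: "spectral \<alpha> = spectral \<beta> \<longleftrightarrow> \<alpha> = \<beta>"
  using al_spectral [of \<alpha>] al_spectral [of \<beta>] by metis

text \<open>Each excluded square is attained at no more than two values of \<alpha>, which differ by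
  sign.\<close>

lemma infinite_admissible:
  assumes "infinite (UNIV :: 'k set)" "finite Z"
  shows "infinite {\<alpha>. \<alpha> \<noteq> 0 \<and> (spectral \<alpha>)\<^sup>2 \<notin> Z}"
proof -
  have fib: "finite {\<alpha>. (spectral \<alpha>)\<^sup>2 = e}" for e
  proof (cases "\<exists>\<beta>. (spectral \<beta>)\<^sup>2 = e")
    case True
    then obtain \<beta> where b: "(spectral \<beta>)\<^sup>2 = e" by auto
    have "\<alpha> \<in> {\<beta>, - \<beta>}" if "(spectral \<alpha>)\<^sup>2 = e" for \<alpha>
    proof -
      from that b have "spectral \<alpha> = spectral \<beta> \<or> spectral \<alpha> = spectral (- \<beta>)"
        unfolding spectral_uminus [symmetric] by (simp add: power2_eq_iff [symmetric])
      then show ?thesis by (simp add: spectral_eq_iff)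
    qed
    then have "{\<alpha>. (spectral \<alpha>)\<^sup>2 = e} \<subseteq> {\<beta>, - \<beta>}" by blast
    then show ?thesis by (rule finite_subset) simp
  qed auto
  have "finite (\<Union>e\<in>Z. {\<alpha>. (spectral \<alpha>)\<^sup>2 = e})"
    using assms(2) fib by blast
  then have *: "finite (insert 0 (\<Union>e\<in>Z. {\<alpha>. (spectral \<alpha>)\<^sup>2 = e}))"
    by simp
  show ?thesis
  proof
    assume "finite {\<alpha>. \<alpha> \<noteq> 0 \<and> (spectral \<alpha>)\<^sup>2 \<notin> Z}"
    with * have "finite ({\<alpha>. \<alpha> \<noteq> 0 \<and> (spectral \<alpha>)\<^sup>2 \<notin> Z} \<union> insert 0 (\<Union>e\<in>Z. {\<alpha>. (spectral \<alpha>)\<^sup>2 = e}))"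
      by blast
    then have "finite (UNIV :: 'k set)"
      by (rule finite_subset [rotated]) auto
    with assms(1) show False by simp
  qed
qed

text \<open>The coefficients of Q involve X itself, while \<mu> and u involve \<alpha> X. As
  \<alpha> runs through an infinite set the two become independent, and a fixed power X^s of the
  former leaves the same equation with a polynomial over the ground field in place of Q.\<close>

lemma exists_P:
  fixes \<mu> :: "'k fps"
  assumes inf: "infinite (UNIV :: 'k set)" and "Q \<noteq> 0" "finite Z"
    and eq: "\<And>v. v \<in> UU \<Longrightarrow> v\<^sup>2 \<notin> Z \<Longrightarrow> muS \<mu> v * poly Q (v\<^sup>2 + v) = muS \<mu> (- v) * poly Q (v\<^sup>2 - v)"
    and \<mu>0: "fps_nth \<mu> 0 = 1"
  shows "\<exists>P :: 'k poly. lead_coeff P = 1 \<and> P = pcompose P [:1, - 1:] \<and>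
    fps_to_fls (neg_u \<mu>) / fps_to_fls \<mu> = poly_in_u (pcompose P [:1, 1:]) / poly_in_u P"
proof -
  define N where "N = degree Q"
  obtain L p where Lp: "\<And>j. j \<le> N \<Longrightarrow> fls_X ^ L * coeff Q j = fps_to_fls (p j)"
    using fls_common_shift [of N "coeff Q"] by auto
  \<comment> \<open>The equation is divided by u^(2N): (u^2 + u)^j becomes (1/u)^(2(N-j)) (1 +
    1/u)^j, likewise with a minus sign, and X stands for 1/u.\<close>
  define \<phi> where "\<phi> j = \<mu> * (fps_X ^ (2 * (N - j)) * (1 + fps_X) ^ j) - neg_u \<mu> * (fps_X ^ (2 * (N - j)) * (1 - fps_X) ^ j)" for j
  have scaled: "(\<Sum>j\<le>N. p j * fps_scale \<alpha> (\<phi> j)) = 0" if "\<alpha> \<noteq> 0" "(spectral \<alpha>)\<^sup>2 \<notin> Z" for \<alpha>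
  proof -
    have X0: "uX \<alpha> \<noteq> 0" using that by (simp add: uX_eq_0_iff)
    have pw: "uX \<alpha> ^ (2 * N) * z ^ j = uX \<alpha> ^ (2 * (N - j)) * w ^ j"
      if "j \<le> N" "(uX \<alpha>)\<^sup>2 * z = w" for z w and j
    proof -
      have "2 * N = 2 * (N - j) + 2 * j" using that by simp
      then have "uX \<alpha> ^ (2 * N) = uX \<alpha> ^ (2 * (N - j)) * ((uX \<alpha>)\<^sup>2) ^ j"
        by (simp only: power_add power_mult)
      then show ?thesis
        by (simp add: that(2) [symmetric] power_mult_distrib mult.assoc)
    qed
    have ev: "fls_X ^ L * (uX \<alpha> ^ (2 * N) * poly Q z) = (\<Sum>j\<le>N. fps_to_fls (p j) * (uX \<alpha> ^ (2 * (N - j)) * w ^ j))"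
      if "(uX \<alpha>)\<^sup>2 * z = w" for z w
    proof -
      have "fls_X ^ L * (uX \<alpha> ^ (2 * N) * poly Q z) = (\<Sum>j\<le>N. (fls_X ^ L * coeff Q j) * (uX \<alpha> ^ (2 * N) * z ^ j))"
        unfolding poly_altdef N_def [symmetric] by (simp add: sum_distrib_left mult_ac)
      also have "\<dots> = (\<Sum>j\<le>N. fps_to_fls (p j) * (uX \<alpha> ^ (2 * (N - j)) * w ^ j))"
        by (intro sum.cong refl) (simp add: Lp pw that)
      finally show ?thesis .
    qed
    have w1: "(uX \<alpha>)\<^sup>2 * ((spectral \<alpha>)\<^sup>2 + spectral \<alpha>) = 1 + uX \<alpha>" "(uX \<alpha>)\<^sup>2 * ((spectral \<alpha>)\<^sup>2 - spectral \<alpha>) = 1 - uX \<alpha>"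
      using X0 by (simp_all add: spectral_def field_simps power2_eq_square)
    have "spectral \<alpha> \<in> UU" using that by (simp add: UU_def)
    then have "muS \<mu> (spectral \<alpha>) * (fls_X ^ L * (uX \<alpha> ^ (2 * N) * poly Q ((spectral \<alpha>)\<^sup>2 + spectral \<alpha>)))
       = muS \<mu> (spectral (- \<alpha>)) * (fls_X ^ L * (uX \<alpha> ^ (2 * N) * poly Q ((spectral \<alpha>)\<^sup>2 - spectral \<alpha>)))"
      using eq [of "spectral \<alpha>"] that(2) by (simp add: spectral_uminus mult.left_commute)
    then have *: "muS \<mu> (spectral \<alpha>) * (\<Sum>j\<le>N. fps_to_fls (p j) * (uX \<alpha> ^ (2 * (N - j)) * (1 + uX \<alpha>) ^ j))
       = muS \<mu> (spectral (- \<alpha>)) * (\<Sum>j\<le>N. fps_to_fls (p j) * (uX \<alpha> ^ (2 * (N - j)) * (1 - uX \<alpha>) ^ j))"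
      unfolding ev [OF w1(1)] ev [OF w1(2)] .
    have mu: "muS \<mu> (spectral \<alpha>) = fps_to_fls (fps_scale \<alpha> \<mu>)" for \<alpha>
      by (simp add: muS_def fps_scale_def)
    have X: "uX \<alpha> = fps_to_fls (fps_const \<alpha> * fps_X)"
      by (simp add: uX_def fls_times_fps_to_fls)
    have "fps_to_fls (fps_scale \<alpha> (\<phi> j)) = muS \<mu> (spectral \<alpha>) * (uX \<alpha> ^ (2 * (N - j)) * (1 + uX \<alpha>) ^ j)
        - muS \<mu> (spectral (- \<alpha>)) * (uX \<alpha> ^ (2 * (N - j)) * (1 - uX \<alpha>) ^ j)" for j
      unfolding \<phi>_def fps_scale_simps fps_scale_neg_u mu X
      by (simp add: fls_times_fps_to_fls fps_to_fls_power)
    then have "fps_to_fls (\<Sum>j\<le>N. p j * fps_scale \<alpha> (\<phi> j)) = 0"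
      using * by (simp add: fps_to_fls_sum fls_times_fps_to_fls right_diff_distrib sum_subtractf
          sum_distrib_left mult.left_commute)
    then show ?thesis by simp
  qed
  have indep: "(\<Sum>j\<le>N. fps_nth (p j) s * fps_nth (\<phi> j) t) = 0" for s t
    by (rule rescaled_series_independent [OF infinite_admissible [OF inf \<open>finite Z\<close>]]) (use scaled in auto)
  have "fls_X ^ L * coeff Q N \<noteq> 0"
    using \<open>Q \<noteq> 0\<close> by (simp add: N_def)
  then have "p N \<noteq> 0"
    using Lp [of N] by auto
  \<comment> \<open>A power of X that occurs in the leading coefficient, so that \<open>R\<close>
    keeps degree N and is nonzero.\<close>
  then obtain s where s: "fps_nth (p N) s \<noteq> 0"
    by (auto simp: fps_eq_iff)
  define R where "R = (\<Sum>j\<le>N. monom (fps_nth (p j) s) j)"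
  have coeffR: "coeff R j = (if j \<le> N then fps_nth (p j) s else 0)" for j
    by (simp add: R_def coeff_sum if_distrib sum.delta' cong: if_cong)
  have R0: "R \<noteq> 0" using coeffR [of N] s by auto
  have degR: "degree R = N"
    by (rule antisym) (use s in \<open>auto intro!: degree_le le_degree simp: coeffR\<close>)
  have "fps_to_fls (\<Sum>j\<le>N. fps_const (fps_nth (p j) s) * \<phi> j) = fps_to_fls 0"
    by (intro arg_cong [of _ _ fps_to_fls] fps_ext) (simp add: fps_sum_nth indep)
  then have "(\<Sum>j\<le>N. fls_const (fps_nth (p j) s) * fps_to_fls (\<phi> j)) = 0"
    by (simp add: fps_to_fls_sum fls_times_fps_to_fls)
  \<comment> \<open>Back to polynomials in u, by X^2 (u^2 + c u) = 1 + c X.\<close>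
  moreover have "fps_to_fls (\<phi> j) = fls_X ^ (2 * N) * (fps_to_fls \<mu> * poly_in_u [:0, 1, 1:] ^ j - fps_to_fls (neg_u \<mu>) * poly_in_u [:0, - 1, 1:] ^ j)"
    if "j \<le> N" for j
  proof -
    have "2 * N = 2 * (N - j) + 2 * j" using that by simp
    then have N: "fls_X ^ (2 * N) = (fls_X ^ (2 * (N - j)) * (fls_X\<^sup>2) ^ j :: 'k fls)"
      by (simp only: power_add power_mult)
    have XX: "(fls_X :: 'k fls) * fls_X_inv = 1"
      by (simp flip: fls_inverse_X)
    have "fls_X\<^sup>2 * poly_in_u [:0, c, 1::'k:] = fls_const c * fls_X + 1" for c
    proof -
      have "fls_X\<^sup>2 * poly_in_u [:0, c, 1::'k:] = fls_const c * fls_X * (fls_X * fls_X_inv) + (fls_X * fls_X_inv) * (fls_X * fls_X_inv)"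
        by (simp only: poly_in_u_pCons poly_in_u_0 power2_eq_square) (simp add: algebra_simps del: fls_X_inv_times_conv_shift)
      then show ?thesis unfolding XX by simp
    qed
    note quadratic = this
    have "fls_const (- 1) = (- 1 :: 'k fls)"
      by (rule fls_eqI) simp
    with quadratic [of 1] quadratic [of "- 1"]
    have "fls_X\<^sup>2 * poly_in_u [:0, 1, 1::'k:] = 1 + fls_X" "fls_X\<^sup>2 * poly_in_u [:0, - 1, 1::'k:] = 1 - fls_X"
      by (simp_all add: add.commute)
    then have pw: "(fls_X\<^sup>2) ^ j * poly_in_u [:0, 1, 1::'k:] ^ j = (1 + fls_X) ^ j"
      "(fls_X\<^sup>2) ^ j * poly_in_u [:0, - 1, 1::'k:] ^ j = (1 - fls_X) ^ j"
      by (simp_all only: power_mult_distrib [symmetric])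
    have "x * y * (m * f - m' * g) = m * (x * (y * f)) - m' * (x * (y * g))" for x y m m' f g :: "'k fls"
      by (simp add: algebra_simps)
    then show ?thesis
      unfolding N \<phi>_def pw by (simp add: pw fls_times_fps_to_fls fps_to_fls_power)
  qed
  ultimately have "fls_X ^ (2 * N) * (fps_to_fls \<mu> * poly_in_u (pcompose R [:0, 1, 1:])
      - fps_to_fls (neg_u \<mu>) * poly_in_u (pcompose R [:0, - 1, 1:])) = 0"
    unfolding poly_in_u_pcompose degR
    by (simp add: coeffR sum_distrib_left sum_subtractf [symmetric] algebra_simps)
  then have main: "fps_to_fls \<mu> * poly_in_u (pcompose R [:0, 1, 1:]) = fps_to_fls (neg_u \<mu>) * poly_in_u (pcompose R [:0, - 1, 1:])"
    by simp
  \<comment> \<open>The polynomial u^2 - u is invariant under u -> 1 - u and becomes u^2 + u under u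
    -> u + 1.\<close>
  define P0 where "P0 = pcompose R [:0, - 1, 1:]"
  define P where "P = smult (inverse (lead_coeff P0)) P0"
  have P0: "P0 \<noteq> 0"
    unfolding P0_def using R0 pcompose_eq_0 by fastforce
  have refl: "pcompose P0 [:1, - 1:] = P0"
    unfolding P0_def pcompose_assoc [symmetric] by (simp add: pcompose_pCons)
  have shift: "pcompose P0 [:1, 1:] = pcompose R [:0, 1, 1:]"
    unfolding P0_def pcompose_assoc [symmetric] by (simp add: pcompose_pCons)
  have "\<mu> \<noteq> 0" using \<mu>0 by auto
  moreover have "poly_in_u P \<noteq> 0"
    using P0 by (simp add: poly_in_u_eq_0_iff P_def)
  moreover have "fps_to_fls \<mu> * poly_in_u (pcompose P [:1, 1:]) = fps_to_fls (neg_u \<mu>) * poly_in_u P"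
    using main [folded P0_def] by (simp add: P_def pcompose_smult poly_in_u_smult shift)
  ultimately have "fps_to_fls (neg_u \<mu>) / fps_to_fls \<mu> = poly_in_u (pcompose P [:1, 1:]) / poly_in_u P"
    by (simp add: field_simps)
  moreover have "lead_coeff P = 1"
    using P0 by (simp add: P_def)
  moreover have "P = pcompose P [:1, - 1:]"
    by (simp add: P_def pcompose_smult refl)
  ultimately show ?thesis by blast
qed

end

section \<open>Weights of the modules $V(m,p)$\<close>



text \<open>Over a finite field 1 + prod (x - a) takes the value 1 everywhere and has no
  root.\<close>

lemma infinite_alg_closed_field: "infinite (UNIV :: 'k::alg_closed_field set)"
proof
  assume fin: "finite (UNIV :: 'k set)"
  define p where "p = (\<Prod>a\<in>(UNIV :: 'k set). [:- a, 1:])"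
  have "degree p = card (UNIV :: 'k set)"
    unfolding p_def by (subst degree_prod_eq_sum_degree) auto
  then have "degree p > 0"
    using fin by (simp add: card_gt_0_iff)
  then have "degree (p + 1) > 0"
    by (subst degree_add_eq_left) simp_all
  then obtain z where "poly (p + 1) z = 0"
    using alg_closed_imp_poly_has_root by blast
  moreover have "poly p z = 0"
    using fin by (auto simp: p_def poly_prod prod_zero_iff)
  ultimately show False by simp
qed

lemma (in vector_space) exists_separating_functional:
  assumes "subspace U" "w \<notin> U"
  shows "\<exists>f. Vector_Spaces.linear scale (*) f \<and> (\<forall>u\<in>U. f u = 0) \<and> f w = 1"
proof -
  interpret F: vector_space "(*) :: 'a \<Rightarrow> 'a \<Rightarrow> 'a"
    by unfold_locales (auto simp: algebra_simps)
  interpret P: vector_space_pair scale "(*) :: 'a \<Rightarrow> 'a \<Rightarrow> 'a" ..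
  obtain B where B: "B \<subseteq> U" "independent B" "span B = U"
    using basis_exists [of U] assms(1) by (metis span_subspace)
  have ind: "independent (insert w B)"
    using B assms(2) by (simp add: independent_insert)
  obtain f where f: "Vector_Spaces.linear scale (*) f" "\<forall>x\<in>insert w B. f x = (if x = w then 1 else 0)"
    using P.linear_independent_extend [OF ind, of "\<lambda>x. if x = w then 1 else 0"] by blast
  interpret f: Vector_Spaces.linear scale "(*)" f by (rule f)
  have "f u = 0" if "u \<in> U" for u
  proof -
    have wB: "w \<notin> B" using B assms(2) by auto
    have "subspace {u. f u = 0}"
      by (auto intro!: subspaceI simp: f.add f.scale)
    then have "span B \<subseteq> {u. f u = 0}"
      using f(2) wB by (intro span_minimal) auto
    with that B show ?thesis by auto
  qed
  with f show ?thesis by auto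
qed

text \<open>A functional that vanishes on \<open>U\<close> but not on the coefficient would give a
  nonzero scalar polynomial with infinitely many zeros. Exponents may repeat, so that the two sides
  of an equation can be compared as one sum.\<close>

lemma (in vector_space) polynomial_coefficients_in_subspace:
  assumes "subspace U" "finite I" "infinite S"
    and mem: "\<And>s. s \<in> S \<Longrightarrow> (\<Sum>i\<in>I. scale (s ^ k i) (v i)) \<in> U"
  shows "(\<Sum>i\<in>{i\<in>I. k i = e}. v i) \<in> U"
proof (rule ccontr)
  assume "(\<Sum>i\<in>{i\<in>I. k i = e}. v i) \<notin> U"
  then obtain f where f: "Vector_Spaces.linear scale (*) f" "\<forall>u\<in>U. f u = 0" "f (\<Sum>i\<in>{i\<in>I. k i = e}. v i) = 1"
    using exists_separating_functional [OF assms(1)] by blast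
  interpret f: Vector_Spaces.linear scale "(*)" f by (rule f)
  define p where "p = (\<Sum>i\<in>I. monom (f (v i)) (k i))"
  have "poly p s = 0" if "s \<in> S" for s
  proof -
    have "poly p s = f (\<Sum>i\<in>I. scale (s ^ k i) (v i))"
      by (simp add: p_def poly_sum poly_monom f.sum f.scale mult.commute)
    then show ?thesis using f(2) mem [OF that] by simp
  qed
  then have "S \<subseteq> {x. poly p x = 0}" by auto
  then have "p = 0"
    using assms(3) poly_roots_finite finite_subset by blast
  moreover have "coeff p e = f (\<Sum>i\<in>{i\<in>I. k i = e}. v i)"
    using assms(2) by (simp add: p_def coeff_sum f.sum sum.inter_filter [symmetric])
  ultimately show False using f(3) by simp
qed

definition mat2 :: "'k::field \<Rightarrow> 'k \<Rightarrow> 'k \<Rightarrow> 'k \<Rightarrow> 'k ^ idx ^ idx" where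
  "mat2 p q r s = (\<chi> i j. case i of MinusOne \<Rightarrow> (case j of MinusOne \<Rightarrow> p | PlusOne \<Rightarrow> q)
     | PlusOne \<Rightarrow> (case j of MinusOne \<Rightarrow> r | PlusOne \<Rightarrow> s))"

lemma mat_idx_eqI:
  "A $ MinusOne $ MinusOne = B $ MinusOne $ MinusOne \<Longrightarrow> A $ MinusOne $ PlusOne = B $ MinusOne $ PlusOne \<Longrightarrow>
   A $ PlusOne $ MinusOne = B $ PlusOne $ MinusOne \<Longrightarrow> A $ PlusOne $ PlusOne = B $ PlusOne $ PlusOne \<Longrightarrow> A = B"
  unfolding vec_eq_iff
proof (intro allI)
  fix i j
  assume "A $ MinusOne $ MinusOne = B $ MinusOne $ MinusOne" "A $ MinusOne $ PlusOne = B $ MinusOne $ PlusOne"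
    "A $ PlusOne $ MinusOne = B $ PlusOne $ MinusOne" "A $ PlusOne $ PlusOne = B $ PlusOne $ PlusOne"
  then show "A $ i $ j = B $ i $ j" by (cases i; cases j) auto
qed

lemma mat2_nth [simp]:
  "mat2 p q r s $ MinusOne $ MinusOne = p" "mat2 p q r s $ MinusOne $ PlusOne = q"
  "mat2 p q r s $ PlusOne $ MinusOne = r" "mat2 p q r s $ PlusOne $ PlusOne = s"
  by (simp_all add: mat2_def)

lemma mat2_cases: obtains p q r s where "g = mat2 p q r s"
proof
  show "g = mat2 (g $ MinusOne $ MinusOne) (g $ MinusOne $ PlusOne) (g $ PlusOne $ MinusOne) (g $ PlusOne $ PlusOne)"
    by (rule mat_idx_eqI) simp_all
qed

lemma mat2_mult: "mat2 p q r s ** mat2 p' q' r' s' = mat2 (p * p' + q * r') (p * q' + q * s') (r * p' + s * r') (r * q' + s * s')"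
  by (rule mat_idx_eqI) (simp_all add: matrix_matrix_mult_def sum_idx)

lemma mat_1_mat2: "mat 1 = mat2 1 0 0 1"
  by (rule mat_idx_eqI) (simp_all add: mat_def)

text \<open>For 2 x 2 matrices A' is the adjugate, so \<open>Sp2\<close> is SL_2.\<close>

lemma mat2_Sp2: "mat2 p q r s \<in> Sp2 \<longleftrightarrow> p * s - q * r = 1"
proof -
  have "prime_mat (mat2 p q r s) = mat2 s (- q) (- r) p"
    by (rule mat_idx_eqI) (simp_all add: prime_mat_def theta_def sgn_idx_def uminus_idx_def)
  then have "mat2 p q r s \<in> Sp2 \<longleftrightarrow> mat2 (p * s - q * r) 0 0 (p * s - q * r) = mat2 1 0 0 1"
    by (simp add: Sp2_def mat2_mult mat_1_mat2 algebra_simps)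
  also have "\<dots> \<longleftrightarrow> p * s - q * r = 1"
    by (metis mat2_nth(1))
  finally show ?thesis .
qed

lemma unip_elt_mat2: "unip_elt t = mat2 1 t 0 1"
  by (rule mat_idx_eqI) (simp_all add: unip_elt_def E_mat_def mat_def)

lemma torus_elt_mat2: "torus_elt t = mat2 (inverse t) 0 0 t"
  by (rule mat_idx_eqI) (simp_all add: torus_elt_def)

lemma matrix_monomial_mat2:
  "matrix_monomial \<alpha> (mat2 p q r s) = p ^ \<alpha> MinusOne MinusOne * q ^ \<alpha> MinusOne PlusOne * (r ^ \<alpha> PlusOne MinusOne * s ^ \<alpha> PlusOne PlusOne)"
  by (simp add: matrix_monomial_def UNIV_idx)

lemma coeff_linear_power: "coeff ([:1, c:] ^ n) 0 = 1" "coeff ([:1, c:] ^ n) (Suc 0) = of_nat n * (c :: 'k::field)"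
  by (induction n) (simp_all add: coeff_mult algebra_simps)

text \<open>F_11 is diag(- 1, 1), so 1 + \<epsilon> F_11 has zero off-diagonal entries and kills
  every monomial that contains one.\<close>

lemma diff_monomial_F:
  "diff_monomial \<alpha> (F_mat PlusOne PlusOne :: 'k::field ^ idx ^ idx)
     = (if \<alpha> MinusOne PlusOne = 0 \<and> \<alpha> PlusOne MinusOne = 0
        then of_nat (\<alpha> PlusOne PlusOne) - of_nat (\<alpha> MinusOne MinusOne) else 0)"
proof -
  have F: "F_mat PlusOne PlusOne = (mat2 (- 1) 0 0 1 :: 'k ^ idx ^ idx)"
    by (rule mat_idx_eqI) (simp_all add: F_mat_def E_mat_def theta_def sgn_idx_def uminus_idx_def)
  show ?thesis
    unfolding F
    by (simp add: diff_monomial_def matrix_monomial_def UNIV_idx mat_def coeff_mult coeff_linear_power power_0_left)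
qed

section \<open>Weight vectors from the group action\<close>

locale sp2_module = vector_space scl
  for scl :: "'k::alg_closed_field \<Rightarrow> 'w \<Rightarrow> 'w::ab_group_add" +
  fixes \<pi> W \<tau> and m :: int and \<xi>
  assumes rep: "Sp2_rep scl \<pi> W" and rational: "Sp2_rational scl \<pi> W" and simple: "Sp2_simple scl \<pi> W"
    and differential: "Sp2_differential scl \<pi> W \<tau>"
    and \<xi>: "\<xi> \<in> W" "\<xi> \<noteq> 0"
    and unip_\<xi>: "\<And>t. \<pi> (unip_elt t) \<xi> = \<xi>"
    and torus_\<xi>: "\<And>t. t \<noteq> 0 \<Longrightarrow> \<pi> (torus_elt t) \<xi> = scl (t powi m) \<xi>"
    and m: "m \<le> 0"
begin

lemma W: "subspace W"
  using rep by (simp add: Sp2_rep_def)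

lemma \<pi>_closed: "g \<in> Sp2 \<Longrightarrow> w \<in> W \<Longrightarrow> \<pi> g w \<in> W"
  and \<pi>_add: "g \<in> Sp2 \<Longrightarrow> v \<in> W \<Longrightarrow> w \<in> W \<Longrightarrow> \<pi> g (v + w) = \<pi> g v + \<pi> g w"
  and \<pi>_scale: "g \<in> Sp2 \<Longrightarrow> w \<in> W \<Longrightarrow> \<pi> g (scl c w) = scl c (\<pi> g w)"
  and \<pi>_one: "w \<in> W \<Longrightarrow> \<pi> (mat2 1 0 0 1) w = w"
  and \<pi>_mult: "g \<in> Sp2 \<Longrightarrow> h \<in> Sp2 \<Longrightarrow> w \<in> W \<Longrightarrow> \<pi> (g ** h) w = \<pi> g (\<pi> h w)"
  using rep by (auto simp: Sp2_rep_def mat_1_mat2)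

lemma \<pi>_sum: "g \<in> Sp2 \<Longrightarrow> (\<And>i. i \<in> I \<Longrightarrow> v i \<in> W) \<Longrightarrow> \<pi> g (\<Sum>i\<in>I. scl (c i) (v i)) = (\<Sum>i\<in>I. scl (c i) (\<pi> g (v i)))"
proof (induction I rule: infinite_finite_induct)
  case (insert a I)
  have "(\<Sum>i\<in>I. scl (c i) (v i)) \<in> W"
    using insert W by (intro subspace_sum) (auto intro: subspace_scale)
  with insert W show ?case
    by (simp add: \<pi>_add \<pi>_scale subspace_scale)
qed (use \<pi>_scale [of _ \<xi> 0] \<xi> in auto)

lemma infinite_nonzero: "infinite (UNIV - {0 :: 'k})"
  using infinite_alg_closed_field by simp

text \<open>On the two unipotent root subgroups all entries but s are constant; the terms of the
  orbit map are collected by powers of s.\<close>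

lemma orbit_curve:
  assumes w: "w \<in> W"
  shows "\<exists>N x. (\<forall>k\<le>N. x k \<in> W) \<and> (\<forall>s. \<pi> (mat2 1 s 0 1) w = (\<Sum>k\<le>N. scl (s ^ k) (x k)))"
    and "\<exists>N x. (\<forall>k\<le>N. x k \<in> W) \<and> (\<forall>s. \<pi> (mat2 1 0 s 1) w = (\<Sum>k\<le>N. scl (s ^ k) (x k)))"
proof -
  obtain A c where "orbit_polynomial scl \<pi> W w A c"
    using rational w by (auto simp: Sp2_rational_def)
  then have fin: "finite A" and c: "c ` A \<subseteq> W"
    and eq: "\<And>g. g \<in> Sp2 \<Longrightarrow> \<pi> g w = (\<Sum>\<alpha>\<in>A. scl (matrix_monomial \<alpha> g) (c \<alpha>))"
    by (auto simp: orbit_polynomial_def)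
  have *: "\<exists>N x. (\<forall>k\<le>N. x k \<in> W) \<and> (\<forall>s. (\<Sum>\<alpha>\<in>A. scl (s ^ f \<alpha> * z \<alpha>) (c \<alpha>)) = (\<Sum>k\<le>N. scl (s ^ k) (x k)))"
    for f :: "(idx \<Rightarrow> idx \<Rightarrow> nat) \<Rightarrow> nat" and z
  proof -
    define N where "N = (\<Sum>\<alpha>\<in>A. f \<alpha>)"
    have N: "f ` A \<subseteq> {..N}"
      using fin by (auto simp: N_def intro: member_le_sum)
    define x where "x k = (\<Sum>\<alpha>\<in>{\<alpha>\<in>A. f \<alpha> = k}. scl (z \<alpha>) (c \<alpha>))" for k
    have "x k \<in> W" for k
      unfolding x_def using c W by (intro subspace_sum) (auto intro: subspace_scale)
    moreover have "(\<Sum>\<alpha>\<in>A. scl (s ^ f \<alpha> * z \<alpha>) (c \<alpha>)) = (\<Sum>k\<le>N. scl (s ^ k) (x k))" for s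
    proof -
      have "(\<Sum>\<alpha>\<in>A. scl (s ^ f \<alpha> * z \<alpha>) (c \<alpha>)) = (\<Sum>k\<le>N. \<Sum>\<alpha>\<in>{\<alpha>\<in>A. f \<alpha> = k}. scl (s ^ f \<alpha> * z \<alpha>) (c \<alpha>))"
        by (rule sum.group [symmetric]) (use fin N in auto)
      then show ?thesis by (simp add: x_def scale_sum_right)
    qed
    ultimately show ?thesis by blast
  qed
  have "\<pi> (mat2 1 s 0 1) w = (\<Sum>\<alpha>\<in>A. scl (s ^ \<alpha> MinusOne PlusOne * 0 ^ \<alpha> PlusOne MinusOne) (c \<alpha>))"
    "\<pi> (mat2 1 0 s 1) w = (\<Sum>\<alpha>\<in>A. scl (s ^ \<alpha> PlusOne MinusOne * 0 ^ \<alpha> MinusOne PlusOne) (c \<alpha>))" for s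
    by (simp_all add: eq mat2_Sp2 matrix_monomial_mat2 mult.commute)
  then show "\<exists>N x. (\<forall>k\<le>N. x k \<in> W) \<and> (\<forall>s. \<pi> (mat2 1 s 0 1) w = (\<Sum>k\<le>N. scl (s ^ k) (x k)))"
    and "\<exists>N x. (\<forall>k\<le>N. x k \<in> W) \<and> (\<forall>s. \<pi> (mat2 1 0 s 1) w = (\<Sum>k\<le>N. scl (s ^ k) (x k)))"
    using * by simp_all
qed

text \<open>The differential uses one polynomial expression of the orbit map, of which the weight
  determines only the restriction to the torus. There, after multiplication by t^M, the coefficients
  of exponent e sum to 0 unless e = M + l, when they sum to x; the differential multiplies them by e
  - M.\<close>

lemma torus_weight_differential:
  assumes x: "x \<in> W" and weight: "\<And>t. t \<noteq> 0 \<Longrightarrow> \<pi> (torus_elt t) x = scl (t powi l) x"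
  shows "\<tau> PlusOne PlusOne x = scl (of_int l) x"
proof -
  obtain A c where orb: "orbit_polynomial scl \<pi> W x A c"
    using rational x by (auto simp: Sp2_rational_def)
  then have fin: "finite A" and c: "c ` A \<subseteq> W"
    and eq: "\<And>g. g \<in> Sp2 \<Longrightarrow> \<pi> g x = (\<Sum>\<alpha>\<in>A. scl (matrix_monomial \<alpha> g) (c \<alpha>))"
    by (auto simp: orbit_polynomial_def)
  define J where "J = {\<alpha>\<in>A. \<alpha> MinusOne PlusOne = 0 \<and> \<alpha> PlusOne MinusOne = 0}"
  have finJ: "finite J" using fin by (simp add: J_def)
  \<comment> \<open>Large enough to clear the negative powers of t on both sides; \<open>a\<close>
    is the exponent of t^M t^l.\<close>
  define M where "M = (\<Sum>\<alpha>\<in>J. \<alpha> MinusOne MinusOne) + nat (- l)"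
  have M: "\<alpha> MinusOne MinusOne \<le> M" if "\<alpha> \<in> J" for \<alpha>
    using member_le_sum [OF that, of "\<lambda>\<alpha>. \<alpha> MinusOne MinusOne"] finJ by (simp add: M_def)
  define a where "a = nat (int M + l)"
  have a: "int a = int M + l" by (simp add: a_def M_def sum_nonneg)
  define h where "h \<alpha> = M - \<alpha> MinusOne MinusOne + \<alpha> PlusOne PlusOne" for \<alpha> :: "idx \<Rightarrow> idx \<Rightarrow> nat"
  have poly: "scl (t ^ a) x = (\<Sum>\<alpha>\<in>J. scl (t ^ h \<alpha>) (c \<alpha>))" if "t \<noteq> 0" for t
  proof -
    have "t ^ a = t ^ M * t powi l"
      using that a by (metis power_int_add power_int_of_nat)
    then have "scl (t ^ a) x = scl (t ^ M) (\<pi> (torus_elt t) x)"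
      by (simp add: weight that)
    also have "\<pi> (torus_elt t) x = (\<Sum>\<alpha>\<in>A. scl (matrix_monomial \<alpha> (torus_elt t)) (c \<alpha>))"
      by (rule eq) (simp add: torus_elt_mat2 mat2_Sp2 that)
    also have "\<dots> = (\<Sum>\<alpha>\<in>J. scl (inverse t ^ \<alpha> MinusOne MinusOne * t ^ \<alpha> PlusOne PlusOne) (c \<alpha>))"
      using fin by (intro sum.mono_neutral_cong_right)
        (auto simp: J_def torus_elt_mat2 matrix_monomial_mat2 power_0_left)
    also have "scl (t ^ M) \<dots> = (\<Sum>\<alpha>\<in>J. scl (t ^ h \<alpha>) (c \<alpha>))"
      unfolding scale_sum_right
    proof (rule sum.cong [OF refl])
      fix \<alpha> assume "\<alpha> \<in> J"
      then have "M = \<alpha> MinusOne MinusOne + (M - \<alpha> MinusOne MinusOne)" using M by simp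
      then have "t ^ M = t ^ \<alpha> MinusOne MinusOne * t ^ (M - \<alpha> MinusOne MinusOne)"
        by (metis power_add)
      then have "t ^ M * (inverse t ^ \<alpha> MinusOne MinusOne * t ^ \<alpha> PlusOne PlusOne) = t ^ h \<alpha>"
        using that by (simp add: h_def power_add field_simps)
      then show "scl (t ^ M) (scl (inverse t ^ \<alpha> MinusOne MinusOne * t ^ \<alpha> PlusOne PlusOne) (c \<alpha>)) = scl (t ^ h \<alpha>) (c \<alpha>)"
        by simp
    qed
    finally show ?thesis .
  qed
  have coef: "(\<Sum>\<alpha>\<in>{\<alpha>\<in>J. h \<alpha> = e}. c \<alpha>) = (if e = a then x else 0)" for e
  proof -
    \<comment> \<open>\<open>None\<close> carries - x with exponent \<open>a\<close>, which makes
      the equation a single sum equal to 0.\<close>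
    define k where "k = case_option a h"
    define v where "v = case_option (- x) c"
    have "(\<Sum>i\<in>{i\<in>insert None (Some ` J). k i = e}. v i) \<in> {0}"
    proof (rule polynomial_coefficients_in_subspace [OF _ _ infinite_nonzero])
      show "(\<Sum>i\<in>insert None (Some ` J). scl (s ^ k i) (v i)) \<in> {0}" if "s \<in> UNIV - {0}" for s
        using poly [of s] that finJ by (simp add: sum.reindex k_def v_def scale_minus_right)
    qed (use finJ in auto)
    moreover have "{i\<in>insert None (Some ` J). k i = e} = (if e = a then {None} else {}) \<union> Some ` {\<alpha>\<in>J. h \<alpha> = e}"
      by (auto simp: k_def)
    ultimately show ?thesis
      using finJ by (simp add: sum.reindex v_def split: if_splits)
  qed
  have bound: "h ` J \<subseteq> {..(\<Sum>\<alpha>\<in>J. h \<alpha>) + a}"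
    using finJ by (auto intro: trans_le_add1 member_le_sum)
  have "\<tau> PlusOne PlusOne x = (\<Sum>\<alpha>\<in>A. scl (diff_monomial \<alpha> (F_mat PlusOne PlusOne)) (c \<alpha>))"
    using differential x orb by (auto simp: Sp2_differential_def)
  also have "\<dots> = (\<Sum>\<alpha>\<in>J. scl (of_int (int (h \<alpha>) - int M)) (c \<alpha>))"
  proof (rule sum.mono_neutral_cong_right [OF fin])
    fix \<alpha> assume \<alpha>: "\<alpha> \<in> J"
    have "int (h \<alpha>) - int M = int (\<alpha> PlusOne PlusOne) - int (\<alpha> MinusOne MinusOne)"
      using M [OF \<alpha>] by (simp add: h_def)
    then have "of_int (int (h \<alpha>) - int M) = (of_nat (\<alpha> PlusOne PlusOne) - of_nat (\<alpha> MinusOne MinusOne) :: 'k)"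
      by (simp only: of_int_diff of_int_of_nat_eq)
    with \<alpha> show "scl (diff_monomial \<alpha> (F_mat PlusOne PlusOne)) (c \<alpha>) = scl (of_int (int (h \<alpha>) - int M)) (c \<alpha>)"
      by (simp add: J_def diff_monomial_F)
  qed (auto simp: J_def diff_monomial_F)
  also have "\<dots> = (\<Sum>e\<le>(\<Sum>\<alpha>\<in>J. h \<alpha>) + a. \<Sum>\<alpha>\<in>{\<alpha>\<in>J. h \<alpha> = e}. scl (of_int (int (h \<alpha>) - int M)) (c \<alpha>))"
    by (rule sum.group [symmetric]) (use finJ bound in auto)
  also have "\<dots> = (\<Sum>e\<le>(\<Sum>\<alpha>\<in>J. h \<alpha>) + a. scl (of_int (int e - int M)) (\<Sum>\<alpha>\<in>{\<alpha>\<in>J. h \<alpha> = e}. c \<alpha>))"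
    by (simp add: scale_sum_right)
  also have "\<dots> = (\<Sum>e\<le>(\<Sum>\<alpha>\<in>J. h \<alpha>) + a. if e = a then scl (of_int (int e - int M)) x else 0)"
    unfolding coef by (intro sum.cong refl) auto
  also have "\<dots> = scl (of_int l) x"
    using a by simp
  finally show ?thesis .
qed

text \<open>The weight vectors are the coefficients of the orbit of \<open>\<xi>\<close> under the
  unipotent subgroup opposite to the one fixing it. Their span contains the whole orbit of
  \<open>\<xi>\<close>, hence W by simplicity.\<close>

theorem weight_basis:
  "\<exists>x. (\<forall>k\<le>nat (- m). x k \<in> W \<and> \<tau> PlusOne PlusOne (x k) = scl (of_int (m + 2 * int k)) (x k)) \<and>
    W \<subseteq> span (x ` {..nat (- m)})"
proof -
  define n where "n = nat (- m)"
  obtain N x where x: "\<And>k. k \<le> N \<Longrightarrow> x k \<in> W"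
    and lo: "\<And>s. \<pi> (mat2 1 0 s 1) \<xi> = (\<Sum>k\<le>N. scl (s ^ k) (x k))"
    using orbit_curve(2) [OF \<xi>(1)] by blast
  have Sp2: "mat2 1 0 s 1 \<in> Sp2" "mat2 1 s 0 1 \<in> Sp2" "mat2 0 (- 1) 1 0 \<in> Sp2" for s :: 'k
    by (simp_all add: mat2_Sp2)
  have torus: "torus_elt t \<in> Sp2" if "t \<noteq> 0" for t :: 'k
    using that by (simp add: torus_elt_mat2 mat2_Sp2)
  have weight: "\<pi> (torus_elt t) (x k) = scl (t powi (m + 2 * int k)) (x k)" if t: "t \<noteq> 0" and k: "k \<le> N" for t k
  proof -
    have "(\<Sum>i\<in>{i\<in>{..N}. i = k}. \<pi> (torus_elt t) (x i) - scl (t powi m * t ^ (2 * i)) (x i)) \<in> {0}"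
    proof (rule polynomial_coefficients_in_subspace [OF _ _ infinite_nonzero])
      fix s :: 'k
      \<comment> \<open>Moving the torus element across scales s by t^2, which accounts for the step
        2k in the weights.\<close>
      have "torus_elt t ** mat2 1 0 s 1 = mat2 1 0 (t\<^sup>2 * s) 1 ** torus_elt t"
        using t by (simp add: torus_elt_mat2 mat2_mult power2_eq_square field_simps)
      then have "\<pi> (torus_elt t) (\<pi> (mat2 1 0 s 1) \<xi>) = \<pi> (mat2 1 0 (t\<^sup>2 * s) 1) (\<pi> (torus_elt t) \<xi>)"
        using \<pi>_mult torus [OF t] Sp2 \<xi> by metis
      also have "\<dots> = scl (t powi m) (\<pi> (mat2 1 0 (t\<^sup>2 * s) 1) \<xi>)"
        using t by (simp add: torus_\<xi> \<pi>_scale Sp2 \<xi>)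
      finally have "(\<Sum>i\<le>N. scl (s ^ i) (\<pi> (torus_elt t) (x i))) = (\<Sum>i\<le>N. scl (t powi m * (t\<^sup>2 * s) ^ i) (x i))"
        unfolding lo using \<pi>_sum [OF torus [OF t], of "{..N}" x] x by (simp add: scale_sum_right)
      also have "\<dots> = (\<Sum>i\<le>N. scl (s ^ i) (scl (t powi m * t ^ (2 * i)) (x i)))"
        by (simp only: power_mult power_mult_distrib scale_scale) (simp only: mult_ac)
      finally show "(\<Sum>i\<le>N. scl (s ^ i) (\<pi> (torus_elt t) (x i) - scl (t powi m * t ^ (2 * i)) (x i))) \<in> {0}"
        by (simp add: scale_right_diff_distrib sum_subtractf)
    qed auto
    moreover have "{i\<in>{..N}. i = k} = {k}" using k by auto
    moreover have "t powi (m + 2 * int k) = t powi m * t ^ (2 * k)"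
      using t by (metis power_int_add power_int_of_nat of_nat_mult of_nat_numeral)
    ultimately show ?thesis by simp
  qed
  \<comment> \<open>By a factorisation through the Weyl element the curve is also s^n times a
    polynomial in 1/s, so powers above s^n cannot occur.\<close>
  have high: "x k = 0" if k: "k \<le> N" "n < k" for k
  proof -
    define y0 where "y0 = \<pi> (mat2 0 (- 1) 1 0) \<xi>"
    have y0: "y0 \<in> W" by (simp add: y0_def \<pi>_closed Sp2 \<xi>)
    obtain N' y where up: "\<And>s. \<pi> (mat2 1 s 0 1) y0 = (\<Sum>k\<le>N'. scl (s ^ k) (y k))"
      using orbit_curve(1) [OF y0] by blast
    \<comment> \<open>Multiplied by s^N', both expressions are polynomials in s; for k > n the
      exponent N' + k does not occur in the second.\<close>
    define e where "e = case_sum (\<lambda>k. N' + k) (\<lambda>k. n + (N' - k))"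
    define v where "v = case_sum x (\<lambda>k. - y k)"
    have "(\<Sum>i\<in>{i\<in>{..N} <+> {..N'}. e i = N' + k}. v i) \<in> {0}"
    proof (rule polynomial_coefficients_in_subspace [OF _ _ infinite_nonzero])
      fix s :: 'k assume "s \<in> UNIV - {0}"
      then have s: "s \<noteq> 0" by simp
      have g: "mat2 1 0 s 1 = mat2 1 (inverse s) 0 1 ** (mat2 0 (- 1) 1 0 ** (torus_elt (inverse s) ** unip_elt (inverse s)))"
        using s by (simp add: torus_elt_mat2 unip_elt_mat2 mat2_mult)
      have t: "torus_elt (inverse s) \<in> Sp2" "unip_elt (inverse s) \<in> Sp2"
        "torus_elt (inverse s) ** unip_elt (inverse s) \<in> Sp2"
        "mat2 0 (- 1) 1 0 ** (torus_elt (inverse s) ** unip_elt (inverse s)) \<in> Sp2"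
        using s by (simp_all add: torus unip_elt_mat2 torus_elt_mat2 mat2_mult mat2_Sp2)
      have "inverse s powi m = s ^ n"
        using m s by (simp add: n_def power_int_def)
      then have "\<pi> (mat2 1 0 s 1) \<xi> = scl (s ^ n) (\<pi> (mat2 1 (inverse s) 0 1) y0)"
        unfolding g y0_def using s t \<xi>
        by (simp add: \<pi>_mult Sp2 unip_\<xi> torus_\<xi> \<pi>_scale \<pi>_closed)
      then have "scl (s ^ N') (\<Sum>k\<le>N. scl (s ^ k) (x k)) = scl (s ^ N') (scl (s ^ n) (\<Sum>k\<le>N'. scl (inverse s ^ k) (y k)))"
        unfolding lo up by simp
      moreover have "s ^ N' * (s ^ n * inverse s ^ k) = s ^ (n + (N' - k))" if "k \<le> N'" for k
      proof -
        have "s ^ N' = s ^ (N' - k) * s ^ k" using that by (simp flip: power_add)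
        then show ?thesis using s by (simp add: power_add field_simps)
      qed
      ultimately have "(\<Sum>k\<le>N. scl (s ^ (N' + k)) (x k)) = (\<Sum>k\<le>N'. scl (s ^ (n + (N' - k))) (y k))"
        by (simp add: scale_sum_right power_add)
      then show "(\<Sum>i\<in>{..N} <+> {..N'}. scl (s ^ e i) (v i)) \<in> {0}"
        by (simp add: sum.Plus e_def v_def sum_negf)
    qed auto
    moreover have "{i\<in>{..N} <+> {..N'}. e i = N' + k} = {Inl k}"
      using k by (auto simp: e_def)
    ultimately show ?thesis by (simp add: v_def)
  qed
  define X where "X = span (x ` {..N})"
  have X: "subspace X" by (simp add: X_def)
  have orbit: "\<pi> g \<xi> \<in> X" if g: "g \<in> Sp2" for g
  proof -
    \<comment> \<open>On the big cell p is nonzero, and g is an opposite unipotent times a torus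
      element times a unipotent; the last two only rescale \<open>\<xi>\<close>.\<close>
    have big: "\<pi> (mat2 p q r s) \<xi> \<in> X" if "p \<noteq> 0" "p * s - q * r = 1" for p q r s
    proof -
      have g: "mat2 p q r s = mat2 1 0 (r / p) 1 ** (torus_elt (inverse p) ** unip_elt (q / p))"
      proof -
        have sd: "s = (1 + q * r) / p"
          using that by (simp add: field_simps)
        show ?thesis
          by (subst sd) (use that(1) in \<open>simp add: torus_elt_mat2 unip_elt_mat2 mat2_mult field_simps\<close>)
      qed
      have "torus_elt (inverse p) \<in> Sp2" "unip_elt (q / p) \<in> Sp2" "torus_elt (inverse p) ** unip_elt (q / p) \<in> Sp2"
        using that by (simp_all add: unip_elt_mat2 torus_elt_mat2 mat2_mult mat2_Sp2)
      then have "\<pi> (mat2 p q r s) \<xi> = scl (inverse p powi m) (\<pi> (mat2 1 0 (r / p) 1) \<xi>)"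
        unfolding g using that \<xi> by (simp add: \<pi>_mult Sp2 unip_\<xi> torus_\<xi> \<pi>_scale \<pi>_closed)
      also have "\<dots> \<in> X"
        unfolding lo X_def by (intro span_scale span_sum) (auto intro: span_base)
      finally show ?thesis .
    qed
    obtain p q r s where pqrs: "g = mat2 p q r s" by (rule mat2_cases)
    then have det: "p * s - q * r = 1" using g by (simp add: mat2_Sp2)
    show ?thesis
    proof (cases "p = 0")
      case True
      then have r: "r \<noteq> 0" using det by auto
      have gW: "\<pi> g \<xi> \<in> W" using g \<xi> by (simp add: \<pi>_closed)
      obtain N' y where up: "\<And>s. \<pi> (mat2 1 s 0 1) (\<pi> g \<xi>) = (\<Sum>k\<le>N'. scl (s ^ k) (y k))"
        using orbit_curve(1) [OF gW] by blast
      \<comment> \<open>A translate by a nonzero u lies in the big cell, and the constant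
        coefficient of the resulting polynomial curve is its value at u = 0.\<close>
      have "(\<Sum>i\<in>{i\<in>{..N'}. i = 0}. y i) \<in> X"
      proof (rule polynomial_coefficients_in_subspace [OF X _ infinite_nonzero])
        fix u :: 'k assume u: "u \<in> UNIV - {0}"
        have "\<pi> (mat2 1 u 0 1) (\<pi> g \<xi>) = \<pi> (mat2 (u * r) (q + u * s) r s) \<xi>"
          using \<pi>_mult [OF Sp2(2) g \<xi>(1), of u] True by (simp add: pqrs mat2_mult)
        also have "\<dots> \<in> X"
          by (rule big) (use u r det True in \<open>auto simp: algebra_simps\<close>)
        finally show "(\<Sum>i\<le>N'. scl (u ^ i) (y i)) \<in> X"
          unfolding up .
      qed auto
      moreover have "{i\<in>{..N'}. i = 0} = {0}" by auto
      moreover have "y 0 = \<pi> g \<xi>"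
        using up [of 0] \<pi>_one [OF gW] by (simp add: power_0_left if_distrib [of "\<lambda>c. scl c _"] cong: if_cong)
      ultimately show ?thesis by simp
    qed (use big det pqrs in auto)
  qed
  \<comment> \<open>The vectors whose whole orbit stays in \<open>X\<close>: a subrepresentation
    that contains \<open>\<xi>\<close>.\<close>
  define U where "U = {v\<in>W. \<forall>g\<in>Sp2. \<pi> g v \<in> X}"
  have "subspace U"
  proof (rule subspaceI)
    have "\<pi> g 0 = 0" if "g \<in> Sp2" for g
      using \<pi>_scale [OF that \<xi>(1), of 0] by simp
    then show "0 \<in> U"
      using W X by (simp add: U_def subspace_0)
    show "x + y \<in> U" if "x \<in> U" "y \<in> U" for x y
      using that W X by (simp add: U_def subspace_add \<pi>_add)
    show "scl c x \<in> U" if "x \<in> U" for c x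
      using that W X by (simp add: U_def subspace_scale \<pi>_scale)
  qed
  moreover have "\<pi> g v \<in> U" if g: "g \<in> Sp2" and v: "v \<in> U" for g v
  proof -
    have "h ** g \<in> Sp2" if "h \<in> Sp2" for h
    proof -
      obtain p q r s where g': "g = mat2 p q r s" by (rule mat2_cases)
      obtain p' q' r' s' where h': "h = mat2 p' q' r' s'" by (rule mat2_cases)
      have 1: "p * s - q * r = 1" "p' * s' - q' * r' = 1"
        using g that by (simp_all add: g' h' mat2_Sp2)
      have "(p' * p + q' * r) * (r' * q + s' * s) - (p' * q + q' * s) * (r' * p + s' * r)
          = (p' * s' - q' * r') * (p * s - q * r)"
        by (simp add: algebra_simps)
      with 1 show ?thesis by (simp add: g' h' mat2_mult mat2_Sp2)
    qed
    then show ?thesis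
      using g v by (auto simp: U_def \<pi>_closed \<pi>_mult [symmetric])
  qed
  moreover have "U \<subseteq> W" by (auto simp: U_def)
  moreover have "\<xi> \<in> U" using \<xi> orbit by (simp add: U_def)
  ultimately have "U = W"
    using simple \<xi> by (auto simp: Sp2_simple_def image_subset_iff)
  have WX: "W \<subseteq> X"
  proof
    fix w assume w: "w \<in> W"
    then have "\<pi> (mat2 1 0 0 1) w \<in> X"
      using \<open>U = W\<close> Sp2(2) [of 0] by (auto simp: U_def)
    then show "w \<in> X" by (simp add: \<pi>_one w)
  qed
  \<comment> \<open>Padding by 0 provides vectors for all k up to n, also when n exceeds N.\<close>
  define x' where "x' k = (if k \<le> N then x k else 0)" for k
  have "x ` {..N} \<subseteq> insert 0 (x' ` {..n})"
  proof safe
    fix k assume k: "k \<le> N" "x k \<notin> x' ` {..n}"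
    show "x k = 0"
    proof (rule high [OF k(1)], rule ccontr)
      assume "\<not> n < k"
      then have "x' k \<in> x' ` {..n}" by simp
      with k show False by (simp add: x'_def)
    qed
  qed
  then have "span (x ` {..N}) \<subseteq> span (x' ` {..n})"
    by (metis span_insert_0 span_mono)
  with WX have "W \<subseteq> span (x' ` {..n})" by (auto simp: X_def)
  moreover have "x' k \<in> W \<and> \<tau> PlusOne PlusOne (x' k) = scl (of_int (m + 2 * int k)) (x' k)" for k
  proof (cases "k \<le> N")
    case True
    then show ?thesis
      using x weight torus_weight_differential [of "x k" "m + 2 * int k"] by (simp add: x'_def)
  next
    case False
    \<comment> \<open>\<open>\<tau>\<close> is known only through orbit maps, so even its value at 0
      is taken from the weight lemma, with weight 0.\<close>
    have "\<tau> PlusOne PlusOne 0 = scl (of_int 0) 0"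
      by (rule torus_weight_differential) (use W \<pi>_scale [OF torus \<xi>(1), of _ 0] in \<open>auto simp: subspace_0\<close>)
    with False W show ?thesis by (simp add: x'_def subspace_0)
  qed
  ultimately show ?thesis unfolding n_def by blast
qed

end

section \<open>Eigenvectors in finite dimension\<close>

definition poly_app :: "('a::field \<Rightarrow> 'b \<Rightarrow> 'b::ab_group_add) \<Rightarrow> ('b \<Rightarrow> 'b) \<Rightarrow> 'a poly \<Rightarrow> 'b \<Rightarrow> 'b" where
  "poly_app s T p v = (\<Sum>i\<le>degree p. s (coeff p i) ((T ^^ i) v))"

context vector_space
begin

lemma poly_app_altdef:
  fixes p :: "'a poly"
  assumes "degree p \<le> N"
  shows "poly_app scale T p v = (\<Sum>i\<le>N. scale (coeff p i) ((T ^^ i) v))"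
  unfolding poly_app_def
  by (rule sum.mono_neutral_left) (use assms in \<open>auto simp: coeff_eq_0\<close>)

lemma poly_app_linear_factor:
  assumes "Vector_Spaces.linear scale scale T"
  shows "poly_app scale T ([:- a, 1:] * q) v = T (poly_app scale T q v) - scale a (poly_app scale T q v)"
proof -
  interpret T: Vector_Spaces.linear scale scale T by fact
  define N where "N = Suc (degree q)"
  have deg: "degree ([:- a, 1:] * q) \<le> N"
    using degree_mult_le [of "[:- a, 1:]" q] by (simp add: N_def)
  have coef: "coeff ([:- a, 1:] * q) i = (case i of 0 \<Rightarrow> 0 | Suc k \<Rightarrow> coeff q k) - a * coeff q i" for i
    by (simp add: coeff_pCons split: nat.split)
  have "poly_app scale T ([:- a, 1:] * q) v
      = (\<Sum>i\<le>N. scale (case i of 0 \<Rightarrow> 0 | Suc k \<Rightarrow> coeff q k) ((T ^^ i) v)) - (\<Sum>i\<le>N. scale (a * coeff q i) ((T ^^ i) v))"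
    unfolding poly_app_altdef [OF deg] coef by (simp add: scale_left_diff_distrib sum_subtractf)
  also have "(\<Sum>i\<le>N. scale (case i of 0 \<Rightarrow> 0 | Suc k \<Rightarrow> coeff q k) ((T ^^ i) v)) = T (poly_app scale T q v)"
    unfolding N_def sum.atMost_Suc_shift by (simp add: poly_app_def T.sum T.scale)
  also have "(\<Sum>i\<le>N. scale (a * coeff q i) ((T ^^ i) v)) = scale a (poly_app scale T q v)"
    by (subst poly_app_altdef [of q N]) (simp_all add: N_def scale_sum_right scale_right_distrib)
  finally show ?thesis .
qed

lemma span_image_lessThan:
  fixes f :: "nat \<Rightarrow> 'b"
  assumes "x \<in> span (f ` {..<d})"
  shows "\<exists>c. x = (\<Sum>i<d. scale (c i) (f i))"
  using assms
proof (induction d arbitrary: x)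
  case (Suc d)
  have "f ` {..<Suc d} = insert (f d) (f ` {..<d})" by (auto simp: lessThan_Suc)
  with Suc.prems obtain k where "x - scale k (f d) \<in> span (f ` {..<d})"
    by (auto simp: span_insert)
  then obtain c where c: "x - scale k (f d) = (\<Sum>i<d. scale (c i) (f i))"
    using Suc.IH by blast
  have "x = (\<Sum>i<Suc d. scale ((c(d := k)) i) (f i))"
    using c by (simp add: algebra_simps)
  then show ?case by blast
qed simp

end

text \<open>Linear factors x - a are split off until q(T) v is nonzero while (T - a) q(T) v = 0.
  Existence of roots is a hypothesis because the scalars of the locale are merely a field.\<close>

lemma (in vector_space) poly_app_eigenvector:
  fixes p :: "'a poly"
  assumes closed: "\<And>p :: 'a poly. degree p > 0 \<Longrightarrow> \<exists>z. poly p z = 0"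
    and T: "Vector_Spaces.linear scale scale T" and U: "subspace U" "T ` U \<subseteq> U"
    and "p \<noteq> 0" "v \<in> U" "v \<noteq> 0" "poly_app scale T p v = 0"
  shows "\<exists>w\<in>U. w \<noteq> 0 \<and> (\<exists>c. T w = scale c w)"
  using assms(5-)
proof (induction "degree p" arbitrary: p)
  case 0
  then have "poly_app scale T p v = scale (coeff p 0) v" by (simp add: poly_app_def)
  with 0 have "coeff p 0 = 0" by simp
  with 0 show ?case by (metis leading_coeff_0_iff)
next
  case (Suc n)
  obtain a where "poly p a = 0" using closed [of p] Suc.hyps(2) by auto
  then obtain q where q: "p = [:- a, 1:] * q"
    by (metis dvdE poly_eq_0_iff_dvd)
  have "q \<noteq> 0" using Suc.prems q by auto
  then have deg: "n = degree q"
    using Suc.hyps(2) unfolding q by (subst (asm) degree_mult_eq) auto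
  have memU: "(T ^^ i) v \<in> U" for i
    using U(2) Suc.prems(2) by (induction i) auto
  show ?case
  proof (cases "poly_app scale T q v = 0")
    case True
    then show ?thesis using Suc.hyps(1) [OF deg \<open>q \<noteq> 0\<close>] Suc.prems by blast
  next
    case False
    have "poly_app scale T q v \<in> U"
      unfolding poly_app_def using U memU by (intro subspace_sum subspace_scale) auto
    moreover have "T (poly_app scale T q v) = scale a (poly_app scale T q v)"
      using poly_app_linear_factor [OF T, of a q v] Suc.prems(4) q by simp
    ultimately show ?thesis using False by blast
  qed
qed

context finite_dimensional_vector_space
begin

text \<open>Otherwise any number of iterates of v would be independent, against finite
  dimension.\<close>

lemma exists_annihilating_poly:
  "\<exists>p. p \<noteq> 0 \<and> poly_app scale T p v = 0"
proof -
  have "\<exists>d. (T ^^ d) v \<in> span ((\<lambda>i. (T ^^ i) v) ` {..<d})"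
  proof (rule ccontr)
    assume neg: "\<not> ?thesis"
    have "independent ((\<lambda>i. (T ^^ i) v) ` {..<d}) \<and> card ((\<lambda>i. (T ^^ i) v) ` {..<d}) = d" for d
    proof (induction d)
      case (Suc d)
      let ?S = "(\<lambda>i. (T ^^ i) v) ` {..<d}"
      have ins: "(\<lambda>i. (T ^^ i) v) ` {..<Suc d} = insert ((T ^^ d) v) ?S"
        by (simp add: lessThan_Suc)
      have span: "(T ^^ d) v \<notin> span ?S"
        using neg by simp
      then have "(T ^^ d) v \<notin> ?S"
        using span_base [of "(T ^^ d) v" ?S] by argo
      then show ?case
        unfolding ins using Suc span by (simp add: independent_insert)
    qed (simp add: independent_empty)
    from this [of "Suc (card Basis)"] show False
      using independent_span_bound [OF finite_Basis, of "(\<lambda>i. (T ^^ i) v) ` {..<Suc (card Basis)}"]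
      by (simp add: span_Basis)
  qed
  then obtain d where "(T ^^ d) v \<in> span ((\<lambda>i. (T ^^ i) v) ` {..<d})" ..
  from span_image_lessThan [OF this] obtain c where d: "(T ^^ d) v = (\<Sum>i<d. scale (c i) ((T ^^ i) v))" ..
  define p where "p = monom 1 d - (\<Sum>i<d. monom (c i) i)"
  have coef: "coeff p i = (if i = d then 1 else if i < d then - c i else 0)" for i
    by (auto simp: p_def coeff_sum)
  have "degree p \<le> d" by (rule degree_le) (simp add: coef)
  then have "poly_app scale T p v = (\<Sum>i\<le>d. scale (coeff p i) ((T ^^ i) v))"
    by (rule poly_app_altdef)
  also have "\<dots> = 0"
    by (simp add: lessThan_Suc_atMost [symmetric] coef d scale_minus_left sum_negf)
  finally have "poly_app scale T p v = 0" .
  moreover have "p \<noteq> 0" using coef [of d] by auto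
  ultimately show ?thesis by blast
qed

text \<open>In a nonzero invariant subspace of least dimension, an eigenspace of one T_r is
  invariant under all the others and hence everything. The argument handles infinitely many
  operators at once.\<close>

lemma exists_common_eigenvector:
  fixes T :: "'i \<Rightarrow> 'b \<Rightarrow> 'b"
  assumes closed: "\<And>p :: 'a poly. degree p > 0 \<Longrightarrow> \<exists>z. poly p z = 0"
    and T: "\<And>r. Vector_Spaces.linear scale scale (T r)"
    and S: "subspace S" "S \<noteq> {0}" "\<And>r. T r ` S \<subseteq> S"
    and comm: "\<And>q r v. v \<in> S \<Longrightarrow> T q (T r v) = T r (T q v)"
  shows "\<exists>v\<in>S. v \<noteq> 0 \<and> (\<forall>r. \<exists>c. T r v = scale c v)"
proof -
  define good where "good U \<longleftrightarrow> subspace U \<and> U \<subseteq> S \<and> U \<noteq> {0} \<and> (\<forall>r. T r ` U \<subseteq> U)" for U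
  have "good S" using S by (simp add: good_def)
  then obtain U where U: "good U" and min: "\<And>U'. good U' \<Longrightarrow> dim U \<le> dim U'"
    using ex_has_least_nat [of good S dim] by blast
  have sU: "subspace U" "U \<subseteq> S" "\<And>r. T r ` U \<subseteq> U" using U by (auto simp: good_def)
  obtain v where v: "v \<in> U" "v \<noteq> 0"
    using U subspace_0 [OF sU(1)] by (auto simp: good_def)
  have "\<exists>c. \<forall>w\<in>U. T r w = scale c w" for r
  proof -
    interpret Tr: Vector_Spaces.linear scale scale "T r" by (rule T)
    obtain p where "p \<noteq> 0" "poly_app scale (T r) p v = 0"
      using exists_annihilating_poly by blast
    then have "\<exists>w\<in>U. w \<noteq> 0 \<and> (\<exists>c. T r w = scale c w)"
      using poly_app_eigenvector [OF closed T sU(1,3) _ v] by simp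
    then obtain w c where w: "w \<in> U" "w \<noteq> 0" "T r w = scale c w" by blast
    define U' where "U' = {x\<in>U. T r x = scale c x}"
    have "subspace U'"
      unfolding U'_def using sU(1)
      by (auto intro!: subspaceI simp: subspace_0 subspace_add subspace_scale Tr.zero Tr.add Tr.scale scale_right_distrib mult.commute)
    moreover have "T q x \<in> U'" if x: "x \<in> U'" for q x
    proof -
      interpret Tq: Vector_Spaces.linear scale scale "T q" by (rule T)
      have "T r (T q x) = T q (T r x)" using x sU by (intro comm) (auto simp: U'_def)
      with x sU show ?thesis by (auto simp: U'_def Tq.scale)
    qed
    moreover have "U' \<noteq> {0}" using w by (auto simp: U'_def)
    ultimately have "good U'" using sU by (auto simp: good_def U'_def)
    then have "dim U \<le> dim U'" by (rule min)
    then have "U' = U"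
      using subspace_dim_equal [of U' U] \<open>subspace U'\<close> sU by (auto simp: U'_def)
    then show ?thesis by (auto simp: U'_def)
  qed
  with v sU show ?thesis by blast
qed

text \<open>For l outside \<open>J\<close> the map T - l hits every member of the spanning set, so
  it is surjective and, in finite dimension, injective.\<close>

lemma eigenvalue_mem:
  assumes T: "Vector_Spaces.linear scale scale T"
    and span: "span B = UNIV" "\<And>b. b \<in> B \<Longrightarrow> \<exists>j\<in>J. T b = scale j b"
    and v: "v \<noteq> 0" "T v = scale l v"
  shows "l \<in> J"
proof (rule ccontr)
  assume l: "l \<notin> J"
  interpret T: Vector_Spaces.linear scale scale T by fact
  define D where "D x = T x - scale l x" for x
  have D: "Vector_Spaces.linear scale scale D"
    by unfold_locales (simp_all add: D_def T.add T.scale algebra_simps)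
  interpret D: Vector_Spaces.linear scale scale D by fact
  have "B \<subseteq> range D"
  proof
    fix b assume "b \<in> B"
    then obtain j where j: "j \<in> J" "T b = scale j b" using span(2) by blast
    moreover have "j - l \<noteq> 0" using j l by auto
    ultimately have "D (scale (inverse (j - l)) b) = b"
      unfolding D.scale unfolding D_def by (simp flip: scale_left_diff_distrib)
    then show "b \<in> range D" by (metis rangeI)
  qed
  then have "span B \<subseteq> range D"
    by (rule span_minimal) (rule D.subspace_image, rule subspace_UNIV)
  then have "surj D" using span(1) by auto
  then have "inj D" using linear_surj_imp_inj [OF D] by simp
  moreover have "D v = D 0" using v by (simp add: D_def T.zero)
  ultimately show False using v(1) by (metis injD)
qed

end

section \<open>The main theorem\<close>

context
  fixes scl :: "'k::field \<Rightarrow> 'v \<Rightarrow> 'v::ab_group_add" and scl' :: "'k \<Rightarrow> 'w \<Rightarrow> 'w::ab_group_add"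
    and \<tau> :: "idx \<Rightarrow> idx \<Rightarrow> 'v \<Rightarrow> 'v" and W :: "nat \<Rightarrow> 'w set" and \<sigma> and I :: "nat set" and a b :: idx
  assumes V: "vector_space scl" and W': "vector_space scl'"
    and iso: "iso_direct_sum scl \<tau> scl' W \<sigma> I"
    and I: "finite I" and W: "\<And>i. i \<in> I \<Longrightarrow> module.subspace scl' (W i)"
    and \<tau>_zero: "\<tau> a b 0 = 0"
begin

interpretation V: vector_space scl by (rule V)
interpretation W': vector_space scl' by (rule W')

text \<open>\<open>\<Psi> i\<close> is the inverse isomorphism restricted to the i-th summand. On
  the other components, which are 0, the action is controlled by \<open>\<tau>_zero\<close>.\<close>

lemma direct_summand_embedding:
  obtains \<Psi> :: "nat \<Rightarrow> 'w \<Rightarrow> 'v" where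
    "\<And>v. \<exists>w. (\<forall>i\<in>I. w i \<in> W i) \<and> v = (\<Sum>i\<in>I. \<Psi> i (w i))"
    "\<And>i x y. i \<in> I \<Longrightarrow> x \<in> W i \<Longrightarrow> y \<in> W i \<Longrightarrow> \<Psi> i (x + y) = \<Psi> i x + \<Psi> i y"
    "\<And>i x c. i \<in> I \<Longrightarrow> x \<in> W i \<Longrightarrow> \<Psi> i (scl' c x) = scl c (\<Psi> i x)"
    "\<And>i x. i \<in> I \<Longrightarrow> x \<in> W i \<Longrightarrow> \<Psi> i x = 0 \<Longrightarrow> x = 0"
    "\<And>i x c. i \<in> I \<Longrightarrow> x \<in> W i \<Longrightarrow> \<sigma> i a b x = scl' c x \<Longrightarrow> \<tau> a b (\<Psi> i x) = scl c (\<Psi> i x)"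
proof -
  obtain \<Phi> where bij: "bij_betw \<Phi> UNIV (\<Pi>\<^sub>E i\<in>I. W i)"
    and add: "\<And>i v w. i \<in> I \<Longrightarrow> \<Phi> (v + w) i = \<Phi> v i + \<Phi> w i"
    and scale: "\<And>i c v. i \<in> I \<Longrightarrow> \<Phi> (scl c v) i = scl' c (\<Phi> v i)"
    and act: "\<And>i v. i \<in> I \<Longrightarrow> \<Phi> (\<tau> a b v) i = \<sigma> i a b (\<Phi> v i)"
    using iso unfolding iso_direct_sum_def by metis
  have mem: "\<Phi> v \<in> (\<Pi>\<^sub>E i\<in>I. W i)" for v
    using bij by (auto simp: bij_betw_def)
  have eqI: "v = w" if "\<And>i. i \<in> I \<Longrightarrow> \<Phi> v i = \<Phi> w i" for v w
  proof -
    have "\<Phi> v = \<Phi> w" by (rule PiE_ext [OF mem mem that])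
    then show ?thesis using bij by (auto simp: bij_betw_def inj_def)
  qed
  have zero: "\<Phi> 0 i = 0" if "i \<in> I" for i
    using scale [OF that, of 0 0] by simp
  have sum: "\<Phi> (sum f J) i = (\<Sum>j\<in>J. \<Phi> (f j) i)" if "i \<in> I" for f and J :: "nat set" and i
    by (induction J rule: infinite_finite_induct) (simp_all add: zero add that)
  define \<Psi> where "\<Psi> i x = inv_into UNIV \<Phi> (\<lambda>j\<in>I. if j = i then x else 0)" for i x
  have \<Psi>: "\<Phi> (\<Psi> i x) j = (if j = i then x else 0)" if "i \<in> I" "j \<in> I" "x \<in> W i" for i j x
  proof -
    have "(\<lambda>j\<in>I. if j = i then x else 0) \<in> \<Phi> ` UNIV"
      using bij that W W'.subspace_0 by (auto simp: bij_betw_def)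
    then have "\<Phi> (\<Psi> i x) = (\<lambda>j\<in>I. if j = i then x else 0)"
      unfolding \<Psi>_def by (rule f_inv_into_f)
    then show ?thesis using that by simp
  qed
  have \<sigma>0: "\<sigma> i a b 0 = 0" if "i \<in> I" for i
    using act [OF that, of 0] by (simp add: \<tau>_zero zero that)
  have W_add: "x + y \<in> W i" and W_scale: "scl' c x \<in> W i" if "i \<in> I" "x \<in> W i" "y \<in> W i" for i x y c
    using that W by (auto intro: W'.subspace_add W'.subspace_scale)
  have 1: "\<exists>w. (\<forall>i\<in>I. w i \<in> W i) \<and> v = (\<Sum>i\<in>I. \<Psi> i (w i))" for v
  proof (intro exI conjI)
    show in_W: "\<forall>i\<in>I. \<Phi> v i \<in> W i" using mem [of v] by (auto simp: PiE_def)
    show "v = (\<Sum>i\<in>I. \<Psi> i (\<Phi> v i))"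
      by (rule eqI) (use in_W I in \<open>simp add: sum \<Psi>\<close>)
  qed
  have 2: "\<Psi> i (x + y) = \<Psi> i x + \<Psi> i y" if "i \<in> I" "x \<in> W i" "y \<in> W i" for i x y
    by (rule eqI) (use that in \<open>simp add: \<Psi> add W_add\<close>)
  have 3: "\<Psi> i (scl' c x) = scl c (\<Psi> i x)" if "i \<in> I" "x \<in> W i" for i x c
    by (rule eqI) (use that in \<open>simp add: \<Psi> scale W_scale\<close>)
  have 4: "x = 0" if "i \<in> I" "x \<in> W i" "\<Psi> i x = 0" for i x
    using \<Psi> [of i i x] that zero by simp
  have 5: "\<tau> a b (\<Psi> i x) = scl c (\<Psi> i x)" if "i \<in> I" "x \<in> W i" "\<sigma> i a b x = scl' c x" for i x c
    by (rule eqI) (use that in \<open>simp add: \<Psi> scale act \<sigma>0\<close>)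
  show ?thesis
    by (rule that [OF 1 2 3 4 5])
qed

lemma direct_sum_spanned_by_eigenvectors:
  assumes X: "\<And>i. i \<in> I \<Longrightarrow> X i \<subseteq> W i" "\<And>i. i \<in> I \<Longrightarrow> W i \<subseteq> module.span scl' (X i)"
    and eig: "\<And>i x. i \<in> I \<Longrightarrow> x \<in> X i \<Longrightarrow> \<exists>c\<in>J. \<sigma> i a b x = scl' c x"
  shows "\<exists>B. module.span scl B = UNIV \<and> (\<forall>v\<in>B. \<exists>c\<in>J. \<tau> a b v = scl c v)"
proof -
  obtain \<Psi> where 1: "\<And>v. \<exists>w. (\<forall>i\<in>I. w i \<in> W i) \<and> v = (\<Sum>i\<in>I. \<Psi> i (w i))"
    and 2: "\<And>i x y. i \<in> I \<Longrightarrow> x \<in> W i \<Longrightarrow> y \<in> W i \<Longrightarrow> \<Psi> i (x + y) = \<Psi> i x + \<Psi> i y"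
    and 3: "\<And>i x c. i \<in> I \<Longrightarrow> x \<in> W i \<Longrightarrow> \<Psi> i (scl' c x) = scl c (\<Psi> i x)"
    and 4: "\<And>i x. i \<in> I \<Longrightarrow> x \<in> W i \<Longrightarrow> \<Psi> i x = 0 \<Longrightarrow> x = 0"
    and 5: "\<And>i x c. i \<in> I \<Longrightarrow> x \<in> W i \<Longrightarrow> \<sigma> i a b x = scl' c x \<Longrightarrow> \<tau> a b (\<Psi> i x) = scl c (\<Psi> i x)"
    by (rule direct_summand_embedding) (rule that)
  define B where "B = (\<Union>i\<in>I. \<Psi> i ` X i)"
  have "\<Psi> i w \<in> V.span B" if i: "i \<in> I" and w: "w \<in> W i" for i w
  proof -
    have "W'.subspace {w\<in>W i. \<Psi> i w \<in> V.span B}"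
    proof (rule W'.subspaceI)
      have "\<Psi> i 0 = 0"
        using 3 [OF i w, of 0] by simp
      then show "0 \<in> {w\<in>W i. \<Psi> i w \<in> V.span B}"
        using W [OF i] by (simp add: W'.subspace_0 V.span_zero)
    qed (use W [OF i] i in \<open>auto simp: 2 3 W'.subspace_add W'.subspace_scale V.span_add V.span_scale\<close>)
    moreover have "X i \<subseteq> {w\<in>W i. \<Psi> i w \<in> V.span B}"
      using X(1) [OF i] i by (auto simp: B_def intro!: V.span_base)
    ultimately have "W'.span (X i) \<subseteq> {w\<in>W i. \<Psi> i w \<in> V.span B}"
      by (rule W'.span_minimal [rotated])
    with w X(2) [OF i] show ?thesis by auto
  qed
  then have "v \<in> V.span B" for v
    using 1 [of v] by (auto intro!: V.span_sum)
  moreover have "\<exists>c\<in>J. \<tau> a b v = scl c v" if "v \<in> B" for v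
  proof -
    from that obtain i x where i: "i \<in> I" "x \<in> X i" "v = \<Psi> i x" by (auto simp: B_def)
    obtain c where "c \<in> J" "\<sigma> i a b x = scl' c x" using eig [OF i(1,2)] by blast
    moreover have "x \<in> W i" using X(1) [OF i(1)] i(2) by blast
    ultimately show ?thesis using 5 [OF i(1)] i(3) by blast
  qed
  ultimately show ?thesis by (intro exI [of _ B]) auto
qed

lemma direct_sum_eigenvector:
  assumes "i \<in> I" "x \<in> W i" "x \<noteq> 0" "\<sigma> i a b x = scl' c x"
  shows "\<exists>v. v \<noteq> 0 \<and> \<tau> a b v = scl c v"
proof (rule direct_summand_embedding)
  fix \<Psi> :: "nat \<Rightarrow> 'w \<Rightarrow> 'v"
  assume 4: "\<And>i x. i \<in> I \<Longrightarrow> x \<in> W i \<Longrightarrow> \<Psi> i x = 0 \<Longrightarrow> x = 0"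
    and 5: "\<And>i x c. i \<in> I \<Longrightarrow> x \<in> W i \<Longrightarrow> \<sigma> i a b x = scl' c x \<Longrightarrow> \<tau> a b (\<Psi> i x) = scl c (\<Psi> i x)"
  show ?thesis
    using 4 [OF assms(1,2)] 5 [OF assms(1,2,4)] assms(3) by blast
qed

end

section \<open>Singular vectors\<close>

context twisted_rep
begin

text \<open>On such a vector the right-hand side of \<open>DD\<close> vanishes, and the commutator
  is reduced to ones with smaller first index, as for c(u).\<close>

lemma D_commute_on_singular:
  assumes "\<And>r. app (B r) v = 0"
  shows "app (D m) (app (D n) v) = app (D n) (app (D m) v)"
proof (induction "nat m" arbitrary: m n rule: less_induct)
  case less
  have IH: "app (D m') (app (D n') v) = app (D n') (app (D m') v)" if "m' < m" for m' n'
  proof (cases "m' < 0")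
    case False
    with less [of m' n'] that show ?thesis by simp
  qed (simp add: op_neg)
  have "app (D (m - 2 + 2) * D n - D n * D (m - 2 + 2) - (D (m - 2) * D (n + 2) - D (n + 2) * D (m - 2))
      - (D (m - 2 + 1) * D n - D n * D (m - 2 + 1)) - (D (m - 2) * D (n + 1) - D (n + 1) * D (m - 2))) v = 0"
    unfolding DD by (simp add: assms)
  then show ?case
    using IH [of "m - 2" "n + 2"] IH [of "m - 1" n] IH [of "m - 2" "n + 1"] by simp
qed

text \<open>A linear functional with value 1 at \<open>\<xi>\<close>, followed by the multiples of
  \<open>\<xi>\<close>; it serves as \<open>P\<close> in \<open>twisted_hw\<close>.\<close>

lemma rank_one_endo:
  assumes "\<xi> \<noteq> 0"
  shows "\<exists>P. P \<noteq> 0 \<and> (\<forall>x. \<exists>c. app P x = scl c \<xi>)"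
proof -
  have "V.subspace {0}" by simp
  then obtain f where f: "Vector_Spaces.linear scl (*) f" "f \<xi> = 1"
    using V.exists_separating_functional [of "{0}" \<xi>] assms by blast
  interpret f: Vector_Spaces.linear scl "(*)" f by (rule f)
  define P where "P = Endo (\<lambda>w. scl (f w) \<xi>)"
  have P: "app P w = scl (f w) \<xi>" for w
    unfolding P_def by (subst Endo_inverse) (simp_all add: f.add V.scale_left_distrib)
  have "app P \<xi> = \<xi>" by (simp add: P f)
  then have "P \<noteq> 0" using assms by auto
  with P show ?thesis by blast
qed

end

theorem theorem3p21:
  fixes scl :: "'k::alg_closed_field \<Rightarrow> 'v \<Rightarrow> 'v::ab_group_add"
    and \<rho> :: "'k free_alg set \<Rightarrow> 'v \<Rightarrow> 'v"
    and scl' :: "'k \<Rightarrow> 'w \<Rightarrow> 'w::ab_group_add"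
    and W :: "nat \<Rightarrow> 'w set"
    and \<sigma> :: "nat \<Rightarrow> idx \<Rightarrow> idx \<Rightarrow> 'w \<Rightarrow> 'w"
    and k :: nat
    and m :: "nat \<Rightarrow> int"
  assumes "CHAR('k) \<noteq> 2"
    and "irreducible_rep scl \<rho>"
    and "fin_dim scl"
    and "vector_space scl'"
    and "\<And>i. i \<in> {1..k} \<Longrightarrow> m i \<le> 0"
    and "\<And>i. i \<in> {1..k} \<Longrightarrow> is_V scl' (W i) (\<sigma> i) (m i)"
    and "iso_direct_sum scl (\<lambda>a b. s_act \<rho> a b 1) scl' W \<sigma> {1..k}"
    and "CHAR('k) > 0 \<Longrightarrow> int CHAR('k) > 2 * Max ((\<lambda>i. - m i) ` {1..k}) + 2"
  shows "\<exists>\<mu> :: 'k fps. fps_nth \<mu> 0 = 1 \<and>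
           highest_weight_rep scl \<rho> \<mu> \<and> irreducible_rep scl \<rho> \<and>
           (\<exists>P :: 'k poly. lead_coeff P = 1 \<and> P = pcompose P [:1, - 1:] \<and>
              fps_to_fls (neg_u \<mu>) / fps_to_fls \<mu>
                = poly_in_u (pcompose P [:1, 1:]) / poly_in_u P)"
proof -
  have two: "(2::'k) \<noteq> 0"
  proof
    assume "(2::'k) = 0"
    then have "of_nat 2 = (0::'k)" by simp
    then have "CHAR('k) dvd 2" by (simp only: of_nat_eq_0_iff_char_dvd)
    then have "CHAR('k) \<le> 2" "0 < CHAR('k)"
      using dvd_imp_le dvd_pos_nat pos2 by blast+
    then have "CHAR('k) = 1 \<or> CHAR('k) = 2"
      by linarith
    with assms(1) show False by simp
  qed
  have irr: "yangian_rep scl \<rho>" "(UNIV :: 'v set) \<noteq> {0}"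
    "\<And>U. yangian_submodule scl \<rho> U \<Longrightarrow> U = {0} \<or> U = UNIV"
    using assms(2) by (auto simp: irreducible_rep_def)
  interpret twisted_rep scl \<rho>
    by unfold_locales (fact irr(1), fact two)
  interpret W': vector_space scl' by fact
  obtain S0 where S0: "finite S0" "V.span S0 = UNIV"
    using assms(3) by (auto simp: fin_dim_def)
  obtain Bs where Bs: "V.independent Bs" "UNIV \<subseteq> V.span Bs"
    by (rule V.basis_exists [of UNIV])
  have "finite Bs"
    using V.independent_span_bound [OF S0(1) Bs(1)] S0(2) by simp
  interpret FD: finite_dimensional_vector_space scl Bs
    by unfold_locales (use Bs \<open>finite Bs\<close> in auto)

  \<comment> \<open>An empty direct sum would be the zero space; a nonempty index set is also what
    gives \<open>Max\<close> its meaning.\<close>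
  have k: "1 \<le> k"
  proof (rule ccontr)
    assume "\<not> 1 \<le> k"
    then have "{1..k} = {}" by simp
    then obtain \<Phi> where \<Phi>: "bij_betw \<Phi> (UNIV :: 'v set) {\<lambda>i :: nat. undefined :: 'w}"
      using assms(7) by (auto simp: iso_direct_sum_def)
    then have "\<Phi> x = \<Phi> 0" for x
      using bij_betw_apply [OF \<Phi>, of x] bij_betw_apply [OF \<Phi>, of 0] by simp
    then have "x = 0" for x :: 'v
      using \<Phi> by (meson bij_betw_def injD)
    then show False using irr(2) by blast
  qed
  define n where "n = nat (Max ((\<lambda>i. - m i) ` {1..k}))"
  have ne: "(\<lambda>i. - m i) ` {1..k} \<noteq> {}" using k by simp
  have "Max ((\<lambda>i. - m i) ` {1..k}) \<in> (\<lambda>i. - m i) ` {1..k}"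
    by (rule Max_in [OF _ ne]) simp
  then obtain i0 where i0: "Max ((\<lambda>i. - m i) ` {1..k}) = - m i0" "i0 \<in> {1..k}"
    by (rule imageE)
  then have n: "int n = Max ((\<lambda>i. - m i) ` {1..k})" "int n = - m i0"
    using assms(5) [OF i0(2)] by (simp_all add: n_def i0(1))
  have mn: "- m i \<le> int n" if "i \<in> {1..k}" for i
    unfolding n(1) by (rule Max_ge) (use that in auto)
  have char: "CHAR('k) = 0 \<or> CHAR('k) > 2 * n + 2"
    using assms(8) unfolding n(1) [symmetric] by linarith

  \<comment> \<open>Contains all weights. For j in [- n, n] the integers n + 2 - j and n + 2 + j lie
    in [2, 2n + 2], below the characteristic when that is positive.\<close>
  define J where "J = {of_int j :: 'k | j. - int n \<le> j \<and> j \<le> int n}"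
  have notJ: "of_nat n + 2 \<notin> J" "- of_nat n - 2 \<notin> J"
  proof -
    have *: "of_int t \<noteq> (0::'k)" if "0 < t" "t \<le> 2 * int n + 2" for t
    proof
      assume "of_int t = (0::'k)"
      then have d: "int CHAR('k) dvd t" by (simp only: of_int_eq_0_iff_char_dvd)
      then have "int CHAR('k) \<le> t"
        using that by (intro zdvd_imp_le)
      moreover have "CHAR('k) \<noteq> 0"
      proof
        assume "CHAR('k) = 0"
        with d that show False by simp
      qed
      ultimately show False using char that by linarith
    qed
    show "of_nat n + 2 \<notin> J"
    proof
      assume "of_nat n + 2 \<in> J"
      then obtain j where j: "- int n \<le> j" "j \<le> int n" "of_nat n + 2 = (of_int j :: 'k)" by (auto simp: J_def)
      then have "of_int (int n + 2 - j) = (0::'k)" by simp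
      with * [of "int n + 2 - j"] j show False by linarith
    qed
    show "- of_nat n - 2 \<notin> J"
    proof
      assume "- of_nat n - 2 \<in> J"
      then obtain j where j: "- int n \<le> j" "j \<le> int n" "- of_nat n - 2 = (of_int j :: 'k)" by (auto simp: J_def)
      then have "of_int (int n + 2 + j) = (0::'k)" by (simp flip: j(3))
      with * [of "int n + 2 + j"] j show False by linarith
    qed
  qed

  have D1: "app (D 1) v = s_act \<rho> PlusOne PlusOne 1 v" for v
    using app_op_nat [of PlusOne PlusOne 1] by simp
  have D1_lin: "Vector_Spaces.linear scl scl (app (D r))" for r
    by unfold_locales (simp_all add: app_add app_op_scale)
  have hw: "\<exists>x. (\<forall>j\<le>nat (- m i). x j \<in> W i \<and> \<sigma> i PlusOne PlusOne (x j) = scl' (of_int (m i + 2 * int j)) (x j)) \<and>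
      W i \<subseteq> W'.span (x ` {..nat (- m i)})" "W'.subspace (W i)"
      "\<exists>x\<in>W i. x \<noteq> 0 \<and> \<sigma> i PlusOne PlusOne x = scl' (of_int (m i)) x"
    if i: "i \<in> {1..k}" for i
  proof -
    obtain \<pi> \<xi> where \<pi>: "Sp2_rep scl' \<pi> (W i)" "Sp2_rational scl' \<pi> (W i)" "Sp2_simple scl' \<pi> (W i)"
      "Sp2_differential scl' \<pi> (W i) (\<sigma> i)" "\<xi> \<in> W i" "\<xi> \<noteq> 0"
      "\<And>t. \<pi> (unip_elt t) \<xi> = \<xi>" "\<And>t. t \<noteq> 0 \<Longrightarrow> \<pi> (torus_elt t) \<xi> = scl' (t powi m i) \<xi>"
      and eig: "\<sigma> i PlusOne PlusOne \<xi> = scl' (of_int (m i)) \<xi>"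
      using assms(6) [OF i] unfolding is_V_def by blast
    interpret sp2_module scl' \<pi> "W i" "\<sigma> i" "m i" \<xi>
      by unfold_locales (use \<pi> assms(5) [OF i] in auto)
    show "\<exists>x. (\<forall>j\<le>nat (- m i). x j \<in> W i \<and> \<sigma> i PlusOne PlusOne (x j) = scl' (of_int (m i + 2 * int j)) (x j)) \<and>
      W i \<subseteq> W'.span (x ` {..nat (- m i)})"
      by (rule weight_basis)
    show "W'.subspace (W i)" using \<pi>(1) by (simp add: Sp2_rep_def)
    show "\<exists>x\<in>W i. x \<noteq> 0 \<and> \<sigma> i PlusOne PlusOne x = scl' (of_int (m i)) x"
      using \<pi>(5,6) eig by blast
  qed
  have zero: "s_act \<rho> PlusOne PlusOne 1 0 = 0"
    using D1 [of 0] by simp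
  note sum_facts = V.vector_space_axioms assms(4,7) finite_atLeastAtMost hw(2) zero

  obtain x where x: "\<And>i j. i \<in> {1..k} \<Longrightarrow> j \<le> nat (- m i) \<Longrightarrow> x i j \<in> W i \<and> \<sigma> i PlusOne PlusOne (x i j) = scl' (of_int (m i + 2 * int j)) (x i j)"
    and xW: "\<And>i. i \<in> {1..k} \<Longrightarrow> W i \<subseteq> W'.span (x i ` {..nat (- m i)})"
    using hw(1) by metis
  have "\<exists>B. V.span B = UNIV \<and> (\<forall>v\<in>B. \<exists>c\<in>J. s_act \<rho> PlusOne PlusOne 1 v = scl c v)"
  proof (rule direct_sum_spanned_by_eigenvectors [OF sum_facts, of "\<lambda>i. x i ` {..nat (- m i)}"])
    fix i y assume i: "i \<in> {1..k}" and "y \<in> x i ` {..nat (- m i)}"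
    then obtain j where j: "j \<le> nat (- m i)" "y = x i j" by auto
    have "of_int (m i + 2 * int j) \<in> J"
      unfolding J_def using mn [OF i] j(1) assms(5) [OF i] by (intro CollectI exI [of _ "m i + 2 * int j"]) auto
    with x [OF i j(1)] j(2) show "\<exists>c\<in>J. \<sigma> i PlusOne PlusOne y = scl' c y" by blast
  qed (use x xW in auto)
  then obtain B where B: "V.span B = UNIV" "\<And>v. v \<in> B \<Longrightarrow> \<exists>c\<in>J. app (D 1) v = scl c v"
    unfolding D1 by blast
  have no_eig: "v = 0" if "app (D 1) v = scl l v" "l \<notin> J" for l v
    using FD.eigenvalue_mem [OF D1_lin B, of v l] that by blast

  \<comment> \<open>The space of weight - n, nonzero because the summand \<open>i0\<close> has
    highest weight - n.\<close>
  define S0 where "S0 = {v. app (D 1) v = scl (- of_nat n) v}"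
  obtain v0 where v0: "v0 \<noteq> 0" "v0 \<in> S0"
  proof -
    obtain y where "y \<in> W i0" "y \<noteq> 0" "\<sigma> i0 PlusOne PlusOne y = scl' (of_int (m i0)) y"
      using hw(3) [OF i0(2)] by blast
    then obtain v where "v \<noteq> 0" "s_act \<rho> PlusOne PlusOne 1 v = scl (of_int (m i0)) v"
      using direct_sum_eigenvector [OF sum_facts i0(2)] by blast
    moreover have "of_int (m i0) = (- of_nat n :: 'k)"
      using n(2) by (metis of_int_minus of_int_of_nat_eq minus_equation_iff)
    ultimately show ?thesis using that by (simp add: S0_def D1)
  qed
  \<comment> \<open>b(u) lowers the weight to - n - 2, which lies outside \<open>J\<close>.\<close>
  have B_S0: "app (op MinusOne PlusOne r) v = 0" if v: "v \<in> S0" for r v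
  proof (rule no_eig)
    let ?b = "app (op MinusOne PlusOne r) v"
    have "app (D 1 * op MinusOne PlusOne r - op MinusOne PlusOne r * D 1) v = app (- op MinusOne PlusOne r - op MinusOne PlusOne r) v"
      by (simp only: D1_B)
    then have "app (D 1) ?b - app (op MinusOne PlusOne r) (app (D 1) v) = - ?b - ?b"
      by (simp only: app_simps)
    moreover have "app (op MinusOne PlusOne r) (app (D 1) v) = scl (- of_nat n) ?b"
      using v by (simp only: S0_def mem_Collect_eq app_op_scale)
    moreover have "scl (- of_nat n - 2) ?b = scl (- of_nat n) ?b - (?b + ?b)"
      using V.scale_left_distrib [of 1 1 ?b] by (simp only: V.scale_left_diff_distrib one_add_one V.scale_one)
    ultimately show "app (D 1) ?b = scl (- of_nat n - 2) ?b"
      by (simp only: diff_eq_eq) simp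
  qed (rule notJ)
  have "\<exists>\<xi>\<in>S0. \<xi> \<noteq> 0 \<and> (\<forall>r. \<exists>c. app (D (int r)) \<xi> = scl c \<xi>)"
  proof (rule FD.exists_common_eigenvector)
    show "\<exists>z. poly p z = 0" if "degree p > 0" for p :: "'k poly"
      using that by (rule alg_closed_imp_poly_has_root)
    show "Vector_Spaces.linear scl scl (app (D (int r)))" for r by (rule D1_lin)
    show "V.subspace S0"
      by (auto intro!: V.subspaceI simp: S0_def app_add app_op_scale V.scale_right_distrib mult.commute)
    show "S0 \<noteq> {0}" using v0 by auto
    show "app (D (int r)) ` S0 \<subseteq> S0" for r
    proof safe
      fix v assume "v \<in> S0"
      moreover have "app (D 1 * D (int r) - D (int r) * D 1) v = 0"
        by (simp only: D1_D app_simps)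
      then have "app (D 1) (app (D (int r)) v) = app (D (int r)) (app (D 1) v)"
        by simp
      ultimately show "app (D (int r)) v \<in> S0"
        by (simp only: S0_def mem_Collect_eq app_op_scale)
    qed
    show "app (D (int q)) (app (D (int r)) v) = app (D (int r)) (app (D (int q)) v)" if "v \<in> S0" for q r v
      by (rule D_commute_on_singular) (rule B_S0 [OF that])
  qed
  then obtain \<xi> c where \<xi>: "\<xi> \<in> S0" "\<xi> \<noteq> 0" and c: "\<And>r. app (D (int r)) \<xi> = scl (c r) \<xi>"
    by metis
  define \<mu> where "\<mu> = Abs_fps c"
  have \<mu>0: "fps_nth \<mu> 0 = 1"
    using c [of 0] \<xi>(2) by (simp add: \<mu>_def op_zero app_E_one)
      (metis V.scale_cancel_right V.scale_one)
  have \<mu>1: "fps_nth \<mu> 1 = - of_nat n"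
  proof -
    have "scl (c 1) \<xi> = scl (- of_nat n) \<xi>"
      using c [of 1] \<xi>(1) by (simp add: S0_def)
    then have "c 1 = - of_nat n"
      by (rule V.scale_right_imp_eq [OF \<xi>(2)])
    then show ?thesis by (simp add: \<mu>_def)
  qed
  obtain P where P: "P \<noteq> 0" "\<And>x. \<exists>c. app P x = scl c \<xi>"
    using rank_one_endo [OF \<xi>(2)] by blast
  interpret twisted_hw scl \<rho> P \<mu>
  proof
    show "op MinusOne PlusOne 1 * P = 0"
    proof (rule endo_eqI)
      fix x obtain a where "app P x = scl a \<xi>" using P(2) by blast
      then show "app (op MinusOne PlusOne 1 * P) x = app 0 x"
        using B_S0 [OF \<xi>(1), of 1] by (simp add: app_op_scale)
    qed
    show "D (int r) * P = scalar (fps_nth \<mu> r) * P" for r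
    proof (rule endo_eqI)
      fix x obtain a where "app P x = scl a \<xi>" using P(2) by blast
      then show "app (D (int r) * P) x = app (scalar (fps_nth \<mu> r) * P) x"
        by (simp add: app_op_scale c \<mu>_def mult.commute)
    qed
  qed
  \<comment> \<open>A prime that divides (n + 1)! is at most n + 1, whereas a positive
    characteristic exceeds 2n + 2.\<close>
  have fact: "of_nat (fact (Suc n)) \<noteq> (0::'k)"
  proof
    assume "of_nat (fact (Suc n)) = (0::'k)"
    then have d: "CHAR('k) dvd fact (Suc n)" by (simp only: of_nat_eq_0_iff_char_dvd)
    then have p: "CHAR('k) > 0" by (metis dvd_0_left_iff fact_nonzero gr0I)
    then have "prime CHAR('k)" by (rule prime_CHAR_semidom)
    with d have "CHAR('k) \<le> Suc n" by (simp only: prime_dvd_fact_iff)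
    with char p show False by linarith
  qed
  obtain Q Z where "Q \<noteq> 0" "finite Z"
    "\<And>v. v \<in> UU \<Longrightarrow> v\<^sup>2 \<notin> Z \<Longrightarrow> muS \<mu> v * poly Q (v\<^sup>2 + v) = muS \<mu> (- v) * poly Q (v\<^sup>2 - v)"
    using exists_Q_series [OF P(1) \<mu>1 fact no_eig [OF _ notJ(1)]] by blast
  then have "\<exists>P :: 'k poly. lead_coeff P = 1 \<and> P = pcompose P [:1, - 1:] \<and>
    fps_to_fls (neg_u \<mu>) / fps_to_fls \<mu> = poly_in_u (pcompose P [:1, 1:]) / poly_in_u P"
    by (intro exists_P [OF infinite_alg_closed_field _ _ _ \<mu>0])
  moreover have "highest_weight_rep scl \<rho> \<mu>"
    unfolding highest_weight_rep_def
  proof (intro conjI exI [of _ \<xi>] allI impI)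
    show "U = UNIV" if "yangian_submodule scl \<rho> U \<and> \<xi> \<in> U" for U
      using irr(3) [of U] that \<xi>(2) by auto
    show "s_act \<rho> MinusOne PlusOne r \<xi> = 0" for r
      using B_S0 [OF \<xi>(1), of "int r"] by (simp add: app_op_nat)
    show "s_act \<rho> PlusOne PlusOne r \<xi> = scl (fps_nth \<mu> r) \<xi>" for r
      using c [of r] by (simp add: app_op_nat \<mu>_def)
  qed (use irr \<xi> in auto)
  ultimately show ?thesis
    using \<mu>0 assms(2) by blast
qed

end
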